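(* Let $u$ be a stable (classical) solution in $\mathbb{R}^2$ of $$\Delta u=0\ \text{ in } \Omega:=\{-1<u<1\},\qquad u=\pm1\ \text{ outside }\Omega,\qquad |\nabla u|=1\ \text{ on }\partial\Omega .$$ Then there exists a unit vector $e$ such that $u(x)\equiv u(x\cdot e)$, that is, $u$ depends only on the variable $x\cdot e$.
   Context: A solution is always understood as a classical solution: $\Omega=\{-1<u<1\}$ is an open domain in $\mathbb{R}^2$ with smooth boundary, $u\in C(\mathbb{R}^2)\cap C^2(\overline\Omega)$, and the equation and the boundary conditions hold pointwise (on $\partial\Omega$ the gradient is taken from inside $\Omega$). Let $\nu$ be the unit normal of $\partial\Omega$ pointing into $\Omega^c$ and $H$ the (mean) curvature of $\partial\Omega$ with respect to $\nu$, with the sign convention that $H\ge0$ where $\Omega^c$ is locally convex. The solution $u$ is stable if for every $\eta\in C_0^\infty(\mathbb{R}^2)$, $$\int_\Omega|\nabla\eta|^2\ge\int_{\partial\Omega}H\eta^2 .$$ *)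

theory Defs
  imports "HOL-Analysis.Analysis"
begin

section \<open>Differential operators and smoothness classes\<close>

definition dir_deriv :: "'a::real_normed_vector \<Rightarrow> ('a \<Rightarrow> real) \<Rightarrow> 'a \<Rightarrow> real" where
  "dir_deriv v f x = frechet_derivative f (at x) v"

definition grad :: "('a::euclidean_space \<Rightarrow> real) \<Rightarrow> 'a \<Rightarrow> 'a" where
  "grad f x = (\<Sum>i\<in>Basis. dir_deriv i f x *\<^sub>R i)"

definition laplacian :: "('a::euclidean_space \<Rightarrow> real) \<Rightarrow> 'a \<Rightarrow> real" where
  "laplacian f x = (\<Sum>i\<in>Basis. dir_deriv i (dir_deriv i f) x)"

text \<open>The class \<open>C\<^sup>k(S)\<close>, for open \<open>S\<close>.\<close>
primrec Ck_on :: "nat \<Rightarrow> ('a::real_normed_vector \<Rightarrow> real) \<Rightarrow> 'a set \<Rightarrow> bool" where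
  "Ck_on 0 f S \<longleftrightarrow> continuous_on S f"
| "Ck_on (Suc k) f S \<longleftrightarrow>
     (\<forall>x\<in>S. f differentiable (at x)) \<and> (\<forall>v. Ck_on k (dir_deriv v f) S)"

definition smooth_on :: "('a::real_normed_vector \<Rightarrow> real) \<Rightarrow> 'a set \<Rightarrow> bool" where
  "smooth_on f S \<longleftrightarrow> (\<forall>k. Ck_on k f S)"

text \<open>The class \<open>C\<^sup>k\<close> of the closure of an open set \<open>S\<close>: \<open>f\<close> is \<open>C\<^sup>k\<close> in \<open>S\<close> and all its
  derivatives of order at most \<open>k\<close> extend continuously from \<open>S\<close> to \<open>closure S\<close>.\<close>
primrec Ck_closure :: "nat \<Rightarrow> ('a::real_normed_vector \<Rightarrow> real) \<Rightarrow> 'a set \<Rightarrow> bool" where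
  "Ck_closure 0 f S \<longleftrightarrow> (\<exists>g. continuous_on (closure S) g \<and> (\<forall>x\<in>S. g x = f x))"
| "Ck_closure (Suc k) f S \<longleftrightarrow>
     (\<exists>g. continuous_on (closure S) g \<and> (\<forall>x\<in>S. g x = f x)) \<and>
     (\<forall>x\<in>S. f differentiable (at x)) \<and> (\<forall>v. Ck_closure k (dir_deriv v f) S)"

definition test_function :: "('a::real_normed_vector \<Rightarrow> real) \<Rightarrow> bool" where
  "test_function \<eta> \<longleftrightarrow> smooth_on \<eta> UNIV \<and> compact (closure {x. \<eta> x \<noteq> 0})"

section \<open>Smooth boundaries, normal and curvature\<close>

text \<open>\<open>\<rho>\<close> is a smooth defining function of \<open>\<Omega>\<close> in the neighbourhood \<open>U\<close> of \<open>p\<close>. As its gradient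
  does not vanish, \<open>frontier \<Omega> \<inter> U = {x \<in> U. \<rho> x = 0}\<close>, and \<open>\<Omega>\<close> lies on one side of its
  boundary in \<open>U\<close>.\<close>
definition defining_function ::
    "'a::euclidean_space set \<Rightarrow> 'a \<Rightarrow> 'a set \<Rightarrow> ('a \<Rightarrow> real) \<Rightarrow> bool" where
  "defining_function \<Omega> p U \<rho> \<longleftrightarrow>
     open U \<and> p \<in> U \<and> smooth_on \<rho> U \<and>
     (\<forall>x\<in>U. grad \<rho> x \<noteq> 0) \<and> (\<forall>x\<in>U. x \<in> \<Omega> \<longleftrightarrow> \<rho> x < 0)"

definition smooth_boundary :: "'a::euclidean_space set \<Rightarrow> bool" where
  "smooth_boundary \<Omega> \<longleftrightarrow> (\<forall>p\<in>frontier \<Omega>. \<exists>U \<rho>. defining_function \<Omega> p U \<rho>)"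

text \<open>The unit normal at \<open>p \<in> frontier \<Omega>\<close> pointing into the complement of \<open>\<Omega>\<close>; it does not depend
  on the defining function.\<close>
definition outward_normal :: "'a::euclidean_space set \<Rightarrow> 'a \<Rightarrow> 'a" where
  "outward_normal \<Omega> p =
     (THE n. \<exists>U \<rho>. defining_function \<Omega> p U \<rho> \<and> n = grad \<rho> p /\<^sub>R norm (grad \<rho> p))"

text \<open>The curvature \<open>H\<close> of the planar curve \<open>frontier \<Omega>\<close> at \<open>p\<close>: if \<open>\<gamma>\<close> is an arc-length
  parametrization of the curve with \<open>\<gamma> 0 = p\<close>, then \<open>\<gamma>'' = H \<nu>\<close> at \<open>0\<close>, with \<open>\<nu>\<close> the normal pointing
  into the complement. Thus \<open>H \<ge> 0\<close> where the curve bends towards the complement, i.e. where the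
  complement is locally convex; if the complement is a disc of radius \<open>r\<close>, then \<open>H = 1 / r\<close>.\<close>
definition boundary_curvature :: "(real^2) set \<Rightarrow> real^2 \<Rightarrow> real" where
  "boundary_curvature \<Omega> p =
     (THE k. \<exists>\<epsilon>>0. \<exists>\<gamma> \<gamma>'. \<gamma> 0 = p \<and>
        (\<forall>t\<in>{-\<epsilon><..<\<epsilon>}. \<gamma> t \<in> frontier \<Omega> \<and>
            (\<gamma> has_vector_derivative \<gamma>' t) (at t) \<and> norm (\<gamma>' t) = 1) \<and>
        (\<gamma>' has_vector_derivative k *\<^sub>R outward_normal \<Omega> p) (at 0))"

section \<open>Arc length\<close>

text \<open>Arc length on \<open>frontier \<Omega>\<close> is the restriction of the one-dimensional Hausdorff measure, which
  in dimension one needs no normalizing constant. Covers consist of bounded sets because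
  \<^const>\<open>diameter\<close> is meaningless on unbounded ones.\<close>
definition hausdorff1_cover :: "real \<Rightarrow> 'a::metric_space set \<Rightarrow> (nat \<Rightarrow> 'a set) \<Rightarrow> bool" where
  "hausdorff1_cover \<delta> A C \<longleftrightarrow> A \<subseteq> (\<Union>i. C i) \<and> (\<forall>i. bounded (C i) \<and> diameter (C i) \<le> \<delta>)"

definition hausdorff1_outer :: "'a::metric_space set \<Rightarrow> ennreal" where
  "hausdorff1_outer A =
     (SUP \<delta>\<in>{0<..}. INF C\<in>Collect (hausdorff1_cover \<delta> A). \<Sum>i. ennreal (diameter (C i)))"

definition hausdorff1 :: "'a::metric_space measure" where
  "hausdorff1 = measure_of UNIV (sets borel) hausdorff1_outer"

section \<open>The free boundary problem\<close>

definition transition_region :: "(real^2 \<Rightarrow> real) \<Rightarrow> (real^2) set" where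
  "transition_region u = {x. -1 < u x \<and> u x < 1}"

text \<open>On the free boundary the gradient is the limit of the gradient from inside \<open>\<Omega>\<close>.\<close>
definition classical_solution :: "(real^2 \<Rightarrow> real) \<Rightarrow> bool" where
  "classical_solution u \<longleftrightarrow>
     (let \<Omega> = transition_region u in
        open \<Omega> \<and> smooth_boundary \<Omega> \<and> continuous_on UNIV u \<and> Ck_closure 2 u \<Omega> \<and>
        (\<forall>x\<in>\<Omega>. laplacian u x = 0) \<and>
        (\<forall>x. x \<notin> \<Omega> \<longrightarrow> u x = 1 \<or> u x = -1) \<and>
        (\<forall>x\<in>frontier \<Omega>. \<exists>g. (grad u \<longlongrightarrow> g) (at x within \<Omega>) \<and> norm g = 1))"

definition stable_solution :: "(real^2 \<Rightarrow> real) \<Rightarrow> bool" where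
  "stable_solution u \<longleftrightarrow>
     (let \<Omega> = transition_region u in
        \<forall>\<eta>. test_function \<eta> \<longrightarrow>
          (LINT x:\<Omega>|lborel. (norm (grad \<eta> x))\<^sup>2) \<ge>
          (LINT x:frontier \<Omega>|hausdorff1. boundary_curvature \<Omega> x * (\<eta> x)\<^sup>2))"

end

theory Submission
  imports Defs "HOL-Complex_Analysis.Complex_Analysis"
begin

text \<open>
  Write \<open>G\<close> for the gradient and \<open>D\<^sup>2u\<close> for the Hessian of \<open>u\<close>, and let \<open>Y = D\<^sup>2u G\<close>, which is the
  gradient of \<open>|G|\<^sup>2 / 2\<close>. The idea is that the boundary term of the stability inequality is the flux of
  \<open>Y\<close>. Differentiating \<open>G \<bullet> \<gamma>' = 0\<close> along an arc-length parametrization \<open>\<gamma>\<close> of the free boundary gives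
  \<open>H = Y \<bullet> \<nu>\<close> (\<open>boundary_curvature_H\<close>), because \<open>\<nu> = u G\<close> there and the Hessian is trace free.
  Moreover \<open>div Y = |D\<^sup>2u|\<^sup>2\<close>, since \<open>u\<close> is harmonic. By the divergence theorem for \<open>\<phi>\<^sup>2 Y\<close>
  (\<open>curvature_identity\<close>), stability tested with \<open>\<phi>\<close> reads
  \<open>\<integral>\<^sub>\<Omega> |D\<^sup>2u|\<^sup>2 \<phi>\<^sup>2 + 2 \<phi> \<nabla>\<phi> \<bullet> Y \<le> \<integral>\<^sub>\<Omega> |\<nabla>\<phi>|\<^sup>2\<close>.
  In the plane \<open>2 |Y|\<^sup>2 = |D\<^sup>2u|\<^sup>2 |G|\<^sup>2\<close>. If \<open>|G|\<close> is bounded, the mixed term can be absorbed, so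
  \<open>\<integral>\<^sub>\<Omega> |D\<^sup>2u|\<^sup>2 \<phi>\<^sup>2\<close> is at most a constant times \<open>\<integral> |\<nabla>\<phi>|\<^sup>2\<close> (\<open>hessian_energy_bound\<close>). Logarithmic
  cut-offs (\<open>log_cutoff\<close>) make this arbitrarily small while \<open>\<phi> = 1\<close> near a given point. Hence
  \<open>D\<^sup>2u = 0\<close> in \<open>\<Omega>\<close>.

  The bound \<open>|G| \<le> 4\<close> (\<open>gradient_bound\<close>) comes from the free boundary condition. Let \<open>x\<close> have
  distance \<open>r\<close> to a nearest free boundary point \<open>y\<close>, and let \<open>W = 1 - u(y) u\<close>, a positive harmonic
  function on the disc of radius \<open>r\<close> around \<open>x\<close> that vanishes at \<open>y\<close>. Harnack's inequality bounds the
  slope of \<open>W\<close> at \<open>y\<close> below by \<open>W(x) / (2 r)\<close>. As this slope is at most 1, \<open>W(x) \<le> 2 r\<close>, and the gradient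
  estimate for positive harmonic functions gives \<open>|G(x)| \<le> 2 W(x) / r \<le> 4\<close>.

  If the Hessian vanishes, \<open>u\<close> is affine on each component of \<open>\<Omega>\<close>. A component that has a boundary has
  slope 1 and is a whole strip between two level lines (\<open>component_strip\<close>). Different strips are
  disjoint, hence parallel, and \<open>u\<close> is constant on every line in their common direction
  (\<open>one_dimensional\<close>).

  The divergence theorem up to the boundary is obtained from the plane. A cut-off \<open>Z k\<close>, a function of
  \<open>k (1 - u\<^sup>2)\<close>, makes \<open>Z k \<phi>\<^sup>2 Y\<close> a compactly supported field of class \<open>C\<^sup>1\<close> on the plane, whose divergence
  has integral zero. The derivative of \<open>Z k\<close> contributes the integral of \<open>H \<phi>\<^sup>2\<close> against a density \<open>q k\<close>
  that concentrates on the free boundary, and it remains to see that \<open>q k dx\<close> converges weakly to arc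
  length (\<open>weak_limit\<close>). This is local: near a boundary point \<open>\<Omega>\<close> lies below the graph of a function
  with slope at most \<open>\<epsilon>\<close>; there \<open>q k\<close> is, up to a factor \<open>1 \<plusminus> \<epsilon>\<close>, the normal derivative of \<open>Z k\<close>, whose
  integral along normal lines is computed exactly, and arc length is comparable to Lebesgue measure of
  the tangential coordinate up to the same kind of factor. A partition of unity and \<open>\<epsilon> \<longrightarrow> 0\<close> finish.
\<close>

section \<open>The one-dimensional Hausdorff measure\<close>

lemma diameter_empty_ennreal [simp]: "ennreal (diameter {}) = 0"
  by (simp add: diameter_def)

text \<open>The pre-measures whose supremum over all \<open>\<delta>\<close> is the Hausdorff outer measure.\<close>
definition hausdorff1_content :: "real \<Rightarrow> 'a::metric_space set \<Rightarrow> ennreal" where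
  "hausdorff1_content \<delta> A = (INF C\<in>Collect (hausdorff1_cover \<delta> A). \<Sum>i. ennreal (diameter (C i)))"

lemma hausdorff1_outer_eq: "hausdorff1_outer A = (SUP \<delta>\<in>{0<..}. hausdorff1_content \<delta> A)"
  by (simp add: hausdorff1_outer_def hausdorff1_content_def)

lemma hausdorff1_content_le:
  assumes "hausdorff1_cover \<delta> A C"
  shows "hausdorff1_content \<delta> A \<le> (\<Sum>i. ennreal (diameter (C i)))"
  unfolding hausdorff1_content_def using assms by (intro INF_lower) auto

lemma hausdorff1_content_antimono:
  "\<delta>' \<le> \<delta> \<Longrightarrow> hausdorff1_content \<delta> A \<le> hausdorff1_content \<delta>' A"
  unfolding hausdorff1_content_def
proof (intro INF_superset_mono subsetI)
  fix C assume "\<delta>' \<le> \<delta>" "C \<in> Collect (hausdorff1_cover \<delta>' A)"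
  then have "A \<subseteq> (\<Union>i. C i)" "\<And>i. bounded (C i)" "\<And>i. diameter (C i) \<le> \<delta>"
    unfolding hausdorff1_cover_def by (simp_all, meson order_trans)
  then show "C \<in> Collect (hausdorff1_cover \<delta> A)" by (simp add: hausdorff1_cover_def)
qed simp

lemma hausdorff1_content_le_outer: "0 < \<delta> \<Longrightarrow> hausdorff1_content \<delta> A \<le> hausdorff1_outer A"
  unfolding hausdorff1_outer_eq by (intro SUP_upper) auto

lemma hausdorff1_content_mono:
  "A \<subseteq> B \<Longrightarrow> hausdorff1_content \<delta> A \<le> hausdorff1_content \<delta> B"
  unfolding hausdorff1_content_def
proof (intro INF_superset_mono subsetI)
  fix C assume "A \<subseteq> B" "C \<in> Collect (hausdorff1_cover \<delta> B)"
  then have "A \<subseteq> (\<Union>i. C i)" "\<And>i. bounded (C i)" "\<And>i. diameter (C i) \<le> \<delta>"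
    unfolding hausdorff1_cover_def by (blast, simp_all)
  then show "C \<in> Collect (hausdorff1_cover \<delta> A)" by (simp add: hausdorff1_cover_def)
qed simp

lemma hausdorff1_outer_mono: "A \<subseteq> B \<Longrightarrow> hausdorff1_outer A \<le> hausdorff1_outer B"
  unfolding hausdorff1_outer_eq by (intro SUP_mono' hausdorff1_content_mono)

lemma hausdorff1_outer_empty [simp]: "hausdorff1_outer {} = 0"
proof -
  have "hausdorff1_content \<delta> {} \<le> 0" if "0 < \<delta>" for \<delta> :: real
    using hausdorff1_content_le[of \<delta> "{}" "\<lambda>_. {}"] that
    by (simp add: hausdorff1_cover_def diameter_def)
  then have "hausdorff1_outer ({} :: 'a set) \<le> 0"
    unfolding hausdorff1_outer_eq by (intro SUP_least) auto
  then show ?thesis by simp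
qed

text \<open>Covers of the single sets, nearly optimal up to \<open>e / 2^(i+1)\<close>, are merged into one cover along a
  bijection of the pairs of natural numbers with the natural numbers.\<close>
lemma hausdorff1_content_UN:
  assumes "0 < \<delta>"
  shows "hausdorff1_content \<delta> (\<Union>i. A i) \<le> (\<Sum>i. hausdorff1_content \<delta> (A i))"
proof (rule ennreal_le_epsilon)
  fix e :: real assume fin: "(\<Sum>i. hausdorff1_content \<delta> (A i)) < top" and e: "0 < e"
  have fini: "hausdorff1_content \<delta> (A i) < top" for i
    using fin by (meson ennreal_suminf_lessD)
  have "\<exists>C. hausdorff1_cover \<delta> (A i) C \<and>
          (\<Sum>j. ennreal (diameter (C j))) \<le> hausdorff1_content \<delta> (A i) + ennreal (e * (1/2) ^ Suc i)" for i
  proof -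
    have "hausdorff1_content \<delta> (A i) < hausdorff1_content \<delta> (A i) + ennreal (e * (1/2) ^ Suc i)"
      using fini[of i] e ennreal_add_left_cancel_less[of _ 0] by (simp add: less_top ennreal_zero_less_mult_iff)
    then show ?thesis
      unfolding hausdorff1_content_def INF_less_iff by (auto intro: less_imp_le)
  qed
  then obtain C where C: "\<And>i. hausdorff1_cover \<delta> (A i) (C i)"
     "\<And>i. (\<Sum>j. ennreal (diameter (C i j))) \<le> hausdorff1_content \<delta> (A i) + ennreal (e * (1/2) ^ Suc i)"
    by metis
  define D where "D k = (case prod_decode k of (i, j) \<Rightarrow> C i j)" for k
  have "hausdorff1_cover \<delta> (\<Union>i. A i) D"
    unfolding hausdorff1_cover_def
  proof
    show "(\<Union>i. A i) \<subseteq> (\<Union>k. D k)"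
    proof
      fix x assume "x \<in> (\<Union>i. A i)"
      then obtain i j where "x \<in> C i j" using C(1) unfolding hausdorff1_cover_def by blast
      then have "x \<in> D (prod_encode (i, j))" by (simp add: D_def)
      then show "x \<in> (\<Union>k. D k)" by blast
    qed
    show "\<forall>k. bounded (D k) \<and> diameter (D k) \<le> \<delta>"
      using C(1) by (auto simp: D_def hausdorff1_cover_def split: prod.split)
  qed
  then have "hausdorff1_content \<delta> (\<Union>i. A i) \<le> (\<Sum>k. ennreal (diameter (D k)))"
    by (rule hausdorff1_content_le)
  also have "\<dots> = (\<Sum>k. (\<lambda>(i,j). ennreal (diameter (C i j))) (prod_decode k))"
    by (intro suminf_cong) (simp add: D_def split: prod.split)
  also have "\<dots> = (\<Sum>i. \<Sum>j. ennreal (diameter (C i j)))"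
    by (intro suminf_ennreal_2dimen) auto
  also have "\<dots> \<le> (\<Sum>i. hausdorff1_content \<delta> (A i) + ennreal (e * (1/2) ^ Suc i))"
    by (intro suminf_le C(2)) auto
  also have "\<dots> = (\<Sum>i. hausdorff1_content \<delta> (A i)) + (\<Sum>i. ennreal (e * (1/2) ^ Suc i))"
    by (subst suminf_add[symmetric]) auto
  also have "(\<Sum>i. ennreal (e * (1/2) ^ Suc i)) = ennreal e"
  proof -
    have "(\<lambda>i. e * (1/2) ^ Suc i) sums (e * 1)"
      by (intro sums_mult power_half_series)
    then show ?thesis using e
      by (intro sums_unique[symmetric]) (subst sums_ennreal, auto)
  qed
  finally show "hausdorff1_content \<delta> (\<Union>i. A i) \<le> (\<Sum>i. hausdorff1_content \<delta> (A i)) + ennreal e" .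
qed

lemma hausdorff1_outer_UN: "hausdorff1_outer (\<Union>i. A i) \<le> (\<Sum>i. hausdorff1_outer (A i))"
  unfolding hausdorff1_outer_eq[of "\<Union>i. A i"]
proof (rule SUP_least)
  fix \<delta> :: real assume "\<delta> \<in> {0<..}"
  then have "hausdorff1_content \<delta> (\<Union>i. A i) \<le> (\<Sum>i. hausdorff1_content \<delta> (A i))"
    by (intro hausdorff1_content_UN) auto
  also have "\<dots> \<le> (\<Sum>i. hausdorff1_outer (A i))"
    using \<open>\<delta> \<in> {0<..}\<close> by (intro suminf_le hausdorff1_content_le_outer) auto
  finally show "hausdorff1_content \<delta> (\<Union>i. A i) \<le> (\<Sum>i. hausdorff1_outer (A i))" .
qed

lemma hausdorff1_outer_space:
  "outer_measure_space UNIV (hausdorff1_outer :: 'a::metric_space set \<Rightarrow> ennreal)"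
  unfolding outer_measure_space_def positive_def increasing_def countably_subadditive_def
  by (auto intro: hausdorff1_outer_mono hausdorff1_outer_UN)

lemma hausdorff1_outer_Un: "hausdorff1_outer (A \<union> B) \<le> hausdorff1_outer A + hausdorff1_outer B"
proof -
  have "hausdorff1_outer (A \<union> B) = hausdorff1_outer (\<Union>i. binaryset A B i)"
    by (simp add: UN_binaryset_eq)
  also have "\<dots> \<le> (\<Sum>i. hausdorff1_outer (binaryset A B i))" by (rule hausdorff1_outer_UN)
  also have "\<dots> = hausdorff1_outer A + hausdorff1_outer B"
    by (intro suminf_binaryset_eq) auto
  finally show ?thesis .
qed

text \<open>A covering set of diameter less than \<open>\<sigma>\<close> meets at most one of two sets at distance \<open>\<sigma>\<close>, so a fine
  cover of the union splits into covers of the two sets. This metric additivity is what makes Borel sets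
  measurable.\<close>
lemma hausdorff1_outer_separated:
  fixes A B :: "'a::metric_space set"
  assumes "0 < \<sigma>" and sep: "\<And>x y. x \<in> A \<Longrightarrow> y \<in> B \<Longrightarrow> \<sigma> \<le> dist x y"
  shows "hausdorff1_outer A + hausdorff1_outer B \<le> hausdorff1_outer (A \<union> B)"
proof -
  have *: "hausdorff1_content \<delta> A + hausdorff1_content \<delta> B \<le> hausdorff1_outer (A \<union> B)"
    if \<delta>: "0 < \<delta>" "\<delta> < \<sigma>" for \<delta>
  proof -
    have "hausdorff1_content \<delta> A + hausdorff1_content \<delta> B \<le> hausdorff1_content \<delta> (A \<union> B)"
      unfolding hausdorff1_content_def[of \<delta> "A \<union> B"]
    proof (rule INF_greatest)
      fix C assume "C \<in> Collect (hausdorff1_cover \<delta> (A \<union> B))"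
      then have C: "hausdorff1_cover \<delta> (A \<union> B) C" by simp
      define CA where "CA i = (if C i \<inter> A = {} then {} else C i)" for i
      define CB where "CB i = (if C i \<inter> B = {} then {} else C i)" for i
      have cov: "hausdorff1_cover \<delta> A CA" "hausdorff1_cover \<delta> B CB"
      proof -
        have C': "A \<union> B \<subseteq> (\<Union>i. C i)" "\<And>i. bounded (C i)" "\<And>i. diameter (C i) \<le> \<delta>"
          using C unfolding hausdorff1_cover_def by auto
        have "A \<subseteq> (\<Union>i. CA i)" "B \<subseteq> (\<Union>i. CB i)"
          using C'(1) unfolding CA_def CB_def by fastforce+
        moreover have "bounded (CA i) \<and> diameter (CA i) \<le> \<delta>" "bounded (CB i) \<and> diameter (CB i) \<le> \<delta>" for i
          using C'(2,3) \<delta> by (auto simp: CA_def CB_def diameter_def[of "{}"])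
        ultimately show "hausdorff1_cover \<delta> A CA" "hausdorff1_cover \<delta> B CB"
          unfolding hausdorff1_cover_def by blast+
      qed
      from cov have "hausdorff1_content \<delta> A + hausdorff1_content \<delta> B
          \<le> (\<Sum>i. ennreal (diameter (CA i))) + (\<Sum>i. ennreal (diameter (CB i)))"
        by (intro add_mono hausdorff1_content_le)
      also have "\<dots> = (\<Sum>i. ennreal (diameter (CA i)) + ennreal (diameter (CB i)))"
        by (subst suminf_add[symmetric]) auto
      also have "\<dots> \<le> (\<Sum>i. ennreal (diameter (C i)))"
      proof (intro suminf_le allI)
        fix i
        have "C i \<inter> A = {} \<or> C i \<inter> B = {}"
        proof (rule ccontr)
          assume "\<not> ?thesis"
          then obtain x y where xy: "x \<in> C i" "x \<in> A" "y \<in> C i" "y \<in> B" by auto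
          have "dist x y \<le> diameter (C i)"
            using C xy by (intro diameter_bounded_bound) (auto simp: hausdorff1_cover_def)
          also have "\<dots> \<le> \<delta>" using C by (auto simp: hausdorff1_cover_def)
          finally show False using sep[of x y] xy \<delta> by simp
        qed
        then show "ennreal (diameter (CA i)) + ennreal (diameter (CB i)) \<le> ennreal (diameter (C i))"
          by (auto simp: CA_def CB_def)
      qed auto
      finally show "hausdorff1_content \<delta> A + hausdorff1_content \<delta> B \<le> (\<Sum>i. ennreal (diameter (C i)))" .
    qed
    also have "\<dots> \<le> hausdorff1_outer (A \<union> B)" using \<delta> by (intro hausdorff1_content_le_outer)
    finally show ?thesis .
  qed
  have "hausdorff1_outer A + hausdorff1_outer B
      = (SUP \<delta>\<in>{0<..}. hausdorff1_content \<delta> A + hausdorff1_content \<delta> B)"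
    unfolding hausdorff1_outer_eq
  proof (rule SUP_add_directed_ennreal[symmetric])
    fix i j :: real assume "i \<in> {0<..}" "j \<in> {0<..}"
    then show "\<exists>k\<in>{0<..}. hausdorff1_content i A + hausdorff1_content j B
       \<le> hausdorff1_content k A + hausdorff1_content k B"
      by (intro bexI[of _ "min i j"] add_mono hausdorff1_content_antimono) auto
  qed
  also have "\<dots> \<le> hausdorff1_outer (A \<union> B)"
  proof (rule SUP_least)
    fix \<delta> :: real assume "\<delta> \<in> {0<..}"
    then have "hausdorff1_content \<delta> A + hausdorff1_content \<delta> B
       \<le> hausdorff1_content (min \<delta> (\<sigma>/2)) A + hausdorff1_content (min \<delta> (\<sigma>/2)) B"
      by (intro add_mono hausdorff1_content_antimono) auto
    also have "\<dots> \<le> hausdorff1_outer (A \<union> B)"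
      using assms(1) \<open>\<delta> \<in> {0<..}\<close> by (intro *) auto
    finally show "hausdorff1_content \<delta> A + hausdorff1_content \<delta> B \<le> hausdorff1_outer (A \<union> B)" .
  qed
  finally show ?thesis .
qed

text \<open>The points of \<open>A\<close> outside \<open>F\<close> are exhausted by sets at positive distance from \<open>F\<close>. The measure of
  the successive differences is summable because rings of equal parity are separated from each other,
  so the tail of this sum bounds what the \<open>n\<close>-th set misses.\<close>
lemma hausdorff1_outer_rings:
  fixes F A :: "'a::metric_space set"
  assumes "closed F" and fin: "hausdorff1_outer A < top"
  defines "E n \<equiv> {x\<in>A - F. 1 / real (Suc n) \<le> infdist x F}"
  assumes ne: "F \<noteq> {}"
  shows "hausdorff1_outer (A - F) \<le> (SUP n. hausdorff1_outer (E n))"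
proof -
  define R where "R n = E (Suc n) - E n" for n
  have E_mono: "E n \<subseteq> E m" if "n \<le> m" for n m
  proof -
    have "1 / real (Suc m) \<le> 1 / real (Suc n)" using that by (simp add: field_simps)
    then show ?thesis unfolding E_def by (auto intro: order_trans)
  qed
  have Rx: "x \<in> A" "1 / real (Suc (Suc n)) \<le> infdist x F" "infdist x F < 1 / real (Suc n)" if "x \<in> R n" for x n
    using that unfolding R_def E_def by auto
  have cover: "A - F \<subseteq> E n \<union> (\<Union>m. R (n + m))" for n
  proof
    fix x assume x: "x \<in> A - F"
    then have "infdist x F > 0"
      using assms(1) ne by (metis DiffD2 in_closed_iff_infdist_zero infdist_nonneg less_eq_real_def)
    then obtain k where "1 / real (Suc k) < infdist x F" by (metis nat_approx_posE)
    then have ex: "x \<in> E k" using x by (auto simp: E_def)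
    show "x \<in> E n \<union> (\<Union>m. R (n + m))"
    proof (cases "x \<in> E n")
      case False
      define j where "j = (LEAST j. x \<in> E j)"
      have j: "x \<in> E j" unfolding j_def using ex by (rule LeastI)
      have "n < j" using False j E_mono[of j n] by (metis not_le subsetD)
      then obtain m where m: "j = Suc (n + m)" by (metis less_iff_Suc_add)
      have "x \<notin> E (n + m)" unfolding j_def using not_less_Least[of "n + m" "\<lambda>j. x \<in> E j"] m j_def by simp
      then show ?thesis using j m by (auto simp: R_def)
    qed auto
  qed
  \<comment> \<open>rings of the same parity are at positive distance from each other\<close>
  have par: "(\<Sum>i<N. hausdorff1_outer (R (2 * i + c))) \<le> hausdorff1_outer (\<Union>i<N. R (2 * i + c))" for N c
  proof (induction N)
    case (Suc N)
    have "(\<Sum>i<Suc N. hausdorff1_outer (R (2 * i + c)))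
        \<le> hausdorff1_outer (\<Union>i<N. R (2 * i + c)) + hausdorff1_outer (R (2 * N + c))"
      using Suc by (simp add: add_mono)
    also have "\<dots> \<le> hausdorff1_outer ((\<Union>i<N. R (2 * i + c)) \<union> R (2 * N + c))"
    proof (rule hausdorff1_outer_separated)
      \<comment> \<open>the ring before the last one separates the last ring from the earlier ones; for \<open>N = 0\<close> there are
        no earlier rings and any positive number will do\<close>
      define \<sigma> where "\<sigma> = 1 / real (2 * N + c) - 1 / real (Suc (2 * N + c))"
      define \<sigma>' where "\<sigma>' = (if N = 0 then 1 else \<sigma>)"
      show "0 < \<sigma>'" unfolding \<sigma>'_def \<sigma>_def
        by (auto intro!: divide_strict_left_mono mult_pos_pos)
      fix x y assume x: "x \<in> (\<Union>i<N. R (2 * i + c))" and y: "y \<in> R (2 * N + c)"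
      then obtain i where i: "i < N" "x \<in> R (2 * i + c)" by auto
      have "1 / real (2 * N + c) \<le> 1 / real (Suc (Suc (2 * i + c)))"
        using i by (intro divide_left_mono) auto
      then have "1 / real (2 * N + c) \<le> infdist x F" using Rx(2)[OF i(2)] by linarith
      moreover have "infdist y F < 1 / real (Suc (2 * N + c))" using Rx(3)[OF y] .
      moreover have "infdist x F \<le> infdist y F + dist x y" by (rule infdist_triangle)
      ultimately show "\<sigma>' \<le> dist x y" using i by (simp add: \<sigma>'_def \<sigma>_def)
    qed
    also have "(\<Union>i<N. R (2 * i + c)) \<union> R (2 * N + c) = (\<Union>i<Suc N. R (2 * i + c))"
      by (auto simp: less_Suc_eq)
    finally show ?case .
  qed simp
  have sumpar: "(\<Sum>i. hausdorff1_outer (R (2 * i + c))) \<le> hausdorff1_outer A" for c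
  proof (rule suminf_le_const)
    fix N
    have "(\<Union>i<N. R (2 * i + c)) \<subseteq> A" using Rx(1) by auto
    then show "(\<Sum>i<N. hausdorff1_outer (R (2 * i + c))) \<le> hausdorff1_outer A"
      using par[of c N] hausdorff1_outer_mono order_trans by blast
  qed auto
  define r where "r n = hausdorff1_outer (R n)" for n
  have rfin: "(\<Sum>n. r n) < top"
  proof -
    have "(\<Sum>n<N. r n) \<le> hausdorff1_outer A + hausdorff1_outer A" for N
    proof -
      have "(\<Sum>n<N. r n) \<le> (\<Sum>n<2 * N. r n)" by (intro sum_mono2) auto
      also have "\<dots> = (\<Sum>i<N. r (2 * i + 0)) + (\<Sum>i<N. r (2 * i + 1))"
        by (induction N) (simp_all add: ac_simps)
      also have "\<dots> \<le> (\<Sum>i. r (2 * i + 0)) + (\<Sum>i. r (2 * i + 1))"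
        by (intro add_mono sum_le_suminf) auto
      also have "\<dots> \<le> hausdorff1_outer A + hausdorff1_outer A"
        unfolding r_def by (intro add_mono sumpar)
      finally show ?thesis .
    qed
    then have "(\<Sum>n. r n) \<le> hausdorff1_outer A + hausdorff1_outer A"
      by (intro suminf_le_const) auto
    also have "\<dots> < top" using fin by simp
    finally show ?thesis .
  qed
  then have "summable (\<lambda>n. enn2real (r n))" and r_real: "r = (\<lambda>n. ennreal (enn2real (r n)))"
  proof -
    have "r n < top" for n using rfin by (meson ennreal_suminf_lessD)
    then show r_real: "r = (\<lambda>n. ennreal (enn2real (r n)))" by auto
    show "summable (\<lambda>n. enn2real (r n))"
      using rfin by (intro summable_suminf_not_top) (auto simp: r_real[symmetric])
  qed
  then have tail: "(\<lambda>n. \<Sum>m. enn2real (r (m + n))) \<longlonglongrightarrow> 0" by (intro suminf_exist_split2)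
  have le: "hausdorff1_outer (A - F) \<le> (SUP n. hausdorff1_outer (E n)) + ennreal (\<Sum>m. enn2real (r (m + n)))" for n
  proof -
    have "hausdorff1_outer (A - F) \<le> hausdorff1_outer (E n \<union> (\<Union>m. R (n + m)))"
      by (intro hausdorff1_outer_mono cover)
    also have "\<dots> \<le> hausdorff1_outer (E n) + hausdorff1_outer (\<Union>m. R (n + m))"
      by (rule hausdorff1_outer_Un)
    also have "\<dots> \<le> (SUP n. hausdorff1_outer (E n)) + (\<Sum>m. r (m + n))"
      using hausdorff1_outer_UN[of "\<lambda>m. R (n + m)"]
      by (intro add_mono SUP_upper) (auto simp: r_def add.commute)
    also have "(\<Sum>m. r (m + n)) = ennreal (\<Sum>m. enn2real (r (m + n)))"
      using \<open>summable (\<lambda>n. enn2real (r n))\<close>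
      by (subst r_real) (intro suminf_ennreal2 summable_ignore_initial_segment, auto)
    finally show ?thesis .
  qed
  have "(\<lambda>n. (SUP n. hausdorff1_outer (E n)) + ennreal (\<Sum>m. enn2real (r (m + n))))
      \<longlonglongrightarrow> (SUP n. hausdorff1_outer (E n)) + ennreal 0"
    by (intro tendsto_add tendsto_const tendsto_ennrealI tail)
  then show ?thesis using le by (intro LIMSEQ_le_const[where a="hausdorff1_outer (A - F)"]) auto
qed

text \<open>Caratheodory's condition for closed sets.\<close>
lemma hausdorff1_outer_closed_split:
  fixes F A :: "'a::metric_space set"
  assumes "closed F"
  shows "hausdorff1_outer (A \<inter> F) + hausdorff1_outer (A - F) = hausdorff1_outer A"
proof (rule antisym)
  have "hausdorff1_outer A \<le> hausdorff1_outer ((A \<inter> F) \<union> (A - F))" by (simp add: Int_Diff_Un)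
  then show "hausdorff1_outer A \<le> hausdorff1_outer (A \<inter> F) + hausdorff1_outer (A - F)"
    using hausdorff1_outer_Un order_trans by blast
  show "hausdorff1_outer (A \<inter> F) + hausdorff1_outer (A - F) \<le> hausdorff1_outer A"
  proof (cases "F = {} \<or> hausdorff1_outer A = top")
    case False
    define E where "E n = {x\<in>A - F. 1 / real (Suc n) \<le> infdist x F}" for n
    have "hausdorff1_outer (A - F) \<le> (SUP n. hausdorff1_outer (E n))"
      unfolding E_def using False assms by (intro hausdorff1_outer_rings) (auto simp: less_top)
    then have "hausdorff1_outer (A \<inter> F) + hausdorff1_outer (A - F)
        \<le> hausdorff1_outer (A \<inter> F) + (SUP n. hausdorff1_outer (E n))"
      by (intro add_left_mono)
    also have "\<dots> = (SUP n. hausdorff1_outer (A \<inter> F) + hausdorff1_outer (E n))"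
      by (subst ennreal_SUP_add_right) auto
    also have "\<dots> \<le> hausdorff1_outer A"
    proof (rule SUP_least)
      fix n
      have "hausdorff1_outer (A \<inter> F) + hausdorff1_outer (E n) \<le> hausdorff1_outer (A \<inter> F \<union> E n)"
      proof (rule hausdorff1_outer_separated)
        fix x y assume "x \<in> A \<inter> F" "y \<in> E n"
        then have "1 / real (Suc n) \<le> infdist y F" by (simp add: E_def)
        also have "\<dots> \<le> dist y x" using \<open>x \<in> A \<inter> F\<close> by (intro infdist_le) auto
        finally show "1 / real (Suc n) \<le> dist x y" by (simp add: dist_commute)
      qed simp
      also have "\<dots> \<le> hausdorff1_outer A" by (intro hausdorff1_outer_mono) (auto simp: E_def)
      finally show "hausdorff1_outer (A \<inter> F) + hausdorff1_outer (E n) \<le> hausdorff1_outer A" .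
    qed
    finally show ?thesis .
  qed auto
qed

lemma sets_hausdorff1 [simp, measurable_cong]: "sets hausdorff1 = sets borel"
  unfolding hausdorff1_def using sets.sigma_sets_eq[of "borel :: 'a measure"] by (simp add: sets_measure_of_conv)

lemma space_hausdorff1 [simp]: "space hausdorff1 = UNIV"
  unfolding hausdorff1_def by (simp add: space_measure_of_conv)

lemma emeasure_hausdorff1:
  fixes A :: "'a::metric_space set"
  assumes "A \<in> sets borel"
  shows "emeasure hausdorff1 A = hausdorff1_outer A"
proof -
  interpret S: sigma_algebra UNIV "UNIV :: 'a set set" by (simp add: sigma_algebra_iff2)
  define L where "L = lambda_system UNIV UNIV (hausdorff1_outer :: 'a set \<Rightarrow> ennreal)"
  have ms: "measure_space UNIV L hausdorff1_outer"
    unfolding L_def using S.caratheodory_lemma[OF hausdorff1_outer_space] by simp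
  then have sa: "sigma_algebra UNIV L" by (simp add: measure_space_def)
  have "F \<in> L" if "closed F" for F :: "'a set"
    unfolding L_def S.lambda_system_eq using hausdorff1_outer_closed_split[OF that] by auto
  then have sub: "sets (borel :: 'a measure) \<subseteq> L"
    unfolding borel_eq_closed
    using sigma_algebra.sigma_sets_subset[OF sa, of "Collect closed"] by (auto simp: sets_measure_of_conv)
  show ?thesis
    unfolding hausdorff1_def
  proof (rule emeasure_measure_of_sigma)
    show "sigma_algebra UNIV (sets (borel :: 'a measure))"
      using sets.sigma_algebra_axioms[of "borel :: 'a measure"] by simp
    show "positive (sets (borel :: 'a measure)) hausdorff1_outer" by (simp add: positive_def)
    show "countably_additive (sets (borel :: 'a measure)) hausdorff1_outer"
      using ms sub unfolding measure_space_def countably_additive_def by blast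
  qed (use assms in simp)
qed

text \<open>The set \<open>T\<close> is covered by short nonoverlapping intervals inside an open set that is hardly larger than
  \<open>T\<close>; their images cover \<open>\<Gamma> ` T\<close> and have diameter at most \<open>L\<close> times their length.\<close>
lemma hausdorff1_outer_lipschitz_image:
  fixes \<Gamma> :: "real \<Rightarrow> 'a::real_normed_vector"
  assumes T: "T \<in> sets borel" "T \<subseteq> {\<alpha><..<\<beta>}" and L: "0 \<le> L"
    and lip: "\<And>s t. s \<in> {\<alpha><..<\<beta>} \<Longrightarrow> t \<in> {\<alpha><..<\<beta>} \<Longrightarrow> dist (\<Gamma> s) (\<Gamma> t) \<le> L * \<bar>s - t\<bar>"
  shows "hausdorff1_outer (\<Gamma> ` T) \<le> ennreal L * emeasure lborel T"
proof (cases "\<alpha> < \<beta>")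
  case False
  then have "T = {}" using T(2) by auto
  then show ?thesis by simp
next
  case True
  define I where "I = {\<alpha><..<\<beta>}"
  show ?thesis
    unfolding hausdorff1_outer_eq
  proof (rule SUP_least, rule ennreal_le_epsilon)
    fix \<delta> e :: real assume "\<delta> \<in> {0<..}" and e: "0 < e"
    then have \<delta>: "0 < \<delta>" by simp
    obtain U where U: "open U" "T \<subseteq> U" "emeasure lborel (U - T) < e / (L + 1)"
      using outer_regular_lborel[OF T(1), of "e / (L + 1)"] e L by auto
    have U_le: "ennreal L * emeasure lborel U \<le> ennreal L * emeasure lborel T + ennreal e"
    proof -
      have "emeasure lborel U = emeasure lborel T + emeasure lborel (U - T)"
        using U T by (subst plus_emeasure) (auto intro!: arg_cong[where f="emeasure lborel"])
      also have "\<dots> \<le> emeasure lborel T + ennreal (e / (L + 1))"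
        using U(3) by (intro add_left_mono) simp
      finally have "ennreal L * emeasure lborel U \<le> ennreal L * (emeasure lborel T + ennreal (e / (L + 1)))"
        by (intro mult_left_mono) auto
      also have "\<dots> = ennreal L * emeasure lborel T + ennreal (L * (e / (L + 1)))"
        using L e by (simp add: distrib_left ennreal_mult[symmetric])
      also have "\<dots> \<le> ennreal L * emeasure lborel T + ennreal e"
        using L e by (intro add_left_mono ennreal_leI) (simp add: field_simps)
      finally show ?thesis .
    qed
    define g where "g x = (if x \<in> U then U else UNIV) \<inter> ball x (\<delta> / (2 * (L + 1)))" for x
    have "gauge g" using U(1) L \<delta> by (auto simp: g_def gauge_def)
    have "T \<subseteq> cbox \<alpha> \<beta>" using T(2) by auto
    have "box \<alpha> \<beta> \<noteq> {}" using True by auto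
    obtain D where D: "countable D"
      "\<And>K. K \<in> D \<Longrightarrow> interior K \<noteq> {} \<and> (\<exists>c d. K = cbox c d)"
      "pairwise (\<lambda>A B. interior A \<inter> interior B = {}) D"
      "\<And>K. K \<in> D \<Longrightarrow> \<exists>x \<in> T \<inter> K. K \<subseteq> g x" "T \<subseteq> \<Union>D"
      by (rule covering_lemma[OF \<open>T \<subseteq> cbox \<alpha> \<beta>\<close> \<open>box \<alpha> \<beta> \<noteq> {}\<close> \<open>gauge g\<close>]) metis
    define num where "num = to_nat_on D"
    have inj: "inj_on num D" unfolding num_def using D(1) by (rule inj_on_to_nat_on)
    define K where "K i = (if i \<in> num ` D then inv_into D num i else {})" for i
    have K_D: "K (num k) = k" if "k \<in> D" for k using that inj by (simp add: K_def)
    have K_cases: "K i = {} \<or> (i \<in> num ` D \<and> K i \<in> D)" for i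
      by (auto simp: K_def inv_into_into)
    define C where "C i = \<Gamma> ` (K i \<inter> I)" for i
    have small: "diameter (C i) \<le> \<delta> \<and> bounded (C i)
        \<and> ennreal (diameter (C i)) \<le> ennreal L * emeasure lborel (interior (K i)) \<and> K i \<subseteq> U" for i
    proof (cases "K i = {}")
      case True then show ?thesis using \<delta> by (simp add: C_def diameter_def)
    next
      case False
      then have KD: "K i \<in> D" using K_cases by auto
      then obtain c d where cd: "K i = cbox c d" "c < d" using D(2)[OF KD] by auto
      obtain x where x: "x \<in> T \<inter> K i" "K i \<subseteq> g x" using D(4)[OF KD] by auto
      have KU: "K i \<subseteq> U" using x U(2) by (auto simp: g_def split: if_splits)
      have "c \<in> ball x (\<delta> / (2 * (L + 1)))" "d \<in> ball x (\<delta> / (2 * (L + 1)))"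
      proof -
        have "K i \<subseteq> ball x (\<delta> / (2 * (L + 1)))" using x(2) by (auto simp: g_def)
        moreover have "c \<in> K i" "d \<in> K i" using cd by auto
        ultimately show "c \<in> ball x (\<delta> / (2 * (L + 1)))" "d \<in> ball x (\<delta> / (2 * (L + 1)))" by blast+
      qed
      then have "\<bar>c - x\<bar> < \<delta> / (2 * (L + 1))" "\<bar>d - x\<bar> < \<delta> / (2 * (L + 1))"
        by (auto simp: dist_real_def abs_minus_commute)
      then have "d - c \<le> 2 * (\<delta> / (2 * (L + 1)))" by linarith
      also have "\<dots> = \<delta> / (L + 1)" using L by (simp add: field_simps)
      finally have len: "L * (d - c) \<le> \<delta>"
      proof -
        assume a: "d - c \<le> \<delta> / (L + 1)"
        have "L * (d - c) \<le> L * (\<delta> / (L + 1))" using a L by (intro mult_left_mono)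
        also have "\<dots> \<le> \<delta>" using L \<delta> by (simp add: field_simps)
        finally show ?thesis .
      qed
      have dist: "dist p q \<le> L * (d - c)" if pq: "p \<in> C i" "q \<in> C i" for p q
      proof -
        obtain s t where st: "s \<in> K i \<inter> I" "t \<in> K i \<inter> I" "p = \<Gamma> s" "q = \<Gamma> t"
          using pq unfolding C_def by blast
        then have "dist p q \<le> L * \<bar>s - t\<bar>" using lip by (auto simp: I_def)
        also have "\<dots> \<le> L * (d - c)" using st cd L by (intro mult_left_mono) auto
        finally show ?thesis .
      qed
      have diam: "diameter (C i) \<le> L * (d - c)"
        using dist L cd by (intro diameter_le) (auto simp: dist_norm)
      have "bounded (C i)"
        unfolding bounded_two_points using dist by blast
      moreover have "emeasure lborel (interior (K i)) = ennreal (d - c)"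
        using cd by simp
      then have "ennreal (diameter (C i)) \<le> ennreal L * emeasure lborel (interior (K i))"
        using diam L cd by (simp add: ennreal_mult[symmetric] ennreal_leI)
      ultimately show ?thesis using diam len KU by auto
    qed
    have "hausdorff1_cover \<delta> (\<Gamma> ` T) C"
      unfolding hausdorff1_cover_def
    proof
      show "\<Gamma> ` T \<subseteq> (\<Union>i. C i)"
      proof
        fix y assume "y \<in> \<Gamma> ` T"
        then obtain t where t: "t \<in> T" "y = \<Gamma> t" by auto
        then obtain k where k: "k \<in> D" "t \<in> k" using D(5) by blast
        have "y \<in> C (num k)" using t k T(2) K_D[OF k(1)] by (auto simp: C_def I_def)
        then show "y \<in> (\<Union>i. C i)" by blast
      qed
    qed (use small in blast)
    then have "hausdorff1_content \<delta> (\<Gamma> ` T) \<le> (\<Sum>i. ennreal (diameter (C i)))"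
      by (rule hausdorff1_content_le)
    also have "\<dots> \<le> (\<Sum>i. ennreal L * emeasure lborel (interior (K i)))"
      using small by (intro suminf_le) auto
    also have "\<dots> = ennreal L * (\<Sum>i. emeasure lborel (interior (K i)))" by simp
    also have "(\<Sum>i. emeasure lborel (interior (K i))) = emeasure lborel (\<Union>i. interior (K i))"
    proof (rule suminf_emeasure)
      show "disjoint_family (\<lambda>i. interior (K i))"
        unfolding disjoint_family_on_def
      proof (intro ballI impI)
        fix i j :: nat assume ij: "i \<noteq> j"
        show "interior (K i) \<inter> interior (K j) = {}"
        proof (cases "K i = {} \<or> K j = {}")
          case False
          then have "i \<in> num ` D" "j \<in> num ` D" "K i \<in> D" "K j \<in> D" using K_cases by blast+
          moreover from this have "K i \<noteq> K j" using ij K_D by (metis imageE)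
          ultimately show ?thesis using D(3) by (auto simp: pairwise_def)
        qed auto
      qed
    qed auto
    also have "emeasure lborel (\<Union>i. interior (K i)) \<le> emeasure lborel U"
      using small interior_subset U(1) by (intro emeasure_mono) (blast, auto)
    finally have "hausdorff1_content \<delta> (\<Gamma> ` T) \<le> ennreal L * emeasure lborel U"
      by (simp add: mult_left_mono)
    with U_le show "hausdorff1_content \<delta> (\<Gamma> ` T) \<le> ennreal L * emeasure lborel T + ennreal e"
      by (rule order_trans[rotated])
  qed
qed

text \<open>A bounded set projects into an interval whose length is at most its diameter.\<close>
lemma hausdorff1_outer_projection:
  fixes \<pi> :: "'a::metric_space \<Rightarrow> real"
  assumes lip: "\<And>x y. \<bar>\<pi> x - \<pi> y\<bar> \<le> dist x y" and T: "T \<in> sets borel" "T \<subseteq> \<pi> ` A"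
  shows "emeasure lborel T \<le> hausdorff1_outer A"
proof -
  have "emeasure lborel T \<le> hausdorff1_content 1 A"
    unfolding hausdorff1_content_def
  proof (rule INF_greatest)
    fix C assume "C \<in> Collect (hausdorff1_cover 1 A)"
    then have C: "A \<subseteq> (\<Union>i. C i)" "\<And>i. bounded (C i)" by (auto simp: hausdorff1_cover_def)
    define J where "J i = (if C i = {} then {} else {Inf (\<pi> ` C i)..Sup (\<pi> ` C i)})" for i
    have diff: "\<pi> x - \<pi> y \<le> diameter (C i)" if "x \<in> C i" "y \<in> C i" for x y i
      using diameter_bounded_bound[OF C(2) that] lip[of x y] by linarith
    have bdd: "bdd_above (\<pi> ` C i)" "bdd_below (\<pi> ` C i)" for i
    proof -
      show "bdd_above (\<pi> ` C i)"
      proof (cases "C i = {}")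
        case False
        then obtain y where "y \<in> C i" by auto
        then show ?thesis using diff[of _ i y] by (intro bdd_aboveI[of _ "\<pi> y + diameter (C i)"]) (force simp: algebra_simps)
      qed auto
      show "bdd_below (\<pi> ` C i)"
      proof (cases "C i = {}")
        case False
        then obtain y where "y \<in> C i" by auto
        then show ?thesis using diff[of y i] by (intro bdd_belowI[of _ "\<pi> y - diameter (C i)"]) (force simp: algebra_simps)
      qed auto
    qed
    have "T \<subseteq> (\<Union>i. J i)"
    proof
      fix t assume "t \<in> T"
      then obtain x where x: "x \<in> A" "t = \<pi> x" using T(2) by auto
      then obtain i where i: "x \<in> C i" using C(1) by auto
      then have "t \<in> J i" using x bdd by (auto simp: J_def intro: cInf_lower cSup_upper)
      then show "t \<in> (\<Union>i. J i)" by blast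
    qed
    then have "emeasure lborel T \<le> emeasure lborel (\<Union>i. J i)"
      by (intro emeasure_mono) (auto simp: J_def)
    also have "\<dots> \<le> (\<Sum>i. emeasure lborel (J i))"
      by (intro emeasure_subadditive_countably) (auto simp: J_def)
    also have "\<dots> \<le> (\<Sum>i. ennreal (diameter (C i)))"
    proof (intro suminf_le)
      fix i
      show "emeasure lborel (J i) \<le> ennreal (diameter (C i))"
      proof (cases "C i = {}")
        case False
        have le: "Inf (\<pi> ` C i) \<le> Sup (\<pi> ` C i)" using False bdd by (intro cInf_le_cSup) auto
        have "Sup (\<pi> ` C i) \<le> diameter (C i) + Inf (\<pi> ` C i)"
        proof (rule cSup_least)
          fix s assume "s \<in> \<pi> ` C i"
          then obtain x where x: "x \<in> C i" "s = \<pi> x" by auto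
          have "s - diameter (C i) \<le> Inf (\<pi> ` C i)"
            using False diff[OF x(1)] x(2) by (intro cInf_greatest) (auto simp: algebra_simps)
          then show "s \<le> diameter (C i) + Inf (\<pi> ` C i)" by simp
        qed (use False in auto)
        then show ?thesis using False le by (simp add: J_def ennreal_leI)
      qed (simp add: J_def)
    qed auto
    finally show "emeasure lborel T \<le> (\<Sum>i. ennreal (diameter (C i)))" .
  qed
  also have "\<dots> \<le> hausdorff1_outer A" by (intro hausdorff1_content_le_outer) simp
  finally show ?thesis .
qed

section \<open>Smooth cut-off functions of small energy\<close>

lemma dir_deriv_eq: "(f has_derivative D) (at x) \<Longrightarrow> dir_deriv v f x = D v"
  unfolding dir_deriv_def by (metis frechet_derivative_at)

lemma grad_eq:
  assumes "(f has_derivative (\<lambda>h. w \<bullet> h)) (at x)"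
  shows "grad f x = w"
  unfolding grad_def dir_deriv_eq[OF assms] by (rule euclidean_representation)

text \<open>Every derivative of the smooth function that is \<open>exp (- 1 / x)\<close> for positive \<open>x\<close> and vanishes elsewhere
  has this form.\<close>
definition flat :: "real poly \<Rightarrow> real \<Rightarrow> real" where
  "flat p x = (if 0 < x then poly p (1 / x) * exp (- (1 / x)) else 0)"

lemma poly_div_exp_tendsto_0: "((\<lambda>y::real. poly p y * exp (- y)) \<longlongrightarrow> 0) at_top"
proof -
  have "((\<lambda>y::real. \<Sum>i\<le>degree p. coeff p i * (y ^ i / exp y)) \<longlongrightarrow> (\<Sum>i\<le>degree p. coeff p i * 0)) at_top"
    by (intro tendsto_sum tendsto_mult tendsto_const tendsto_power_div_exp_0)
  then show ?thesis by (simp add: poly_altdef sum_distrib_right exp_minus divide_inverse mult.assoc)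
qed

lemma flat_has_derivative:
  "(flat p has_real_derivative flat ([:0, 0, 1:] * (p - pderiv p)) x) (at x)"
proof (cases x "0::real" rule: linorder_cases)
  case greater
  have "((\<lambda>x. poly p (1 / x) * exp (- (1 / x))) has_real_derivative flat ([:0, 0, 1:] * (p - pderiv p)) x) (at x)"
  proof -
    have d: "((\<lambda>x. 1 / x) has_real_derivative - (1 / x\<^sup>2)) (at x)"
      using greater by (auto intro!: derivative_eq_intros simp: power2_eq_square)
    have "((\<lambda>x. poly p (1 / x) * exp (- (1 / x))) has_real_derivative
        poly p (1 / x) * (exp (- (1 / x)) * - (- (1 / x\<^sup>2)))
        + poly (pderiv p) (1 / x) * - (1 / x\<^sup>2) * exp (- (1 / x))) (at x)"
      by (intro DERIV_mult' DERIV_chain2[OF poly_DERIV d] DERIV_chain2[OF DERIV_exp] DERIV_minus d)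
    moreover have "poly p (1 / x) * (exp (- (1 / x)) * - (- (1 / x\<^sup>2)))
        + poly (pderiv p) (1 / x) * - (1 / x\<^sup>2) * exp (- (1 / x)) = flat ([:0, 0, 1:] * (p - pderiv p)) x"
      using greater by (simp add: flat_def power2_eq_square algebra_simps)
    ultimately show ?thesis by simp
  qed
  then show ?thesis
    by (rule has_field_derivative_transform_within_open[where S="{0<..}"]) (use greater in \<open>auto simp: flat_def\<close>)
next
  case less
  have "((\<lambda>x. 0) has_real_derivative 0) (at x)" by simp
  then have "(flat p has_real_derivative 0) (at x)"
    by (rule has_field_derivative_transform_within_open[where S="{..<0}"]) (use less in \<open>auto simp: flat_def\<close>)
  then show ?thesis using less by (simp add: flat_def)
next
  case equal
  have "((\<lambda>h. flat p h / h) \<longlongrightarrow> 0) (at 0)"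
    unfolding filterlim_at_split
  proof
    have "\<forall>\<^sub>F h in at_left 0. 0 = flat p h / h"
      by (rule eventually_at_leftI[of "-1"]) (auto simp: flat_def)
    then show "((\<lambda>h. flat p h / h) \<longlongrightarrow> 0) (at_left 0)"
      by (rule Lim_transform_eventually[OF tendsto_const])
    have "((\<lambda>y::real. poly (pCons 0 p) y * exp (- y)) \<longlongrightarrow> 0) at_top" by (rule poly_div_exp_tendsto_0)
    then have "((\<lambda>h::real. poly (pCons 0 p) (inverse h) * exp (- inverse h)) \<longlongrightarrow> 0) (at_right 0)"
      by (rule filterlim_compose) (rule filterlim_inverse_at_top_right)
    moreover have "\<forall>\<^sub>F h in at_right 0. poly (pCons 0 p) (inverse h) * exp (- inverse h) = flat p h / h"
      by (rule eventually_at_rightI[of _ 1]) (auto simp: flat_def field_simps)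
    ultimately show "((\<lambda>h. flat p h / h) \<longlongrightarrow> 0) (at_right 0)"
      by (rule Lim_transform_eventually)
  qed
  then show ?thesis using equal by (simp add: has_field_derivative_iff flat_def)
qed

text \<open>A class of functions that contains the cut-offs needed below and is closed under directional
  derivatives; all its members are smooth for this reason alone.\<close>
inductive_set elementary :: "('a::euclidean_space \<Rightarrow> real) set" where
  const: "(\<lambda>x. c) \<in> elementary"
| inner: "(\<lambda>x. x \<bullet> v) \<in> elementary"
| add: "f \<in> elementary \<Longrightarrow> g \<in> elementary \<Longrightarrow> (\<lambda>x. f x + g x) \<in> elementary"
| mult: "f \<in> elementary \<Longrightarrow> g \<in> elementary \<Longrightarrow> (\<lambda>x. f x * g x) \<in> elementary"
| inverse: "f \<in> elementary \<Longrightarrow> (\<And>x. f x > 0) \<Longrightarrow> (\<lambda>x. inverse (f x)) \<in> elementary"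
| flat: "f \<in> elementary \<Longrightarrow> (\<lambda>x. flat p (f x)) \<in> elementary"

lemma elementary_sum:
  "finite I \<Longrightarrow> (\<And>i. i \<in> I \<Longrightarrow> f i \<in> elementary) \<Longrightarrow> (\<lambda>x. \<Sum>i\<in>I. f i x) \<in> elementary"
  by (induction I rule: finite_induct) (auto intro: elementary.intros)

lemma elementary_compose:
  fixes f :: "real \<Rightarrow> real"
  assumes "f \<in> elementary" and g: "g \<in> elementary"
  shows "(\<lambda>x. f (g x)) \<in> elementary"
  using assms(1)
proof (induction rule: elementary.induct)
  case (inner v)
  have "(\<lambda>x. g x * v) \<in> elementary" using g by (intro elementary.intros)
  then show ?case by simp
qed (auto intro: elementary.intros)

lemma elementary_derivative:
  "f \<in> elementary \<Longrightarrow> \<exists>D. (\<forall>x. (f has_derivative D x) (at x)) \<and> (\<forall>v. (\<lambda>x. D x v) \<in> elementary)"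
proof (induction rule: elementary.induct)
  case (const c)
  show ?case by (intro exI[of _ "\<lambda>x v. 0"]) (auto intro: elementary.intros)
next
  case (inner w)
  show ?case
    by (intro exI[of _ "\<lambda>x v. v \<bullet> w"]) (auto intro!: elementary.intros derivative_eq_intros)
next
  case (add f g)
  then obtain D E where "\<forall>x. (f has_derivative D x) (at x)" "\<forall>v. (\<lambda>x. D x v) \<in> elementary"
    "\<forall>x. (g has_derivative E x) (at x)" "\<forall>v. (\<lambda>x. E x v) \<in> elementary" by blast
  then show ?case
    by (intro exI[of _ "\<lambda>x v. D x v + E x v"]) (auto intro: elementary.intros has_derivative_add)
next
  case (mult f g)
  then obtain D E where "\<forall>x. (f has_derivative D x) (at x)" "\<forall>v. (\<lambda>x. D x v) \<in> elementary"
    "\<forall>x. (g has_derivative E x) (at x)" "\<forall>v. (\<lambda>x. E x v) \<in> elementary" by blast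
  with mult show ?case
    by (intro exI[of _ "\<lambda>x v. f x * E x v + D x v * g x"]) (auto intro!: elementary.add elementary.mult has_derivative_mult)
next
  case (inverse f)
  then obtain D where D: "\<forall>x. (f has_derivative D x) (at x)" "\<forall>v. (\<lambda>x. D x v) \<in> elementary" by blast
  have "((\<lambda>x. inverse (f x)) has_derivative (\<lambda>v. (-1) * (D x v * (inverse (f x) * inverse (f x))))) (at x)" for x
    using D(1) inverse(2)[of x] by (auto intro!: derivative_eq_intros simp: fun_eq_iff algebra_simps)
  moreover have "(\<lambda>x. (-1) * (D x v * (inverse (f x) * inverse (f x)))) \<in> elementary" for v
    by (intro elementary.mult elementary.const elementary.inverse D(2)[rule_format] inverse)
  ultimately show ?case
    by (intro exI[of _ "\<lambda>x v. (-1) * (D x v * (inverse (f x) * inverse (f x)))"]) blast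
next
  case (flat f p)
  then obtain D where D: "\<forall>x. (f has_derivative D x) (at x)" "\<forall>v. (\<lambda>x. D x v) \<in> elementary" by blast
  let ?q = "[:0, 0, 1:] * (p - pderiv p)"
  have "((\<lambda>x. flat p (f x)) has_derivative (\<lambda>v. flat ?q (f x) * D x v)) (at x)" for x
    using has_derivative_compose[OF D(1)[rule_format, of x] flat_has_derivative[of p "f x", unfolded has_field_derivative_def]]
    by simp
  with D flat show ?case
    by (intro exI[of _ "\<lambda>x v. flat ?q (f x) * D x v"]) (auto intro!: elementary.intros)
qed

lemma elementary_derivativeE:
  assumes "f \<in> elementary"
  obtains D where "\<And>x. (f has_derivative D x) (at x)" "\<And>v. (\<lambda>x. D x v) \<in> elementary"
  using elementary_derivative[OF assms] by (elim exE conjE) (rule that, erule spec, erule spec)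

lemma elementary_continuous: "f \<in> elementary \<Longrightarrow> continuous_on S f"
  using elementary_derivative[of f] by (metis continuous_at_imp_continuous_on has_derivative_continuous)

lemma elementary_Ck_on: "f \<in> elementary \<Longrightarrow> Ck_on k f UNIV"
proof (induction k arbitrary: f)
  case 0
  then show ?case by (simp add: elementary_continuous)
next
  case (Suc k)
  then obtain D where D: "\<forall>x. (f has_derivative D x) (at x)" "\<forall>v. (\<lambda>x. D x v) \<in> elementary"
    using elementary_derivative by blast
  have "dir_deriv v f = (\<lambda>x. D x v)" for v using D(1) by (auto simp: dir_deriv_eq)
  then show ?case using Suc.IH D by (auto simp: differentiable_def)
qed

text \<open>The quotient \<open>A / (A + B)\<close> of two flat functions, where \<open>B\<close> vanishes for \<open>s \<le> 1\<close> and \<open>A\<close> for \<open>4 \<le> s\<close>.\<close>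
lemma smooth_step:
  obtains \<kappa> \<kappa>' :: "real \<Rightarrow> real" and M where
    "\<kappa> \<in> elementary" "\<And>s. s \<le> 1 \<Longrightarrow> \<kappa> s = 1" "\<And>s. 4 \<le> s \<Longrightarrow> \<kappa> s = 0"
    "\<And>s. 0 \<le> \<kappa> s" "\<And>s. \<kappa> s \<le> 1" "\<And>s. (\<kappa> has_real_derivative \<kappa>' s) (at s)"
    "continuous_on UNIV \<kappa>'" "\<And>s. \<bar>\<kappa>' s\<bar> \<le> M" "\<And>s. s \<notin> {1<..<4} \<Longrightarrow> \<kappa>' s = 0"
proof -
  define A where "A s = flat 1 (4 + (-1) * (s \<bullet> 1))" for s :: real
  define B where "B s = flat 1 (s \<bullet> 1 + (-1))" for s :: real
  define \<kappa> where "\<kappa> s = A s * inverse (A s + B s)" for s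
  have A: "A \<in> elementary" unfolding A_def by (intro elementary.intros)
  have B: "B \<in> elementary" unfolding B_def by (intro elementary.intros)
  have nn: "A s \<ge> 0" "B s \<ge> 0" "A s + B s > 0" for s
    by (auto simp: A_def B_def flat_def add_pos_pos)
  have el: "\<kappa> \<in> elementary" unfolding \<kappa>_def using A B nn by (intro elementary.intros) auto
  obtain D where D: "\<And>x. (\<kappa> has_derivative D x) (at x)" "\<And>v. (\<lambda>x. D x v) \<in> elementary"
    by (rule elementary_derivativeE[OF el]) (rule that)
  define \<kappa>' where "\<kappa>' s = D s 1" for s
  have der: "(\<kappa> has_real_derivative \<kappa>' s) (at s)" for s
  proof -
    have "D s h = \<kappa>' s * h" for h
      using linear_scale[OF has_derivative_linear[OF D(1)[of s]], of h 1] by (simp add: \<kappa>'_def mult.commute)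
    then have "D s = (*) (\<kappa>' s)" by (rule ext)
    then show ?thesis using D(1)[of s] unfolding has_field_derivative_def by metis
  qed
  have cont: "continuous_on S \<kappa>'" for S unfolding \<kappa>'_def using D(2) by (rule elementary_continuous)
  have one: "\<kappa> s = 1" if "s \<le> 1" for s
    using nn(3)[of s] that by (simp add: \<kappa>_def B_def flat_def)
  have zero: "\<kappa> s = 0" if "4 \<le> s" for s
    using that by (simp add: \<kappa>_def A_def flat_def)
  have "\<kappa>' s = 0" if "s < 1" for s
  proof -
    have "((\<lambda>s. 1) has_real_derivative 0) (at s)" by simp
    then have "(\<kappa> has_real_derivative 0) (at s)"
      by (rule has_field_derivative_transform_within_open[where S="{..<1}"]) (use that one in auto)
    then show ?thesis using der DERIV_unique by blast
  qed
  moreover have "\<kappa>' s = 0" if "4 < s" for s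
  proof -
    have "((\<lambda>s. 0) has_real_derivative 0) (at s)" by simp
    then have "(\<kappa> has_real_derivative 0) (at s)"
      by (rule has_field_derivative_transform_within_open[where S="{4<..}"]) (use that zero in auto)
    then show ?thesis using der DERIV_unique by blast
  qed
  moreover have "\<kappa>' 1 = 0"
  proof (rule continuous_constant_on_closure[of "{..<1}" \<kappa>' 0])
    show "continuous_on (closure {..<1}) \<kappa>'" by (rule cont)
  qed (use calculation in auto)
  moreover have "\<kappa>' 4 = 0"
  proof (rule continuous_constant_on_closure[of "{4<..}" \<kappa>' 0])
    show "continuous_on (closure {4<..}) \<kappa>'" by (rule cont)
  qed (use calculation in auto)
  ultimately have out: "\<kappa>' s = 0" if "s \<notin> {1<..<4}" for s
    using that by (cases "s = 1 \<or> s = 4") force+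
  have "compact (\<kappa>' ` {1..4})" by (intro compact_continuous_image cont) auto
  then obtain M where M: "\<And>s. s \<in> {1..4} \<Longrightarrow> \<bar>\<kappa>' s\<bar> \<le> M" "0 < M"
    using compact_imp_bounded bounded_pos by (metis imageI real_norm_def)
  have "\<bar>\<kappa>' s\<bar> \<le> M" for s using out[of s] M by (cases "s \<in> {1..4}") auto
  moreover have "0 \<le> \<kappa> s" "\<kappa> s \<le> 1" for s
    using nn[of s] by (auto simp: \<kappa>_def field_simps)
  ultimately show thesis by (intro that[of \<kappa> \<kappa>' M] el one zero der cont out)
qed

lemma power2_two_power: "((2::real) ^ n)\<^sup>2 = 4 ^ n"
  by (simp add: power2_eq_square flip: power_mult_distrib)

text \<open>The average of \<open>N\<close> cut-offs at the dyadic scales \<open>1, 2, \<dots>, 2^(N-1)\<close>. In the plane each of them has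
  Dirichlet energy bounded independently of the scale, and their gradients live on disjoint annuli, so
  the energy of the average is \<open>N\<close> times a constant divided by \<open>N\<^sup>2\<close>.\<close>
lemma log_cutoff:
  fixes x0 :: "real^2"
  obtains C where "\<And>N::nat. 0 < N \<Longrightarrow> \<exists>\<phi> w. test_function \<phi> \<and> (\<forall>x. 0 \<le> \<phi> x \<and> \<phi> x \<le> 1) \<and>
     (\<forall>x. dist x x0 \<le> 1 \<longrightarrow> \<phi> x = 1) \<and> continuous_on UNIV w \<and>
     (\<forall>x. (\<phi> has_derivative (\<lambda>h. w x \<bullet> h)) (at x)) \<and>
     (\<exists>R. \<forall>x. R < norm x \<longrightarrow> \<phi> x = 0 \<and> w x = 0) \<and>
     integrable lborel (\<lambda>x. (norm (w x))\<^sup>2) \<and> (LINT x|lborel. (norm (w x))\<^sup>2) \<le> C / real N"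
proof -
  obtain \<kappa> \<kappa>' M where \<kappa>: "\<kappa> \<in> elementary" "\<And>s. s \<le> 1 \<Longrightarrow> \<kappa> s = 1" "\<And>s. 4 \<le> s \<Longrightarrow> \<kappa> s = 0"
    "\<And>s. 0 \<le> \<kappa> s" "\<And>s. \<kappa> s \<le> 1" "\<And>s. (\<kappa> has_real_derivative \<kappa>' s) (at s)"
    "continuous_on UNIV \<kappa>'" "\<And>s. \<bar>\<kappa>' s\<bar> \<le> M" "\<And>s. s \<notin> {1<..<4} \<Longrightarrow> \<kappa>' s = 0"
    by (rule smooth_step) (rule that)
  define q where "q x = (norm (x - x0))\<^sup>2" for x
  define C where "C = 64 * M\<^sup>2 * unit_ball_vol 2"
  have q_el: "q \<in> elementary"
  proof -
    have "q = (\<lambda>x. \<Sum>b\<in>Basis. (x \<bullet> b + (- (x0 \<bullet> b))) * (x \<bullet> b + (- (x0 \<bullet> b))))"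
      unfolding q_def power2_norm_eq_inner by (subst euclidean_inner) (simp add: inner_diff_left)
    also have "\<dots> \<in> elementary" by (intro elementary_sum elementary.intros) auto
    finally show ?thesis .
  qed
  have q_der: "(q has_derivative (\<lambda>h. 2 * ((x - x0) \<bullet> h))) (at x)" for x
    unfolding q_def power2_norm_eq_inner
    by (auto intro!: derivative_eq_intros simp: inner_commute)
  have q_cont: "continuous_on S q" for S by (rule elementary_continuous[OF q_el])
  show thesis
  proof (rule that)
    fix N :: nat assume N: "0 < N"
    define \<phi> where "\<phi> x = (1 / real N) * (\<Sum>j<N. \<kappa> (q x * (1 / 4 ^ j)))" for x
    define t where "t j x = \<kappa>' (q x * (1 / 4 ^ j)) * (2 / 4 ^ j)" for j x
    define w where "w x = (1 / real N * (\<Sum>j<N. t j x)) *\<^sub>R (x - x0)" for x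
    define R where "R = norm x0 + 2 ^ N"
    have el: "\<phi> \<in> elementary" unfolding \<phi>_def
      by (intro elementary.intros elementary_sum elementary_compose[OF \<kappa>(1)] q_el) auto
    have w_cont: "continuous_on UNIV w"
      unfolding w_def t_def
      by (intro continuous_intros continuous_on_compose2[OF \<kappa>(7)] q_cont) auto
    have der: "(\<phi> has_derivative (\<lambda>h. w x \<bullet> h)) (at x)" for x
    proof -
      have "((\<lambda>x. \<kappa> (q x * (1 / 4 ^ j))) has_derivative (\<lambda>h. t j x * ((x - x0) \<bullet> h))) (at x)" for j
      proof -
        have "((\<lambda>x. q x * (1 / 4 ^ j)) has_derivative (\<lambda>h. 2 * ((x - x0) \<bullet> h) * (1 / 4 ^ j))) (at x)"
          by (intro has_derivative_mult_left q_der)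
        from has_derivative_compose[OF this \<kappa>(6)[unfolded has_field_derivative_def]]
        show ?thesis by (rule has_derivative_eq_rhs) (simp add: t_def fun_eq_iff)
      qed
      then have "(\<phi> has_derivative (\<lambda>h. (1 / real N) * (\<Sum>j<N. t j x * ((x - x0) \<bullet> h)))) (at x)"
        unfolding \<phi>_def by (intro has_derivative_mult_right has_derivative_sum)
      then show ?thesis by (simp add: w_def sum_distrib_right)
    qed
    have far: "\<phi> x = 0 \<and> w x = 0" if "R < norm x" for x
    proof -
      have "2 ^ N \<le> norm (x - x0)" using that norm_triangle_ineq2[of x x0] by (simp add: R_def)
      then have "(2 ^ N)\<^sup>2 \<le> q x" unfolding q_def by (intro power_mono) auto
      then have q: "4 ^ N \<le> q x" by (simp only: power2_two_power)
      have big: "4 \<le> q x * (1 / 4 ^ j)" if "j < N" for j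
      proof -
        have "(4::real) ^ Suc j \<le> 4 ^ N" using that by (intro power_increasing) auto
        then show ?thesis using q by (simp add: field_simps)
      qed
      have "\<kappa> (q x * (1 / 4 ^ j)) = 0" "t j x = 0" if "j < N" for j
        using big[OF that] \<kappa>(3) \<kappa>(9)[of "q x * (1 / 4 ^ j)"] by (auto simp: t_def)
      then show ?thesis by (simp add: \<phi>_def w_def)
    qed
    have test: "test_function \<phi>"
      unfolding test_function_def smooth_on_def
    proof (intro conjI allI elementary_Ck_on el)
      have "{x. \<phi> x \<noteq> 0} \<subseteq> cball 0 R" using far by (force simp: not_less[symmetric])
      then show "compact (closure {x. \<phi> x \<noteq> 0})"
        using bounded_subset[OF bounded_cball] by (simp add: compact_closure)
    qed
    have \<phi>01: "0 \<le> \<phi> x \<and> \<phi> x \<le> 1" for x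
    proof
      show "0 \<le> \<phi> x" unfolding \<phi>_def by (intro mult_nonneg_nonneg sum_nonneg \<kappa>(4)) auto
      have "(\<Sum>j<N. \<kappa> (q x * (1 / 4 ^ j))) \<le> (\<Sum>j<N. 1)" by (intro sum_mono \<kappa>(5))
      then show "\<phi> x \<le> 1" using N by (simp add: \<phi>_def field_simps)
    qed
    have \<phi>1: "\<phi> x = 1" if "dist x x0 \<le> 1" for x
    proof -
      have q1: "q x \<le> 1" using that by (simp add: q_def dist_norm power_le_one)
      have "q x * (1 / 4 ^ j) \<le> 1" for j
      proof -
        have "(1::real) \<le> 4 ^ j" by simp
        then have "q x \<le> 4 ^ j" using q1 by linarith
        then show ?thesis by (simp add: field_simps)
      qed
      then have "\<kappa> (q x * (1 / 4 ^ j)) = 1" for j by (rule \<kappa>(2))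
      then show ?thesis using N by (simp add: \<phi>_def)
    qed
    define u where "u j x = indicator (cball x0 (2 ^ Suc j)) x * (16 * M\<^sup>2 / 4 ^ j)" for j and x :: "real^2"
    have M0: "0 \<le> M" using \<kappa>(8)[of 0] by linarith
    have t_nz: "4 ^ j < q x \<and> q x < 4 ^ Suc j" if "t j x \<noteq> 0" for j x
    proof -
      have "q x * (1 / 4 ^ j) \<in> {1<..<4}" using that \<kappa>(9)[of "q x * (1 / 4 ^ j)"] by (force simp: t_def)
      then show ?thesis by (simp add: field_simps)
    qed
    \<comment> \<open>the annuli carrying the different derivatives are disjoint, so no cross terms occur\<close>
    have bound: "(norm (w x))\<^sup>2 \<le> (1 / real N)\<^sup>2 * (\<Sum>j<N. u j x)" for x
    proof -
      have u0: "0 \<le> u j x" for j by (simp add: u_def)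
      have tj: "(t j x)\<^sup>2 * q x \<le> u j x" if nz: "t j x \<noteq> 0" for j
      proof -
        have q4: "q x < 4 ^ Suc j" using t_nz[OF nz] by simp
        then have "(norm (x - x0))\<^sup>2 \<le> (2 ^ Suc j)\<^sup>2"
          by (simp only: q_def power2_two_power)
        then have "norm (x - x0) \<le> 2 ^ Suc j" by (rule power2_le_imp_le) simp
        then have mem: "x \<in> cball x0 (2 ^ Suc j)" by (simp add: dist_norm norm_minus_commute)
        have "(\<kappa>' (q x * (1 / 4 ^ j)))\<^sup>2 \<le> M\<^sup>2" using \<kappa>(8) M0 by (intro abs_le_square_iff[THEN iffD1]) auto
        then have "(t j x)\<^sup>2 * q x \<le> (M\<^sup>2 * (2 / 4 ^ j)\<^sup>2) * 4 ^ Suc j"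
          unfolding t_def power_mult_distrib using q4
          by (intro mult_mono) (auto simp: q_def)
        also have "\<dots> = 16 * M\<^sup>2 / 4 ^ j" by (simp add: power2_eq_square field_simps)
        finally show ?thesis using mem by (simp add: u_def)
      qed
      have key: "(\<Sum>j<N. t j x)\<^sup>2 * q x \<le> (\<Sum>j<N. u j x)"
      proof (cases "\<exists>j<N. t j x \<noteq> 0")
        case False
        then show ?thesis using u0 by (simp add: sum_nonneg)
      next
        case True
        then obtain j where j: "j < N" "t j x \<noteq> 0" by auto
        have other: "t i x = 0" if "i \<noteq> j" for i
        proof (rule ccontr)
          assume "t i x \<noteq> 0"
          then have "4 ^ i < q x" "q x < 4 ^ Suc i" "4 ^ j < q x" "q x < 4 ^ Suc j"
            using t_nz j(2) by blast+
          then have "(4::real) ^ i < 4 ^ Suc j" "(4::real) ^ j < 4 ^ Suc i" by linarith+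
          then have "i < Suc j" "j < Suc i" by (auto simp only: power_strict_increasing_iff[of "4::real"])
          with that show False by simp
        qed
        have "(\<Sum>i<N. t i x) = (\<Sum>i\<in>{j}. t i x)"
          using j other by (intro sum.mono_neutral_right) auto
        then have "(\<Sum>i<N. t i x)\<^sup>2 * q x \<le> u j x" using tj[OF j(2)] by simp
        also have "\<dots> \<le> (\<Sum>j<N. u j x)" using j u0 by (intro member_le_sum) auto
        finally show ?thesis .
      qed
      have "(norm (w x))\<^sup>2 = (1 / real N)\<^sup>2 * ((\<Sum>j<N. t j x)\<^sup>2 * q x)"
        by (simp add: w_def q_def power_mult_distrib power_divide)
      also have "\<dots> \<le> (1 / real N)\<^sup>2 * (\<Sum>j<N. u j x)" by (intro mult_left_mono key) auto
      finally show ?thesis .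
    qed
    have u_int: "integrable lborel (u j)" for j
      unfolding u_def by (intro integrable_mult_left integrable_real_indicator) (auto simp: emeasure_cball)
    have u_val: "(LINT x|lborel. u j x) = C" for j
    proof -
      have "measure lborel (cball x0 (2 ^ Suc j)) = unit_ball_vol 2 * (2 ^ Suc j)\<^sup>2"
        by (simp add: content_cball)
      moreover have "((2::real) ^ Suc j)\<^sup>2 = 4 * 4 ^ j"
        unfolding power2_two_power by simp
      ultimately show ?thesis by (simp add: u_def C_def)
    qed
    have dom: "integrable lborel (\<lambda>x. (1 / real N)\<^sup>2 * (\<Sum>j<N. u j x))"
      by (intro integrable_mult_right Bochner_Integration.integrable_sum u_int)
    have w_int: "integrable lborel (\<lambda>x. (norm (w x))\<^sup>2)"
    proof (rule Bochner_Integration.integrable_bound[OF dom])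
      have "w \<in> borel_measurable borel" using w_cont by (rule borel_measurable_continuous_onI)
      then show "(\<lambda>x. (norm (w x))\<^sup>2) \<in> borel_measurable lborel" by simp
      show "AE x in lborel. norm ((norm (w x))\<^sup>2) \<le> norm ((1 / real N)\<^sup>2 * (\<Sum>j<N. u j x))"
        using bound by (auto intro!: AE_I2 order_trans[OF _ abs_ge_self])
    qed
    have "(LINT x|lborel. (norm (w x))\<^sup>2) \<le> (LINT x|lborel. (1 / real N)\<^sup>2 * (\<Sum>j<N. u j x))"
      using w_int dom bound by (intro integral_mono) auto
    also have "\<dots> = (1 / real N)\<^sup>2 * (\<Sum>j<N. C)"
      using u_int by (simp add: Bochner_Integration.integral_sum u_val)
    also have "\<dots> = C / real N" using N by (simp add: power2_eq_square)
    finally have "(LINT x|lborel. (norm (w x))\<^sup>2) \<le> C / real N" .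
    with test \<phi>01 \<phi>1 w_cont der far w_int
    show "\<exists>\<phi> w. test_function \<phi> \<and> (\<forall>x. 0 \<le> \<phi> x \<and> \<phi> x \<le> 1) \<and>
     (\<forall>x. dist x x0 \<le> 1 \<longrightarrow> \<phi> x = 1) \<and> continuous_on UNIV w \<and>
     (\<forall>x. (\<phi> has_derivative (\<lambda>h. w x \<bullet> h)) (at x)) \<and>
     (\<exists>R. \<forall>x. R < norm x \<longrightarrow> \<phi> x = 0 \<and> w x = 0) \<and>
     integrable lborel (\<lambda>x. (norm (w x))\<^sup>2) \<and> (LINT x|lborel. (norm (w x))\<^sup>2) \<le> C / real N"
      by (intro exI[of _ \<phi>] exI[of _ w] conjI allI impI exI[of _ R]) auto
  qed
qed

section \<open>Integration in the plane\<close>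

lemma has_real_derivative_along_line:
  assumes "(f has_derivative F) (at (q + s *\<^sub>R v))"
  shows "((\<lambda>s. f (q + s *\<^sub>R v)) has_real_derivative F v) (at s)"
proof -
  have "((\<lambda>s. q + s *\<^sub>R v) has_derivative (\<lambda>h. h *\<^sub>R v)) (at s)"
    by (auto intro!: derivative_eq_intros)
  from has_derivative_compose[OF this assms]
  have "((\<lambda>s. f (q + s *\<^sub>R v)) has_derivative (\<lambda>h. F (h *\<^sub>R v))) (at s)" .
  moreover have "F (h *\<^sub>R v) = F v * h" for h
    using linear_scale[OF has_derivative_linear[OF assms]] by (simp add: mult.commute)
  ultimately show ?thesis unfolding has_field_derivative_def by simp
qed

lemma mvt_along_line:
  fixes f :: "'a::real_normed_vector \<Rightarrow> real"
  assumes "0 < s" and cont: "\<And>t. 0 \<le> t \<Longrightarrow> t \<le> s \<Longrightarrow> isCont f (q + t *\<^sub>R v)"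
    and der: "\<And>t. 0 < t \<Longrightarrow> t < s \<Longrightarrow> (f has_derivative F (q + t *\<^sub>R v)) (at (q + t *\<^sub>R v))"
  obtains t where "0 < t" "t < s" "f (q + s *\<^sub>R v) - f q = s * F (q + t *\<^sub>R v) v"
proof -
  have "continuous_on {0..s} (\<lambda>t. f (q + t *\<^sub>R v))"
  proof (intro continuous_at_imp_continuous_on ballI)
    fix t assume "t \<in> {0..s}"
    then have 1: "isCont f (q + t *\<^sub>R v)" using cont by simp
    have 2: "isCont (\<lambda>t. q + t *\<^sub>R v) t" by (intro continuous_intros)
    show "isCont (\<lambda>t. f (q + t *\<^sub>R v)) t" using 2 1 by (rule isCont_o2)
  qed
  moreover have "(\<lambda>t. f (q + t *\<^sub>R v)) differentiable (at t)" if "0 < t" "t < s" for t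
    using has_real_derivative_along_line[OF der[OF that]] by (auto simp: real_differentiable_def)
  ultimately obtain l z where lz: "0 < z" "z < s" "((\<lambda>t. f (q + t *\<^sub>R v)) has_real_derivative l) (at z)"
    "f (q + s *\<^sub>R v) - f (q + 0 *\<^sub>R v) = (s - 0) * l"
    using MVT[OF assms(1), of "\<lambda>t. f (q + t *\<^sub>R v)"] by blast
  have "l = F (q + z *\<^sub>R v) v"
    using DERIV_unique[OF lz(3) has_real_derivative_along_line[OF der[OF lz(1,2)]]] .
  with lz show thesis by (intro that[of z]) auto
qed

lemma compactly_supported_bounded:
  fixes f :: "'a::euclidean_space \<Rightarrow> real"
  assumes "continuous_on UNIV f" "\<And>x. R < norm x \<Longrightarrow> f x = 0"
  obtains B where "0 < B" "\<And>x. \<bar>f x\<bar> \<le> B"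
proof -
  have "compact (f ` cball 0 R)"
    using assms(1) by (intro compact_continuous_image) (auto intro: continuous_on_subset)
  then obtain B where B: "0 < B" "\<And>x. x \<in> cball 0 R \<Longrightarrow> \<bar>f x\<bar> \<le> B"
    using compact_imp_bounded bounded_pos by (metis imageI real_norm_def)
  have "\<bar>f x\<bar> \<le> B" for x
    using B assms(2)[of x] by (cases "norm x \<le> R") auto
  with B(1) show thesis by (rule that)
qed

lemma compactly_supported_integrable:
  fixes f :: "'a::euclidean_space \<Rightarrow> real"
  assumes "continuous_on UNIV f" "\<And>x. R < norm x \<Longrightarrow> f x = 0"
  shows "integrable lborel f"
proof -
  have "integrable lborel (\<lambda>x. indicator (cball 0 R) x *\<^sub>R f x)"
    using assms(1) by (intro borel_integrable_compact) (auto intro: continuous_on_subset)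
  also have "(\<lambda>x. indicator (cball 0 R) x *\<^sub>R f x) = f"
    using assms(2) by (auto simp: fun_eq_iff indicator_def not_le)
  finally show ?thesis .
qed

text \<open>By translation invariance the difference quotients of a compactly supported function have
  integral zero, hence so has their limit.\<close>
lemma integral_derivative_eq_0:
  fixes h :: "'a::euclidean_space \<Rightarrow> real"
  assumes der: "\<And>x. (h has_derivative D x) (at x)" and cont: "continuous_on UNIV (\<lambda>x. D x v)"
    and supp: "\<And>x. R < norm x \<Longrightarrow> h x = 0"
  shows "(LINT x|lborel. D x v) = 0"
proof -
  have h_cont: "continuous_on UNIV h"
    using der has_derivative_continuous by (blast intro: continuous_at_imp_continuous_on)
  have D_supp: "D x v = 0" if "R < norm x" for x
  proof -
    have "open {x::'a. R < norm x}" by (intro open_Collect_less continuous_intros)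
    then have "(h has_derivative (\<lambda>_. 0)) (at x)"
      by (rule has_derivative_transform_within_open[where f="\<lambda>_. 0", rotated]) (use that supp in auto)
    with der[of x] have "D x = (\<lambda>_. 0)" by (rule has_derivative_unique)
    then show ?thesis by simp
  qed
  obtain B where B: "0 < B" "\<And>x. \<bar>D x v\<bar> \<le> B"
    using compactly_supported_bounded[OF cont D_supp] by metis
  define s where "s n = inverse (real (Suc n))" for n
  have s: "0 < s n" "s n \<le> 1" for n by (auto simp: s_def inverse_le_1_iff)
  define g where "g n x = (h (x + s n *\<^sub>R v) - h x) / s n" for n x
  have h_int: "integrable lborel h" by (rule compactly_supported_integrable[OF h_cont supp])
  have shift: "integrable lborel (\<lambda>x. h (x + c)) \<and> (LINT x|lborel. h (x + c)) = (LINT x|lborel. h x)" for c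
  proof -
    have d: "lborel = distr lborel borel ((+) c)" by (rule lborel_distr_plus[symmetric])
    have "integrable (distr lborel borel ((+) c)) h" using h_int lborel_distr_plus[of c] by simp
    then have "integrable lborel (\<lambda>x. h (c + x))" by (subst (asm) integrable_distr_eq) (use h_int in auto)
    moreover have "(LINT x|distr lborel borel ((+) c). h x) = (LINT x|lborel. h (c + x))"
      by (rule integral_distr) (use h_int in auto)
    ultimately show ?thesis by (simp add: lborel_distr_plus add.commute)
  qed
  have g0: "(LINT x|lborel. g n x) = 0" for n
    unfolding g_def using shift[of "s n *\<^sub>R v"] h_int by simp
  have "(\<lambda>n. LINT x|lborel. g n x) \<longlonglongrightarrow> (LINT x|lborel. D x v)"
  proof (rule integral_dominated_convergence[where w="\<lambda>x. indicator (cball 0 (R + norm v)) x * B"])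
    show "(\<lambda>x. D x v) \<in> borel_measurable lborel"
      using borel_measurable_continuous_onI[OF cont] by simp
    have "h \<in> borel_measurable borel" by (rule borel_measurable_continuous_onI[OF h_cont])
    then show "g n \<in> borel_measurable lborel" for n unfolding g_def by simp
    show "integrable lborel (\<lambda>x. indicator (cball (0::'a) (R + norm v)) x * B)"
    proof (cases "0 \<le> R + norm v")
      case True
      then show ?thesis by (intro integrable_mult_left integrable_real_indicator) (auto simp: emeasure_cball)
    next
      case False
      then show ?thesis by (simp add: cball_empty)
    qed
    show "AE x in lborel. (\<lambda>n. g n x) \<longlonglongrightarrow> D x v"
    proof (rule AE_I2)
      fix x
      have "((\<lambda>t. h (x + t *\<^sub>R v)) has_real_derivative D x v) (at 0)"
        using has_real_derivative_along_line[of h "D x" x 0 v] der[of x] by simp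
      then have "((\<lambda>t. (h (x + t *\<^sub>R v) - h x) / t) \<longlongrightarrow> D x v) (at 0)"
        by (simp add: has_field_derivative_iff)
      moreover have "filterlim s (at 0) sequentially"
        unfolding filterlim_at s_def
        by (auto intro!: always_eventually LIMSEQ_inverse_real_of_nat simp del: of_nat_Suc)
      ultimately show "(\<lambda>n. g n x) \<longlonglongrightarrow> D x v"
        unfolding g_def by (rule filterlim_compose)
    qed
    show "AE x in lborel. norm (g n x) \<le> indicator (cball 0 (R + norm v)) x * B" for n
    proof (rule AE_I2)
      fix x
      show "norm (g n x) \<le> indicator (cball 0 (R + norm v)) x * B"
      proof (cases "x \<in> cball 0 (R + norm v)")
        case True
        obtain t where "h (x + s n *\<^sub>R v) - h x = s n * D (x + t *\<^sub>R v) v"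
          using s(1)[of n] has_derivative_continuous[OF der] der by (rule mvt_along_line[where F=D])
        then have "g n x = D (x + t *\<^sub>R v) v" using s(1)[of n] by (simp add: g_def)
        then show ?thesis using B(2) True by simp
      next
        case False
        then have big: "R + norm v < norm x" by simp
        have "norm (s n *\<^sub>R v) \<le> norm v" using s[of n] by (simp add: mult_left_le_one_le)
        then have "norm x \<le> norm (x + s n *\<^sub>R v) + norm v"
          using norm_triangle_ineq4[of "x + s n *\<^sub>R v" "s n *\<^sub>R v"] by simp
        then have "R < norm (x + s n *\<^sub>R v)" using big by linarith
        moreover have "R < norm x" using big norm_ge_zero[of v] by linarith
        ultimately show ?thesis using False supp by (simp add: g_def)
      qed
    qed
  qed
  then show ?thesis using g0 by (simp add: LIMSEQ_const_iff)
qed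

lemma vec2_eq: "x = y \<longleftrightarrow> x $ 1 = y $ 1 \<and> x $ 2 = y $ 2" for x y :: "'a^2"
  by (simp add: vec_eq_iff forall_2)

lemma inner_vec2: "x \<bullet> y = x $ 1 * y $ 1 + x $ 2 * y $ 2" for x y :: "real^2"
  by (simp add: inner_vec_def sum_2)

lemma lborel_orthogonal_transformation:
  fixes T :: "real^2 \<Rightarrow> real^2"
  assumes T: "orthogonal_transformation T"
  shows "distr lborel borel T = lborel"
proof (rule lborel_eqI[symmetric])
  have Ti: "orthogonal_transformation (inv T)" using T by (rule orthogonal_transformation_inv)
  have bij: "bij T" using T by (rule orthogonal_transformation_bij)
  have meas: "T \<in> borel_measurable borel"
    using orthogonal_transformation_linear[OF T] by (intro borel_measurable_continuous_onI linear_continuous_on) (simp add: linear_conv_bounded_linear)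
  fix l u :: "real^2" assume lu: "\<And>b. b \<in> Basis \<Longrightarrow> l \<bullet> b \<le> u \<bullet> b"
  have "emeasure (distr lborel borel T) (box l u) = emeasure lborel (T -` box l u)"
    using meas by (simp add: emeasure_distr)
  also have "T -` box l u = inv T ` box l u" using bij by (simp add: bij_vimage_eq_inv_image)
  also have "emeasure lborel (inv T ` box l u) = emeasure lebesgue (inv T ` box l u)"
  proof -
    have "T -` box l u \<in> sets borel" using meas by (metis measurable_sets_borel borel_open open_box)
    then show ?thesis using bij by (simp add: bij_vimage_eq_inv_image)
  qed
  also have "\<dots> = ennreal (measure lebesgue (inv T ` box l u))"
    using measurable_orthogonal_image[OF Ti, of "box l u"] by (intro emeasure_eq_measure2) auto
  also have "\<dots> = ennreal (measure lebesgue (box l u))"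
    using measure_orthogonal_image[OF Ti, of "box l u"] by simp
  also have "\<dots> = ennreal (\<Prod>b\<in>Basis. (u - l) \<bullet> b)"
    using lu by (simp add: measure_lborel_box)
  finally show "emeasure (distr lborel borel T) (box l u) = ennreal (\<Prod>b\<in>Basis. (u - l) \<bullet> b)" .
qed simp

lemma lborel_vec2: "distr (lborel :: (real \<times> real) measure) borel (\<lambda>z. vector [fst z, snd z]) = (lborel :: (real^2) measure)"
proof (rule lborel_eqI[symmetric])
  let ?V = "\<lambda>z::real\<times>real. vector [fst z, snd z] :: real^2"
  have cont: "continuous_on UNIV ?V"
  proof -
    have "?V = (\<lambda>z. fst z *\<^sub>R axis 1 1 + snd z *\<^sub>R axis 2 1)"
      by (auto simp: fun_eq_iff vec2_eq axis_def)
    moreover have "continuous_on UNIV (\<lambda>z::real\<times>real. fst z *\<^sub>R axis 1 1 + snd z *\<^sub>R axis 2 1 :: real^2)"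
      by (intro continuous_intros)
    ultimately show ?thesis by (simp only:)
  qed
  then have meas: "?V \<in> borel_measurable borel" by (rule borel_measurable_continuous_onI)
  fix l u :: "real^2" assume lu: "\<And>b. b \<in> Basis \<Longrightarrow> l \<bullet> b \<le> u \<bullet> b"
  have le: "l $ 1 \<le> u $ 1" "l $ 2 \<le> u $ 2"
    using lu[of "axis 1 1"] lu[of "axis 2 1"] by (auto simp: inner_axis)
  have "box (l $ 1, l $ 2) (u $ 1, u $ 2) = {l $ 1<..<u $ 1} \<times> {l $ 2<..<u $ 2}"
    by (auto simp: box_def Basis_prod_def)
  then have "?V -` box l u = box (l $ 1, l $ 2) (u $ 1, u $ 2)"
    by (auto simp: mem_box_cart forall_2)
  then have "emeasure (distr lborel borel ?V) (box l u) = emeasure lborel (box (l $ 1, l $ 2) (u $ 1, u $ 2))"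
    using meas by (simp add: emeasure_distr)
  also have "\<dots> = ennreal ((u $ 1 - l $ 1) * (u $ 2 - l $ 2))"
    using le by (subst emeasure_lborel_box) (auto simp: Basis_prod_def)
  also have "(u $ 1 - l $ 1) * (u $ 2 - l $ 2) = (\<Prod>b\<in>Basis. (u - l) \<bullet> b)"
    by (simp add: Basis_vec_def axis_eq_axis prod.UNION_disjoint UNIV_2 inner_axis)
  finally show "emeasure (distr lborel borel ?V) (box l u) = ennreal (\<Prod>b\<in>Basis. (u - l) \<bullet> b)" .
qed simp

text \<open>Fubini's theorem in an orthonormal frame at \<open>p\<close>, by the invariance of Lebesgue measure under rotations
  and translations.\<close>
lemma integral_rotated_coordinates:
  fixes p \<tau> n :: "real^2" and F :: "real^2 \<Rightarrow> real"
  assumes on: "norm \<tau> = 1" "norm n = 1" "\<tau> \<bullet> n = 0" and F: "integrable lborel F"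
  shows "integrable (lborel \<Otimes>\<^sub>M lborel) (\<lambda>(t, y). F (p + t *\<^sub>R \<tau> + y *\<^sub>R n))"
    and "(LINT x|lborel. F x) = (LINT t|lborel. LINT y|lborel. F (p + t *\<^sub>R \<tau> + y *\<^sub>R n))"
proof -
  define T where "T x = (x $ 1) *\<^sub>R \<tau> + (x $ 2) *\<^sub>R n" for x :: "real^2"
  have ot: "orthogonal_transformation T"
    unfolding orthogonal_transformation_def
  proof
    show "linear T" by (rule linearI) (simp_all add: T_def algebra_simps)
    have "\<tau> \<bullet> \<tau> = 1" "n \<bullet> n = 1" "n \<bullet> \<tau> = 0"
      using on by (simp_all add: norm_eq_1 inner_commute)
    then have "T v \<bullet> T w = v $ 1 * w $ 1 + v $ 2 * w $ 2" for v w
      using on(3) by (simp add: T_def inner_add_left inner_add_right)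
    then show "\<forall>v w. T v \<bullet> T w = v \<bullet> w" by (simp add: inner_vec2)
  qed
  have T_meas: "T \<in> borel_measurable borel"
    using orthogonal_transformation_linear[OF ot] by (intro borel_measurable_continuous_onI linear_continuous_on) (simp add: linear_conv_bounded_linear)
  let ?V = "\<lambda>z::real\<times>real. vector [fst z, snd z] :: real^2"
  have V_meas: "?V \<in> borel_measurable borel"
  proof -
    have "?V = (\<lambda>z. fst z *\<^sub>R axis 1 1 + snd z *\<^sub>R axis 2 1)"
      by (auto simp: fun_eq_iff vec2_eq axis_def)
    moreover have "continuous_on UNIV (\<lambda>z::real\<times>real. fst z *\<^sub>R axis 1 1 + snd z *\<^sub>R axis 2 1 :: real^2)"
      by (intro continuous_intros)
    ultimately show ?thesis by (simp only: borel_measurable_continuous_onI)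
  qed
  have F_meas: "F \<in> borel_measurable borel" using F by auto
  have P: "distr (lborel \<Otimes>\<^sub>M lborel) borel (\<lambda>z. p + T (?V z)) = lborel"
  proof -
    have "lborel = distr (distr (distr lborel borel ?V) borel T) borel ((+) p)"
      by (simp only: lborel_vec2 lborel_orthogonal_transformation[OF ot] lborel_distr_plus)
    also have "\<dots> = distr lborel borel ((+) p \<circ> T \<circ> ?V)"
      using T_meas V_meas by (simp add: distr_distr comp_def)
    finally show ?thesis by (simp add: lborel_prod comp_def)
  qed
  have P_meas: "(\<lambda>z. p + T (?V z)) \<in> measurable (lborel \<Otimes>\<^sub>M lborel) borel"
  proof -
    have "(\<lambda>z. p + T (?V z)) \<in> measurable lborel borel"
      using measurable_compose[OF V_meas T_meas] by simp
    then show ?thesis by (simp add: lborel_prod)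
  qed
  have TV: "p + T (?V z) = p + fst z *\<^sub>R \<tau> + snd z *\<^sub>R n" for z
    by (simp add: T_def)
  have "integrable (distr (lborel \<Otimes>\<^sub>M lborel) borel (\<lambda>z. p + T (?V z))) F"
    using F P by simp
  then have int: "integrable (lborel \<Otimes>\<^sub>M lborel) (\<lambda>z. F (p + T (?V z)))"
    using integrable_distr_eq[OF P_meas F_meas] by simp
  then show I: "integrable (lborel \<Otimes>\<^sub>M lborel) (\<lambda>(t, y). F (p + t *\<^sub>R \<tau> + y *\<^sub>R n))"
    by (simp add: TV split_beta')
  have "(LINT x|lborel. F x) = (LINT z|(lborel \<Otimes>\<^sub>M lborel). F (p + T (?V z)))"
    using integral_distr[OF P_meas F_meas] P by simp
  also have "\<dots> = (LINT z|(lborel \<Otimes>\<^sub>M lborel). (\<lambda>(t, y). F (p + t *\<^sub>R \<tau> + y *\<^sub>R n)) z)"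
    by (simp add: TV split_beta')
  also have "\<dots> = (LINT t|lborel. LINT y|lborel. F (p + t *\<^sub>R \<tau> + y *\<^sub>R n))"
    using lborel_pair.integral_fst'[OF I] by simp
  finally show "(LINT x|lborel. F x) = (LINT t|lborel. LINT y|lborel. F (p + t *\<^sub>R \<tau> + y *\<^sub>R n))" .
qed

section \<open>Harmonic functions and the gradient bound\<close>

text \<open>Two applications of the mean value theorem, first in the direction \<open>v\<close> to the increment in direction
  \<open>w\<close>, then in the direction \<open>w\<close>. The left-hand side is symmetric in \<open>v\<close> and \<open>w\<close>, which yields the
  symmetry of second derivatives.\<close>
lemma second_difference:
  fixes f :: "'a::real_normed_vector \<Rightarrow> real"
  assumes "0 < h"
    and der: "\<And>s t. 0 \<le> s \<Longrightarrow> s \<le> h \<Longrightarrow> 0 \<le> t \<Longrightarrow> t \<le> h \<Longrightarrow>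
        (f has_derivative F (x + s *\<^sub>R v + t *\<^sub>R w)) (at (x + s *\<^sub>R v + t *\<^sub>R w))"
    and der2: "\<And>s t. 0 \<le> s \<Longrightarrow> s \<le> h \<Longrightarrow> 0 \<le> t \<Longrightarrow> t \<le> h \<Longrightarrow>
        ((\<lambda>p. F p v) has_derivative G (x + s *\<^sub>R v + t *\<^sub>R w)) (at (x + s *\<^sub>R v + t *\<^sub>R w))"
  obtains s t where "0 < s" "s < h" "0 < t" "t < h"
    "f (x + h *\<^sub>R v + h *\<^sub>R w) - f (x + h *\<^sub>R v) - f (x + h *\<^sub>R w) + f x
      = h * (h * G (x + s *\<^sub>R v + t *\<^sub>R w) w)"
proof -
  define k where "k p = f (p + h *\<^sub>R w) - f p" for p
  define K where "K p e = F (p + h *\<^sub>R w) e - F p e" for p e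
  have k: "(k has_derivative K (x + s *\<^sub>R v)) (at (x + s *\<^sub>R v))" if "0 \<le> s" "s \<le> h" for s
  proof -
    have 1: "(f has_derivative F (x + s *\<^sub>R v + h *\<^sub>R w)) (at (x + s *\<^sub>R v + h *\<^sub>R w))"
      using der[of s h] that assms(1) by simp
    have "((\<lambda>p. p + h *\<^sub>R w) has_derivative (\<lambda>e. e)) (at (x + s *\<^sub>R v))"
      by (auto intro!: derivative_eq_intros)
    from has_derivative_compose[OF this 1]
    have "((\<lambda>p. f (p + h *\<^sub>R w)) has_derivative F (x + s *\<^sub>R v + h *\<^sub>R w)) (at (x + s *\<^sub>R v))" .
    moreover have "(f has_derivative F (x + s *\<^sub>R v)) (at (x + s *\<^sub>R v))"
      using der[of s 0] that assms(1) by simp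
    ultimately show ?thesis unfolding k_def K_def by (rule has_derivative_diff)
  qed
  obtain s where s: "0 < s" "s < h" "k (x + h *\<^sub>R v) - k x = h * K (x + s *\<^sub>R v) v"
  proof (rule mvt_along_line[where s=h and f=k and q=x and v=v and F=K])
    show "isCont k (x + t *\<^sub>R v)" if "0 \<le> t" "t \<le> h" for t
      using has_derivative_continuous[OF k[OF that]] .
  qed (use assms(1) k in auto)
  let ?q = "x + s *\<^sub>R v"
  have g: "((\<lambda>p. F p v) has_derivative G (?q + t *\<^sub>R w)) (at (?q + t *\<^sub>R w))" if "0 \<le> t" "t \<le> h" for t
    using der2[of s t] s that by simp
  obtain t where t: "0 < t" "t < h" "F (?q + h *\<^sub>R w) v - F ?q v = h * G (?q + t *\<^sub>R w) w"
  proof (rule mvt_along_line[where s=h and f="\<lambda>p. F p v" and q="?q" and v=w and F=G])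
    show "isCont (\<lambda>p. F p v) (?q + t *\<^sub>R w)" if "0 \<le> t" "t \<le> h" for t
      using has_derivative_continuous[OF g[OF that]] .
  qed (use assms(1) g in auto)
  show thesis
  proof (rule that[OF s(1,2) t(1,2)])
    have "f (x + h *\<^sub>R v + h *\<^sub>R w) - f (x + h *\<^sub>R v) - f (x + h *\<^sub>R w) + f x = k (x + h *\<^sub>R v) - k x"
      by (simp add: k_def)
    also have "\<dots> = h * (F (?q + h *\<^sub>R w) v - F ?q v)" using s(3) by (simp add: K_def)
    finally show "f (x + h *\<^sub>R v + h *\<^sub>R w) - f (x + h *\<^sub>R v) - f (x + h *\<^sub>R w) + f x
      = h * (h * G (?q + t *\<^sub>R w) w)" using t(3) by simp
  qed
qed

lemma second_derivative_symmetric: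
  fixes f :: "'a::real_normed_vector \<Rightarrow> real"
  assumes "open S" "x \<in> S"
    and f: "\<And>p. p \<in> S \<Longrightarrow> (f has_derivative F p) (at p)"
    and v: "\<And>p. p \<in> S \<Longrightarrow> ((\<lambda>p. F p v) has_derivative G p) (at p)"
    and w: "\<And>p. p \<in> S \<Longrightarrow> ((\<lambda>p. F p w) has_derivative H p) (at p)"
    and G: "continuous_on S (\<lambda>p. G p w)" and H: "continuous_on S (\<lambda>p. H p v)"
  shows "G x w = H x v"
proof (rule ccontr)
  assume ne: "G x w \<noteq> H x v"
  define e where "e = \<bar>G x w - H x v\<bar> / 2"
  have e: "0 < e" using ne by (simp add: e_def)
  obtain d1 where d1: "0 < d1" "ball x d1 \<subseteq> S" using assms(1,2) open_contains_ball by metis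
  obtain d2 where d2: "0 < d2" "\<And>p. p \<in> S \<Longrightarrow> dist p x < d2 \<Longrightarrow> dist (G p w) (G x w) < e"
    using G assms(2) e unfolding continuous_on_iff by metis
  obtain d3 where d3: "0 < d3" "\<And>p. p \<in> S \<Longrightarrow> dist p x < d3 \<Longrightarrow> dist (H p v) (H x v) < e"
    using H assms(2) e unfolding continuous_on_iff by metis
  define d where "d = min d1 (min d2 d3)"
  define m where "m = norm v + norm w + 1"
  define h where "h = d / (2 * m)"
  have pos: "0 < m" using norm_ge_zero[of v] norm_ge_zero[of w] unfolding m_def by linarith
  have d: "0 < d" "d \<le> d1" "d \<le> d2" "d \<le> d3" using d1 d2 d3 by (auto simp: d_def)
  then have h: "0 < h" using pos by (simp add: h_def)
  have near: "dist (x + s *\<^sub>R v + t *\<^sub>R w) x < d" if "0 \<le> s" "s \<le> h" "0 \<le> t" "t \<le> h" for s t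
  proof -
    have "dist (x + s *\<^sub>R v + t *\<^sub>R w) x = norm (s *\<^sub>R v + t *\<^sub>R w)" by (simp add: dist_norm)
    also have "\<dots> \<le> s * norm v + t * norm w" using that norm_triangle_ineq[of "s *\<^sub>R v" "t *\<^sub>R w"] by simp
    also have "\<dots> \<le> h * norm v + h * norm w" using that by (intro add_mono mult_right_mono) auto
    also have "\<dots> \<le> h * m" using h by (simp add: m_def algebra_simps)
    also have "\<dots> = d / 2" using pos by (simp add: h_def)
    finally show ?thesis using d by linarith
  qed
  have inS: "x + s *\<^sub>R v + t *\<^sub>R w \<in> S" if "0 \<le> s" "s \<le> h" "0 \<le> t" "t \<le> h" for s t
    using near[OF that] d d1(2) by (auto simp: dist_commute)
  have inS': "x + s *\<^sub>R w + t *\<^sub>R v \<in> S" if "0 \<le> s" "s \<le> h" "0 \<le> t" "t \<le> h" for s t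
    using inS[OF that(3,4,1,2)] by (simp add: add.commute add.left_commute)
  obtain s t where st: "0 < s" "s < h" "0 < t" "t < h"
    "f (x + h *\<^sub>R v + h *\<^sub>R w) - f (x + h *\<^sub>R v) - f (x + h *\<^sub>R w) + f x
      = h * (h * G (x + s *\<^sub>R v + t *\<^sub>R w) w)"
    by (rule second_difference[of h f F x v w G]) (use h f v inS that in auto)
  obtain s' t' where st': "0 < s'" "s' < h" "0 < t'" "t' < h"
    "f (x + h *\<^sub>R w + h *\<^sub>R v) - f (x + h *\<^sub>R w) - f (x + h *\<^sub>R v) + f x
      = h * (h * H (x + s' *\<^sub>R w + t' *\<^sub>R v) v)"
    by (rule second_difference[of h f F x w v H]) (use h f w inS' that in auto)
  have "f (x + h *\<^sub>R v + h *\<^sub>R w) = f (x + h *\<^sub>R w + h *\<^sub>R v)" by (simp add: add.commute add.left_commute)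
  then have "h * (h * G (x + s *\<^sub>R v + t *\<^sub>R w) w) = h * (h * H (x + s' *\<^sub>R w + t' *\<^sub>R v) v)"
    using st(5) st'(5) by linarith
  then have eq: "G (x + s *\<^sub>R v + t *\<^sub>R w) w = H (x + s' *\<^sub>R w + t' *\<^sub>R v) v" using h by simp
  have "dist (G (x + s *\<^sub>R v + t *\<^sub>R w) w) (G x w) < e"
    using st near[of s t] inS[of s t] d by (intro d2(2)) auto
  moreover have "dist (H (x + s' *\<^sub>R w + t' *\<^sub>R v) v) (H x v) < e"
  proof -
    have "x + s' *\<^sub>R w + t' *\<^sub>R v = x + t' *\<^sub>R v + s' *\<^sub>R w" by simp
    moreover have "dist (H (x + t' *\<^sub>R v + s' *\<^sub>R w) v) (H x v) < e"
      using st' near[of t' s'] inS[of t' s'] d by (intro d3(2)) auto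
    ultimately show ?thesis by (simp only:)
  qed
  ultimately have "\<bar>G x w - H x v\<bar> < 2 * e" using eq by (simp add: dist_real_def)
  then show False by (simp add: e_def)
qed

text \<open>A Moebius transformation maps the right half plane to the disc and \<open>F z0\<close> to 0, so the Schwarz lemma
  applies. Its derivative part is the gradient estimate for positive harmonic functions, its growth
  part is Harnack's inequality.\<close>
lemma positive_real_part_bounds:
  assumes hol: "F holomorphic_on ball z0 d" and d: "0 < d"
    and pos: "\<And>z. z \<in> ball z0 d \<Longrightarrow> 0 < Re (F z)"
  shows "norm (deriv F z0) \<le> 2 * Re (F z0) / d"
    and "\<And>z. dist z0 z < d \<Longrightarrow> Re (F z0) * (d - dist z0 z) / (d + dist z0 z) \<le> Re (F z)"
proof -
  define X where "X = Re (F z0)"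
  have X: "0 < X" using pos[of z0] d by (simp add: X_def)
  define h where "h w = (F (z0 + of_real d * w) - F z0) / (F (z0 + of_real d * w) + cnj (F z0))" for w
  have inb: "z0 + of_real d * w \<in> ball z0 d" if "norm w < 1" for w
    using that d by (simp add: dist_norm norm_mult)
  have den: "F (z0 + of_real d * w) + cnj (F z0) \<noteq> 0" if "norm w < 1" for w
    using pos[OF inb[OF that]] X by (auto simp: complex_eq_iff X_def)
  have hol2: "(\<lambda>w. F (z0 + of_real d * w)) holomorphic_on ball 0 1"
  proof -
    have "(F \<circ> (\<lambda>w. z0 + of_real d * w)) holomorphic_on ball 0 1"
      by (intro holomorphic_on_compose_gen[OF _ hol] holomorphic_intros) (use inb in auto)
    then show ?thesis by (simp add: comp_def)
  qed
  have hh: "h holomorphic_on ball 0 1"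
    unfolding h_def using den by (intro holomorphic_intros hol2) auto
  have h0: "h 0 = 0" by (simp add: h_def)
  have h1: "norm (h w) < 1" if w: "norm w < 1" for w
  proof -
    define G where "G = F (z0 + of_real d * w)"
    have G: "0 < Re G" using pos[OF inb[OF w]] by (simp add: G_def)
    have "(norm (G - F z0))\<^sup>2 < (norm (G + cnj (F z0)))\<^sup>2"
      using mult_pos_pos[OF G X] unfolding cmod_power2 X_def by (simp add: power2_eq_square algebra_simps)
    then have "norm (G - F z0) < norm (G + cnj (F z0))" by (rule power2_less_imp_less) simp
    then show ?thesis using den[OF w] by (simp add: h_def G_def norm_divide)
  qed
  have S: "norm (h w) \<le> norm w" "norm (deriv h 0) \<le> 1" if "norm w < 1" for w
    using Schwarz_Lemma(1,2)[OF hh h0 h1 that] by auto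
  have "(F has_field_derivative deriv F z0) (at (z0 + of_real d * 0))"
    using hol d by (simp add: holomorphic_derivI[of F "ball z0 d"])
  then have Fd: "((\<lambda>w. F (z0 + of_real d * w)) has_field_derivative deriv F z0 * of_real d) (at 0)"
    by (rule DERIV_chain2[where g="\<lambda>w. z0 + of_real d * w"]) (auto intro!: derivative_eq_intros)
  have "F z0 + cnj (F z0) = of_real (2 * X)" by (simp add: complex_eq_iff X_def)
  then have "((\<lambda>w. F (z0 + of_real d * w) + cnj (F z0)) 0) = of_real (2 * X)" by simp
  moreover have "((\<lambda>w. (F (z0 + of_real d * w) - F z0) / (F (z0 + of_real d * w) + cnj (F z0))) has_field_derivative
      ((deriv F z0 * of_real d) * (F (z0 + of_real d * 0) + cnj (F z0)) - (F (z0 + of_real d * 0) - F z0) * (deriv F z0 * of_real d))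
       / ((F (z0 + of_real d * 0) + cnj (F z0)) * (F (z0 + of_real d * 0) + cnj (F z0)))) (at 0)"
    using DERIV_divide[OF DERIV_diff[OF Fd DERIV_const] DERIV_add[OF Fd DERIV_const], of "cnj (F z0)" "F z0"] den[of 0] by simp
  ultimately have "(h has_field_derivative deriv F z0 * of_real d / of_real (2 * X)) (at 0)"
    unfolding h_def using X by (simp add: mult.commute)
  then have "deriv h 0 = deriv F z0 * of_real d / of_real (2 * X)" by (rule DERIV_imp_deriv)
  then have "norm (deriv F z0 * of_real d / of_real (2 * X)) \<le> 1" using S(2)[of 0] by simp
  then have "norm (deriv F z0) * d / (2 * X) \<le> 1" using X d by (simp add: norm_divide norm_mult)
  then show "norm (deriv F z0) \<le> 2 * Re (F z0) / d" using X d by (simp add: field_simps X_def)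
  fix z assume z: "dist z0 z < d"
  define w where "w = (z - z0) / of_real d"
  define s where "s = norm w"
  have w: "z0 + of_real d * w = z" using d by (simp add: w_def)
  have sd: "s = dist z0 z / d" using d by (simp add: s_def w_def norm_divide dist_norm norm_minus_commute)
  then have s1: "s < 1" "0 \<le> s" using z d by auto
  have Z: "0 < Re (F z)" using pos z by simp
  have "norm (F z - F z0) / norm (F z + cnj (F z0)) \<le> s"
    using S(1)[of w] s1 w by (simp add: h_def s_def norm_divide)
  moreover have "0 < norm (F z + cnj (F z0))" using den[of w] s1 w by (simp add: s_def)
  ultimately have "norm (F z - F z0) \<le> s * norm (F z + cnj (F z0))" by (simp add: field_simps)
  then have "(norm (F z - F z0))\<^sup>2 \<le> (s * norm (F z + cnj (F z0)))\<^sup>2" by (intro power_mono) auto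
  \<comment> \<open>as \<open>s \<le> 1\<close>, the imaginary parts can be dropped\<close>
  then have "(Re (F z) - X)\<^sup>2 + (Im (F z) - Im (F z0))\<^sup>2 \<le> s\<^sup>2 * ((Re (F z) + X)\<^sup>2 + (Im (F z) - Im (F z0))\<^sup>2)"
    by (simp add: power_mult_distrib cmod_power2 X_def)
  moreover have "s\<^sup>2 * (Im (F z) - Im (F z0))\<^sup>2 \<le> 1 * (Im (F z) - Im (F z0))\<^sup>2"
    using s1 by (intro mult_right_mono) (auto simp: power_le_one)
  moreover have "s\<^sup>2 * ((Re (F z) + X)\<^sup>2 + (Im (F z) - Im (F z0))\<^sup>2)
      = (s * (Re (F z) + X))\<^sup>2 + s\<^sup>2 * (Im (F z) - Im (F z0))\<^sup>2"
    by (subst distrib_left) (simp only: power_mult_distrib)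
  ultimately have "(Re (F z) - X)\<^sup>2 \<le> (s * (Re (F z) + X))\<^sup>2" by linarith
  then have "\<bar>Re (F z) - X\<bar> \<le> s * (Re (F z) + X)"
    using Z X s1 by (metis abs_le_square_iff abs_of_nonneg add_nonneg_nonneg less_imp_le mult_nonneg_nonneg)
  then have "X - Re (F z) \<le> s * (Re (F z) + X)" by linarith
  then have "X * (1 - s) \<le> Re (F z) * (1 + s)" by (simp add: algebra_simps)
  then have "X * (1 - s) / (1 + s) \<le> Re (F z)" using s1 by (simp add: field_simps)
  moreover have "X * (1 - s) / (1 + s) = X * (d - dist z0 z) / (d + dist z0 z)"
  proof -
    have "1 - s = (d - dist z0 z) / d" "1 + s = (d + dist z0 z) / d" using d by (simp_all add: sd field_simps)
    then show ?thesis using d by simp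
  qed
  ultimately show "Re (F z0) * (d - dist z0 z) / (d + dist z0 z) \<le> Re (F z)" by (simp add: X_def)
qed

text \<open>The plane as the complex numbers and back, to apply complex analysis to \<open>u\<close>.\<close>
definition cvec :: "real^2 \<Rightarrow> complex" where "cvec x = Complex (x $ 1) (x $ 2)"
definition rvec :: "complex \<Rightarrow> real^2" where "rvec z = vector [Re z, Im z]"

lemma cvec_rvec [simp]: "cvec (rvec z) = z" "rvec (cvec x) = x"
  by (simp_all add: cvec_def rvec_def vec2_eq)

lemma rvec_nth [simp]: "rvec z $ 1 = Re z" "rvec z $ 2 = Im z" by (simp_all add: rvec_def)

lemma bounded_linear_cvec: "bounded_linear cvec"
  unfolding linear_conv_bounded_linear[symmetric]
  by (rule linearI) (simp_all add: cvec_def complex_eq_iff)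

lemma bounded_linear_rvec: "bounded_linear rvec"
  unfolding linear_conv_bounded_linear[symmetric]
  by (rule linearI) (simp_all add: vec2_eq)

lemma norm_cvec [simp]: "norm (cvec x) = norm x"
  by (simp add: cvec_def cmod_def norm_eq_sqrt_inner inner_vec2 power2_eq_square)

lemma dist_cvec [simp]: "dist (cvec x) (cvec y) = dist x y"
  by (metis bounded_linear_cvec dist_norm linear_diff norm_cvec bounded_linear.linear)

text \<open>What is used of a classical solution: \<open>a\<close>, \<open>b\<close> are the first derivatives of \<open>u\<close>, and \<open>c\<close>, \<open>d\<close>, \<open>- c\<close> the
  second derivatives, all extended from \<open>\<Omega>\<close> to continuous functions on the plane. The extensions are
  determined on the closure of \<open>\<Omega>\<close>; their values elsewhere are arbitrary.\<close>
locale free_boundary =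
  fixes u a b c d :: "real^2 \<Rightarrow> real" and \<Omega> :: "(real^2) set"
  assumes Omega: "\<Omega> = {x. -1 < u x \<and> u x < 1}"
    and cont: "continuous_on UNIV u" "continuous_on UNIV a" "continuous_on UNIV b"
      "continuous_on UNIV c" "continuous_on UNIV d"
    and outside: "x \<notin> \<Omega> \<Longrightarrow> u x = 1 \<or> u x = -1"
    and du: "x \<in> \<Omega> \<Longrightarrow> (u has_derivative (\<lambda>h. a x * h $ 1 + b x * h $ 2)) (at x)"
    and da: "x \<in> \<Omega> \<Longrightarrow> (a has_derivative (\<lambda>h. c x * h $ 1 + d x * h $ 2)) (at x)"
    and db: "x \<in> \<Omega> \<Longrightarrow> (b has_derivative (\<lambda>h. d x * h $ 1 - c x * h $ 2)) (at x)"
    and unit_gradient: "x \<in> frontier \<Omega> \<Longrightarrow> (a x)\<^sup>2 + (b x)\<^sup>2 = 1"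
    and smooth: "smooth_boundary \<Omega>"
begin

lemma open_Omega: "open \<Omega>"
  unfolding Omega using cont(1) by (intro open_Collect_conj open_Collect_less) auto

lemma frontier_value: "x \<in> frontier \<Omega> \<Longrightarrow> u x = 1 \<or> u x = -1"
  using outside open_Omega by (auto simp: frontier_def interior_open)

text \<open>The gradient as a complex number, conjugated: this is the holomorphic function whose primitives have
  real part \<open>u\<close> up to a constant.\<close>
definition f :: "complex \<Rightarrow> complex" where "f z = Complex (a (rvec z)) (- b (rvec z))"

lemma f_has_field_derivative:
  assumes "rvec z \<in> \<Omega>"
  shows "(f has_field_derivative Complex (c (rvec z)) (- d (rvec z))) (at z)"
proof -
  have r: "(rvec has_derivative rvec) (at z)"
    using bounded_linear_rvec by (rule bounded_linear_imp_has_derivative)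
  have A: "((\<lambda>z. a (rvec z)) has_derivative (\<lambda>h. c (rvec z) * rvec h $ 1 + d (rvec z) * rvec h $ 2)) (at z)"
    using has_derivative_compose[OF r da[OF assms]] .
  have B: "((\<lambda>z. b (rvec z)) has_derivative (\<lambda>h. d (rvec z) * rvec h $ 1 - c (rvec z) * rvec h $ 2)) (at z)"
    using has_derivative_compose[OF r db[OF assms]] .
  have "((\<lambda>z. of_real (a (rvec z)) - \<i> * of_real (b (rvec z))) has_derivative
     (\<lambda>h. of_real (c (rvec z) * rvec h $ 1 + d (rvec z) * rvec h $ 2)
        - \<i> * of_real (d (rvec z) * rvec h $ 1 - c (rvec z) * rvec h $ 2))) (at z)"
    by (intro has_derivative_diff has_derivative_mult_right has_derivative_of_real A B)
  moreover have "(\<lambda>z. of_real (a (rvec z)) - \<i> * of_real (b (rvec z))) = f"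
    by (auto simp: fun_eq_iff f_def complex_eq_iff)
  moreover have "(\<lambda>h. of_real (c (rvec z) * rvec h $ 1 + d (rvec z) * rvec h $ 2)
        - \<i> * of_real (d (rvec z) * rvec h $ 1 - c (rvec z) * rvec h $ 2))
      = (*) (Complex (c (rvec z)) (- d (rvec z)))"
    by (auto simp: fun_eq_iff complex_eq_iff algebra_simps)
  ultimately show ?thesis by (simp add: has_field_derivative_def)
qed

lemma open_rvec_Omega: "open (rvec -` \<Omega>)"
  using open_Omega bounded_linear_rvec by (intro open_vimage linear_continuous_on)

lemma f_holomorphic: "f holomorphic_on rvec -` \<Omega>"
  unfolding holomorphic_on_open[OF open_rvec_Omega] using f_has_field_derivative by auto

text \<open>On a disc inside \<open>\<Omega>\<close> the positive harmonic function \<open>1 - \<sigma> u\<close> is the real part of a holomorphic function.\<close>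
lemma interior_estimates:
  assumes ball: "ball x r \<subseteq> \<Omega>" and r: "0 < r" and \<sigma>: "\<sigma> = 1 \<or> \<sigma> = (-1::real)"
  shows "sqrt ((a x)\<^sup>2 + (b x)\<^sup>2) \<le> 2 * (1 - \<sigma> * u x) / r"
    and "\<And>y. dist x y < r \<Longrightarrow> (1 - \<sigma> * u x) * (r - dist x y) / (r + dist x y) \<le> 1 - \<sigma> * u y"
proof -
  let ?B = "ball (cvec x) r"
  have sub: "?B \<subseteq> rvec -` \<Omega>"
  proof
    fix z assume "z \<in> ?B"
    then have "dist (cvec x) (cvec (rvec z)) < r" by simp
    then have "dist x (rvec z) < r" by (simp only: dist_cvec)
    then show "z \<in> rvec -` \<Omega>" using ball by auto
  qed
  obtain g where g: "\<And>z. z \<in> ?B \<Longrightarrow> (g has_field_derivative f z) (at z within ?B)"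
    using holomorphic_convex_primitive'[OF convex_ball open_ball holomorphic_on_subset[OF f_holomorphic sub]] by metis
  have g': "(g has_field_derivative f z) (at z)" if "z \<in> ?B" for z
    using g[OF that] that by (simp add: at_within_open[OF _ open_ball])
  define k where "k z = Re (g z) - u (rvec z)" for z
  have kder: "(k has_derivative (\<lambda>h. 0)) (at z)" if "z \<in> ?B" for z
  proof -
    have r: "(rvec has_derivative rvec) (at z)"
      using bounded_linear_rvec by (rule bounded_linear_imp_has_derivative)
    have "(g has_derivative (*) (f z)) (at z)" using g'[OF that] by (simp add: has_field_derivative_def)
    then have 1: "((\<lambda>z. Re (g z)) has_derivative (\<lambda>h. Re (f z * h))) (at z)" by (rule has_derivative_Re)
    have "rvec z \<in> \<Omega>" using that sub by auto
    then have 2: "((\<lambda>z. u (rvec z)) has_derivative (\<lambda>h. a (rvec z) * rvec h $ 1 + b (rvec z) * rvec h $ 2)) (at z)"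
      using has_derivative_compose[OF r du] by blast
    have "(k has_derivative (\<lambda>h. Re (f z * h) - (a (rvec z) * rvec h $ 1 + b (rvec z) * rvec h $ 2))) (at z)"
      unfolding k_def using 1 2 by (rule has_derivative_diff)
    then show ?thesis by (simp add: f_def)
  qed
  have "\<exists>C. \<forall>z\<in>?B. k z = C"
    using has_derivative_zero_constant[OF convex_ball, of "cvec x" r k] kder has_derivative_at_withinI by metis
  then obtain C where C: "\<And>z. z \<in> ?B \<Longrightarrow> k z = C" by blast
  define F where "F z = of_real (1 + \<sigma> * C) - of_real \<sigma> * g z" for z
  have ReF: "Re (F z) = 1 - \<sigma> * u (rvec z)" if "z \<in> ?B" for z
    using C[OF that] by (simp add: F_def k_def algebra_simps)
  have Fd: "(F has_field_derivative - of_real \<sigma> * f z) (at z)" if "z \<in> ?B" for z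
    unfolding F_def using g'[OF that] by (auto intro!: derivative_eq_intros)
  have hol: "F holomorphic_on ?B" unfolding holomorphic_on_open[OF open_ball] using Fd by blast
  have pos: "0 < Re (F z)" if "z \<in> ?B" for z
  proof -
    have "rvec z \<in> \<Omega>" using that sub by auto
    then show ?thesis using ReF[OF that] \<sigma> by (auto simp: Omega)
  qed
  have x: "cvec x \<in> ?B" using r by simp
  have "norm (deriv F (cvec x)) = sqrt ((a x)\<^sup>2 + (b x)\<^sup>2)"
    using DERIV_imp_deriv[OF Fd[OF x]] \<sigma> by (auto simp: norm_mult f_def cmod_def)
  then show "sqrt ((a x)\<^sup>2 + (b x)\<^sup>2) \<le> 2 * (1 - \<sigma> * u x) / r"
    using positive_real_part_bounds(1)[OF hol r pos] ReF[OF x] by simp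
  fix y assume y: "dist x y < r"
  then have "cvec y \<in> ?B" by simp
  then show "(1 - \<sigma> * u x) * (r - dist x y) / (r + dist x y) \<le> 1 - \<sigma> * u y"
    using positive_real_part_bounds(2)[OF hol r pos, of "cvec y"] ReF x y by simp
qed

lemma cont_at: "isCont u x" "isCont a x" "isCont b x" "isCont c x" "isCont d x"
  using cont by (auto simp: continuous_on_eq_continuous_at)

text \<open>At distance \<open>r\<close> from the nearest boundary point \<open>x0\<close> the function \<open>W = 1 - u(x0) u\<close> is at most \<open>2 r\<close>:
  otherwise Harnack's inequality would force it to leave the value 0 at \<open>x0\<close> with slope greater than 1.
  The interior gradient estimate then gives the bound 4. If there is no boundary, the estimate on unit
  discs is enough.\<close>
lemma gradient_bound:
  assumes x: "x \<in> \<Omega>"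
  shows "(a x)\<^sup>2 + (b x)\<^sup>2 \<le> 16"
proof -
  have "sqrt ((a x)\<^sup>2 + (b x)\<^sup>2) \<le> 4"
  proof (cases "\<Omega> = UNIV")
    case True
    have "sqrt ((a x)\<^sup>2 + (b x)\<^sup>2) \<le> 2 * (1 - 1 * u x) / 1"
      using True by (intro interior_estimates(1)) auto
    moreover have "-1 < u x" using x by (simp add: Omega)
    ultimately show ?thesis by simp
  next
    case False
    have cl: "closed (- \<Omega>)" "- \<Omega> \<noteq> {}" using open_Omega False by auto
    obtain x0 where x0: "x0 \<in> - \<Omega>" "\<And>y. y \<in> - \<Omega> \<Longrightarrow> dist x x0 \<le> dist x y"
      using distance_attains_inf[OF cl] by metis
    define r where "r = dist x x0"
    have r: "0 < r" using x x0 by (auto simp: r_def)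
    have ball: "ball x r \<subseteq> \<Omega>" using x0(2) by (force simp: r_def)
    define y where "y t = x0 + t *\<^sub>R (x - x0)" for t
    have dist_y: "dist x (y t) = (1 - t) * r" if "0 \<le> t" "t \<le> 1" for t
    proof -
      have "x - y t = (1 - t) *\<^sub>R (x - x0)" by (simp add: y_def algebra_simps)
      then show ?thesis using that by (simp add: dist_norm r_def)
    qed
    have yO: "y t \<in> \<Omega>" if "0 < t" "t \<le> 1" for t
      using dist_y[of t] that r ball by (intro subsetD[OF ball]) (simp add: mult_less_cancel_right2)
    have fr: "x0 \<in> frontier \<Omega>"
    proof -
      have "x0 \<in> closure \<Omega>"
      proof (rule closure_approachable[THEN iffD2], intro allI impI)
        fix e :: real assume e: "0 < e"
        define t where "t = min 1 (e / (2 * r))"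
        have t: "0 < t" "t \<le> 1" using e r by (auto simp: t_def)
        have "t * r \<le> e / (2 * r) * r" using r by (intro mult_right_mono) (auto simp: t_def)
        then have "t * r < e" using r e by simp
        moreover have "dist (y t) x0 = t * r" using t by (simp add: y_def dist_norm r_def)
        ultimately show "\<exists>y\<in>\<Omega>. dist y x0 < e" using yO[OF t] by (intro bexI[of _ "y t"]) auto
      qed
      then show ?thesis using x0(1) open_Omega by (auto simp: frontier_def interior_open)
    qed
    define \<sigma> where "\<sigma> = u x0"
    have \<sigma>: "\<sigma> = 1 \<or> \<sigma> = -1" using frontier_value[OF fr] by (simp add: \<sigma>_def)
    define W where "W = 1 - \<sigma> * u x"
    \<comment> \<open>Harnack gives a linear lower bound along the radius, whose slope at the boundary is at most 1\<close>
    have lower: "W * t / 2 \<le> 1 - \<sigma> * u (y t)" if t: "0 < t" "t < 1" for t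
    proof -
      have W: "0 \<le> W" using x \<sigma> by (auto simp: W_def Omega)
      have "W * (r - (1 - t) * r) / (r + (1 - t) * r) \<le> 1 - \<sigma> * u (y t)"
        using interior_estimates(2)[OF ball r \<sigma>, of "y t"] dist_y[of t] t r
        by (simp add: W_def mult_less_cancel_right2)
      moreover have "W * (r - (1 - t) * r) / (r + (1 - t) * r) = W * t / (2 - t)"
        using r t by (simp add: divide_simps) (simp add: algebra_simps)
      moreover have "W * t / 2 \<le> W * t / (2 - t)"
        using t W by (intro divide_left_mono) auto
      ultimately show ?thesis by linarith
    qed
    have slope: "\<exists>s. 0 < s \<and> s < t \<and> W / 2 \<le> r * sqrt ((a (y s))\<^sup>2 + (b (y s))\<^sup>2)" if t: "0 < t" "t < 1" for t
    proof -
      obtain s where s: "0 < s" "s < t"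
        "u (x0 + t *\<^sub>R (x - x0)) - u x0 = t * (a (y s) * (x - x0) $ 1 + b (y s) * (x - x0) $ 2)"
      proof (rule mvt_along_line[where s=t and f=u and q=x0 and v="x - x0" and F="\<lambda>(p::real^2) (h::real^2). a p * h $ 1 + b p * h $ 2"])
        show "(u has_derivative (\<lambda>h. a (x0 + s *\<^sub>R (x - x0)) * h $ 1 + b (x0 + s *\<^sub>R (x - x0)) * h $ 2)) (at (x0 + s *\<^sub>R (x - x0)))"
          if "0 < s" "s < t" for s
          using du[OF yO[of s]] that t by (simp add: y_def)
      qed (use t cont_at in \<open>auto simp: y_def\<close>)
      define G where "G = (vector [a (y s), b (y s)] :: real^2)"
      have "u (y t) - \<sigma> = t * (G \<bullet> (x - x0))"
        using s(3) by (simp add: G_def inner_vec2 \<sigma>_def y_def)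
      then have "1 - \<sigma> * u (y t) = t * (- \<sigma> * (G \<bullet> (x - x0)))"
        using \<sigma> by (auto simp: algebra_simps)
      also have "\<dots> \<le> t * (norm G * norm (x - x0))"
      proof (rule mult_left_mono)
        have "\<bar>- \<sigma> * (G \<bullet> (x - x0))\<bar> = \<bar>G \<bullet> (x - x0)\<bar>" using \<sigma> by auto
        then show "- \<sigma> * (G \<bullet> (x - x0)) \<le> norm G * norm (x - x0)"
          using Cauchy_Schwarz_ineq2[of G "x - x0"] by linarith
      qed (use t in simp)
      also have "norm G = sqrt ((a (y s))\<^sup>2 + (b (y s))\<^sup>2)"
        by (simp add: G_def norm_eq_sqrt_inner inner_vec2 power2_eq_square)
      finally have "W * t / 2 \<le> t * (sqrt ((a (y s))\<^sup>2 + (b (y s))\<^sup>2) * r)"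
        using lower[OF t] by (simp add: r_def dist_norm)
      then have "t * (W / 2) \<le> t * (r * sqrt ((a (y s))\<^sup>2 + (b (y s))\<^sup>2))" by (simp add: mult_ac)
      then have "W / 2 \<le> r * sqrt ((a (y s))\<^sup>2 + (b (y s))\<^sup>2)" using t by simp
      then show ?thesis using s by blast
    qed
    define g where "g s = r * sqrt ((a (y s))\<^sup>2 + (b (y s))\<^sup>2)" for s
    have "continuous_on UNIV y" unfolding y_def by (intro continuous_intros)
    then have "continuous_on UNIV g" unfolding g_def
      by (intro continuous_intros continuous_on_compose2[OF cont(2)] continuous_on_compose2[OF cont(3)]) auto
    then have g_cont: "isCont g 0" by (simp add: continuous_on_eq_continuous_at)
    have "W / 2 \<le> g 0"
    proof (rule ccontr)
      assume "\<not> W / 2 \<le> g 0"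
      then obtain \<delta> where \<delta>: "0 < \<delta>" "\<And>s. dist s 0 < \<delta> \<Longrightarrow> dist (g s) (g 0) < W / 2 - g 0"
        using g_cont unfolding continuous_at_eps_delta by (metis diff_gt_0_iff_gt not_le)
      obtain s where s: "0 < s" "s < min \<delta> (1/2)" "W / 2 \<le> g s"
      proof -
        have "0 < min \<delta> (1/2)" "min \<delta> (1/2) < 1" using \<delta>(1) by auto
        from slope[OF this] show ?thesis using that unfolding g_def by blast
      qed
      then have "dist (g s) (g 0) < W / 2 - g 0" by (intro \<delta>(2)) auto
      then show False using s(3) by (simp add: dist_real_def)
    qed
    also have "g 0 = r" using unit_gradient[OF fr] by (simp add: g_def y_def)
    finally have "W \<le> 2 * r" by simp
    moreover have "sqrt ((a x)\<^sup>2 + (b x)\<^sup>2) \<le> 2 * W / r"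
      unfolding W_def by (rule interior_estimates(1)[OF ball r \<sigma>])
    moreover have "2 * W / r \<le> 4" using calculation(1) r by (simp add: field_simps)
    ultimately show ?thesis by linarith
  qed
  then have "(sqrt ((a x)\<^sup>2 + (b x)\<^sup>2))\<^sup>2 \<le> 4\<^sup>2" by (intro power_mono) auto
  then show ?thesis by simp
qed

end

lemma Basis_vec2: "(Basis :: (real^2) set) = {axis 1 1, axis 2 1}"
  by (auto simp: Basis_vec_def UNIV_2)

lemma sum_Basis_vec2: "(\<Sum>i\<in>(Basis :: (real^2) set). g i) = g (axis 1 1) + g (axis 2 1)"
  by (simp add: Basis_vec2 axis_eq_axis)

lemma differentiable_vec2:
  fixes f :: "real^2 \<Rightarrow> real"
  assumes "f differentiable (at x)"
  shows "(f has_derivative (\<lambda>h. dir_deriv (axis 1 1) f x * h $ 1 + dir_deriv (axis 2 1) f x * h $ 2)) (at x)"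
proof -
  have der: "(f has_derivative frechet_derivative f (at x)) (at x)"
    using assms frechet_derivative_works by blast
  interpret L: linear "frechet_derivative f (at x)" using der by (rule has_derivative_linear)
  have "frechet_derivative f (at x) h = dir_deriv (axis 1 1) f x * h $ 1 + dir_deriv (axis 2 1) f x * h $ 2" for h
  proof -
    have "h = (h $ 1) *\<^sub>R axis 1 1 + (h $ 2) *\<^sub>R axis 2 1" by (simp add: vec2_eq axis_def)
    then have "frechet_derivative f (at x) h = frechet_derivative f (at x) ((h $ 1) *\<^sub>R axis 1 1 + (h $ 2) *\<^sub>R axis 2 1)" by metis
    then show ?thesis by (simp add: L.add L.scale dir_deriv_def)
  qed
  then have "frechet_derivative f (at x) = (\<lambda>h. dir_deriv (axis 1 1) f x * h $ 1 + dir_deriv (axis 2 1) f x * h $ 2)"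
    by (rule ext)
  with der show ?thesis by metis
qed

section \<open>Classical solutions\<close>

text \<open>The derivatives extend continuously to the closure by hypothesis and from there to the plane by
  Tietze's theorem. The limits of the gradient at the boundary are the values of these extensions.\<close>
lemma classical_solution_free_boundary:
  assumes "classical_solution u"
  obtains a b c d where "free_boundary u a b c d (transition_region u)"
proof -
  define \<Omega> where "\<Omega> = transition_region u"
  define e1 e2 :: "real^2" where "e1 = axis 1 1" and "e2 = axis 2 1"
  have op: "open \<Omega>" and sm: "smooth_boundary \<Omega>" and cu: "continuous_on UNIV u"
    and ck: "Ck_closure (Suc (Suc 0)) u \<Omega>" and lap: "\<And>x. x \<in> \<Omega> \<Longrightarrow> laplacian u x = 0"
    and out: "\<And>x. x \<notin> \<Omega> \<Longrightarrow> u x = 1 \<or> u x = -1"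
    and fr: "\<And>x. x \<in> frontier \<Omega> \<Longrightarrow> \<exists>g. (grad u \<longlongrightarrow> g) (at x within \<Omega>) \<and> norm g = 1"
    using assms unfolding classical_solution_def Let_def \<Omega>_def numeral_2_eq_2 by blast+
  have D0: "\<And>x. x \<in> \<Omega> \<Longrightarrow> u differentiable (at x)"
    and D1: "\<And>x v. x \<in> \<Omega> \<Longrightarrow> dir_deriv v u differentiable (at x)"
    and E1: "\<And>v. \<exists>g. continuous_on (closure \<Omega>) g \<and> (\<forall>x\<in>\<Omega>. g x = dir_deriv v u x)"
    and E2: "\<And>v w. \<exists>g. continuous_on (closure \<Omega>) g \<and> (\<forall>x\<in>\<Omega>. g x = dir_deriv w (dir_deriv v u) x)"
    using ck by auto
  have ext: "\<exists>g. continuous_on UNIV g \<and> (\<forall>x\<in>\<Omega>. g x = k x)"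
    if ex: "\<exists>g. continuous_on (closure \<Omega>) g \<and> (\<forall>x\<in>\<Omega>. g x = k x)" for k :: "real^2 \<Rightarrow> real"
  proof -
    obtain g where g: "continuous_on (closure \<Omega>) g" "\<forall>x\<in>\<Omega>. g x = k x" using ex by blast
    obtain g' where g': "continuous_on UNIV g'" "\<And>x. x \<in> closure \<Omega> \<Longrightarrow> g' x = g x"
      using Tietze_unbounded[OF g(1), of UNIV] by auto
    have "g' x = k x" if x: "x \<in> \<Omega>" for x
      using g(2) x g'(2) subsetD[OF closure_subset x] by simp
    then show ?thesis using g'(1) by (intro exI[of _ g']) simp
  qed
  obtain a where a: "continuous_on UNIV a" "\<And>x. x \<in> \<Omega> \<Longrightarrow> a x = dir_deriv e1 u x" using ext[OF E1] by metis
  obtain b where b: "continuous_on UNIV b" "\<And>x. x \<in> \<Omega> \<Longrightarrow> b x = dir_deriv e2 u x" using ext[OF E1] by metis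
  obtain c where c: "continuous_on UNIV c" "\<And>x. x \<in> \<Omega> \<Longrightarrow> c x = dir_deriv e1 (dir_deriv e1 u) x" using ext[OF E2] by metis
  obtain d where d: "continuous_on UNIV d" "\<And>x. x \<in> \<Omega> \<Longrightarrow> d x = dir_deriv e2 (dir_deriv e1 u) x" using ext[OF E2] by metis
  have contD: "continuous_on \<Omega> (\<lambda>x. dir_deriv w (dir_deriv v u) x)" for v w
  proof -
    obtain g where g: "continuous_on UNIV g" "\<forall>x\<in>\<Omega>. g x = dir_deriv w (dir_deriv v u) x" using ext[OF E2] by metis
    then show ?thesis using continuous_on_cong[of \<Omega> \<Omega> g] continuous_on_subset by (metis subset_UNIV)
  qed
  have sym: "dir_deriv e2 (dir_deriv e1 u) x = dir_deriv e1 (dir_deriv e2 u) x" if x: "x \<in> \<Omega>" for x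
    using op x
  proof (rule second_derivative_symmetric[where F="\<lambda>p. frechet_derivative u (at p)" and f=u
       and G="\<lambda>p. frechet_derivative (dir_deriv e1 u) (at p)" and H="\<lambda>p. frechet_derivative (dir_deriv e2 u) (at p)"
       and v=e1 and w=e2, folded dir_deriv_def])
    show "(u has_derivative frechet_derivative u (at p)) (at p)" if "p \<in> \<Omega>" for p
      using D0[OF that] frechet_derivative_works by blast
    show "((\<lambda>p. dir_deriv e1 u p) has_derivative frechet_derivative (\<lambda>p. dir_deriv e1 u p) (at p)) (at p)" if "p \<in> \<Omega>" for p
      using D1[OF that] frechet_derivative_works by blast
    show "((\<lambda>p. dir_deriv e2 u p) has_derivative frechet_derivative (\<lambda>p. dir_deriv e2 u p) (at p)) (at p)" if "p \<in> \<Omega>" for p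
      using D1[OF that] frechet_derivative_works by blast
  qed (use contD in auto)
  have "free_boundary u a b c d \<Omega>"
  proof
    show "\<Omega> = {x. - 1 < u x \<and> u x < 1}" by (simp add: \<Omega>_def transition_region_def)
    show "smooth_boundary \<Omega>" "continuous_on UNIV u" "continuous_on UNIV a" "continuous_on UNIV b"
      "continuous_on UNIV c" "continuous_on UNIV d" by fact+
    show "u x = 1 \<or> u x = - 1" if "x \<notin> \<Omega>" for x using out that .
    fix x
    {
      assume x: "x \<in> \<Omega>"
      show "(u has_derivative (\<lambda>h. a x * h $ 1 + b x * h $ 2)) (at x)"
        using differentiable_vec2[OF D0[OF x]] by (simp add: a b x e1_def e2_def)
      have "(dir_deriv e1 u has_derivative (\<lambda>h. c x * h $ 1 + d x * h $ 2)) (at x)"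
        using differentiable_vec2[OF D1[OF x, of e1]] c(2)[OF x] d(2)[OF x] by (simp add: e1_def e2_def)
      then show "(a has_derivative (\<lambda>h. c x * h $ 1 + d x * h $ 2)) (at x)"
        using op x by (rule has_derivative_transform_within_open) (simp add: a)
      have "dir_deriv e1 (dir_deriv e1 u) x + dir_deriv e2 (dir_deriv e2 u) x = 0"
        using lap[OF x] by (simp add: laplacian_def sum_Basis_vec2 e1_def e2_def)
      then have "dir_deriv e2 (dir_deriv e2 u) x = - c x" using c(2)[OF x] by simp
      then have "(dir_deriv e2 u has_derivative (\<lambda>h. d x * h $ 1 + - c x * h $ 2)) (at x)"
        using differentiable_vec2[OF D1[OF x, of e2]] d(2)[OF x] sym[OF x] by (simp add: e1_def e2_def)
      then have "(dir_deriv e2 u has_derivative (\<lambda>h. d x * h $ 1 - c x * h $ 2)) (at x)" by simp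
      then show "(b has_derivative (\<lambda>h. d x * h $ 1 - c x * h $ 2)) (at x)"
        using op x by (rule has_derivative_transform_within_open) (simp add: b)
    }
    assume x: "x \<in> frontier \<Omega>"
    then obtain g where g: "(grad u \<longlongrightarrow> g) (at x within \<Omega>)" "norm g = 1" using fr by blast
    define G where "G y = a y *\<^sub>R e1 + b y *\<^sub>R e2" for y
    have "continuous_on UNIV G" unfolding G_def using a b by (intro continuous_intros)
    then have "isCont G x" by (simp add: continuous_on_eq_continuous_at)
    then have "(G \<longlongrightarrow> G x) (at x)" by (simp add: isCont_def)
    then have "(G \<longlongrightarrow> G x) (at x within \<Omega>)" by (rule Lim_at_imp_Lim_at_within)
    moreover have "\<forall>\<^sub>F y in at x within \<Omega>. G y = grad u y"
      unfolding eventually_at_filter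
      by (intro always_eventually) (auto simp: G_def grad_def sum_Basis_vec2 a b e1_def e2_def)
    ultimately have "(grad u \<longlongrightarrow> G x) (at x within \<Omega>)" by (rule Lim_transform_eventually)
    moreover have "at x within \<Omega> \<noteq> bot"
    proof -
      have "x \<in> closure \<Omega>" "x \<notin> \<Omega>" using x op by (auto simp: frontier_def interior_open)
      then show ?thesis by (auto simp: closure_def trivial_limit_within)
    qed
    ultimately have "G x = g" using g(1) tendsto_unique by blast
    then have "(norm (G x))\<^sup>2 = 1" using g(2) by simp
    then show "(a x)\<^sup>2 + (b x)\<^sup>2 = 1"
      unfolding power2_norm_eq_inner by (simp add: inner_vec2 G_def e1_def e2_def axis_def power2_eq_square)
  qed
  then show thesis using that by (simp add: \<Omega>_def)
qed

section \<open>Charts of the boundary\<close>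

lemma smooth_on_gradient:
  fixes \<rho> :: "real^2 \<Rightarrow> real"
  assumes "smooth_on \<rho> U" "open U" "x \<in> U"
  shows "(\<rho> has_derivative (\<lambda>h. grad \<rho> x \<bullet> h)) (at x)"
    and "(\<lambda>x. grad \<rho> x \<bullet> v) differentiable (at x)"
proof -
  have ck: "Ck_on (Suc (Suc 0)) \<rho> U" using assms(1) unfolding smooth_on_def by blast
  then have D0: "\<And>x. x \<in> U \<Longrightarrow> \<rho> differentiable (at x)"
    and D1: "\<And>x v. x \<in> U \<Longrightarrow> dir_deriv v \<rho> differentiable (at x)"
    by auto
  have g: "dir_deriv (axis 1 1) \<rho> y * v $ 1 + dir_deriv (axis 2 1) \<rho> y * v $ 2 = grad \<rho> y \<bullet> v" for y v
    by (simp add: grad_def sum_Basis_vec2 inner_vec2 axis_def)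
  have der: "(\<rho> has_derivative (\<lambda>h. grad \<rho> y \<bullet> h)) (at y)" if "y \<in> U" for y
    using differentiable_vec2[OF D0[OF that]] unfolding g .
  show "(\<rho> has_derivative (\<lambda>h. grad \<rho> x \<bullet> h)) (at x)" by (rule der[OF assms(3)])
  have eq: "dir_deriv v \<rho> y = grad \<rho> y \<bullet> v" if "y \<in> U" for y
    by (rule dir_deriv_eq[OF der[OF that]])
  obtain D where "(dir_deriv v \<rho> has_derivative D) (at x)"
    using D1[OF assms(3)] unfolding differentiable_def by blast
  then have "((\<lambda>x. grad \<rho> x \<bullet> v) has_derivative D) (at x)"
    using assms(2,3) by (rule has_derivative_transform_within_open) (rule eq)
  then show "(\<lambda>x. grad \<rho> x \<bullet> v) differentiable (at x)" unfolding differentiable_def by blast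
qed

text \<open>A boundary point of an open set lies outside the set but in its closure.\<close>
lemma defining_function_eq_0:
  assumes "open \<Omega>" "p \<in> frontier \<Omega>" "defining_function \<Omega> p U \<rho>"
  shows "\<rho> p = 0"
proof -
  have U: "open U" "p \<in> U" "smooth_on \<rho> U" "\<And>x. x \<in> U \<Longrightarrow> x \<in> \<Omega> \<longleftrightarrow> \<rho> x < 0"
    using assms(3) unfolding defining_function_def by blast+
  have "p \<notin> \<Omega>" "p \<in> closure \<Omega>" using assms(1,2) by (auto simp: frontier_def interior_open)
  then have ge: "0 \<le> \<rho> p" using U by force
  have "\<not> 0 < \<rho> p"
  proof
    assume pos: "0 < \<rho> p"
    have "Ck_on 0 \<rho> U" using U(3) unfolding smooth_on_def by blast
    then have "continuous_on U \<rho>" by simp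
    then have "open (U \<inter> \<rho> -` {0<..})" using U(1) by (intro continuous_open_preimage) auto
    then have "U \<inter> \<rho> -` {0<..} \<inter> \<Omega> \<noteq> {}"
      using \<open>p \<in> closure \<Omega>\<close> pos U(2) by (subst open_Int_closure_eq_empty[symmetric, THEN arg_cong[where f=Not]]) auto
    then show False using U(4) by force
  qed
  with ge show ?thesis by simp
qed

text \<open>Two unit normals \<open>n1 \<noteq> n2\<close> would disagree about the direction \<open>n2 - n1\<close>: it points into \<open>\<Omega>\<close> according to
  the first defining function and out of \<open>\<Omega>\<close> according to the second.\<close>
lemma outward_normal_eq:
  fixes \<Omega> :: "(real^2) set"
  assumes "open \<Omega>" "p \<in> frontier \<Omega>" "defining_function \<Omega> p U \<rho>"
  shows "outward_normal \<Omega> p = grad \<rho> p /\<^sub>R norm (grad \<rho> p)"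
proof -
  have *: "n1 = n2"
    if 1: "defining_function \<Omega> p U1 \<rho>1" "n1 = grad \<rho>1 p /\<^sub>R norm (grad \<rho>1 p)"
    and 2: "defining_function \<Omega> p U2 \<rho>2" "n2 = grad \<rho>2 p /\<^sub>R norm (grad \<rho>2 p)" for U1 U2 \<rho>1 \<rho>2 n1 n2
  proof (rule ccontr)
    assume ne: "n1 \<noteq> n2"
    have U1: "open U1" "p \<in> U1" "smooth_on \<rho>1 U1" "grad \<rho>1 p \<noteq> 0" "\<And>x. x \<in> U1 \<Longrightarrow> x \<in> \<Omega> \<longleftrightarrow> \<rho>1 x < 0"
      using 1(1) unfolding defining_function_def by blast+
    have U2: "open U2" "p \<in> U2" "smooth_on \<rho>2 U2" "grad \<rho>2 p \<noteq> 0" "\<And>x. x \<in> U2 \<Longrightarrow> x \<in> \<Omega> \<longleftrightarrow> \<rho>2 x < 0"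
      using 2(1) unfolding defining_function_def by blast+
    have n: "norm n1 = 1" "norm n2 = 1" using 1 2 U1(4) U2(4) by auto
    define v where "v = n2 - n1"
    have "0 < (norm (n1 - n2))\<^sup>2" using ne by simp
    then have lt: "n1 \<bullet> n2 < 1"
      using n by (simp add: power2_norm_eq_inner inner_diff_left inner_diff_right inner_commute norm_eq_1)
    have v1: "n1 \<bullet> v < 0" and v2: "0 < n2 \<bullet> v"
      using lt n by (simp_all add: v_def inner_diff_right inner_commute norm_eq_1)
    have s1: "grad \<rho>1 p = norm (grad \<rho>1 p) *\<^sub>R n1" and s2: "grad \<rho>2 p = norm (grad \<rho>2 p) *\<^sub>R n2"
      using 1 2 U1(4) U2(4) by simp_all
    have g1: "grad \<rho>1 p \<bullet> v < 0"
      using U1(4) v1 by (subst s1) (simp add: mult_less_0_iff)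
    have g2: "0 < grad \<rho>2 p \<bullet> v"
      using U2(4) v2 by (subst s2) simp
    have d1: "((\<lambda>t. \<rho>1 (p + t *\<^sub>R v)) has_real_derivative grad \<rho>1 p \<bullet> v) (at 0)"
      by (rule has_real_derivative_along_line) (use smooth_on_gradient(1)[OF U1(3,1,2)] in simp)
    have d2: "((\<lambda>t. \<rho>2 (p + t *\<^sub>R v)) has_real_derivative grad \<rho>2 p \<bullet> v) (at 0)"
      by (rule has_real_derivative_along_line) (use smooth_on_gradient(1)[OF U2(3,1,2)] in simp)
    have z: "\<rho>1 p = 0" "\<rho>2 p = 0"
      using defining_function_eq_0[OF assms(1,2)] 1(1) 2(1) by blast+
    obtain \<delta>1 where \<delta>1: "0 < \<delta>1" "\<And>h. 0 < h \<Longrightarrow> h < \<delta>1 \<Longrightarrow> \<rho>1 (p + h *\<^sub>R v) < 0"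
      using DERIV_neg_dec_right[OF d1 g1] z by auto
    obtain \<delta>2 where \<delta>2: "0 < \<delta>2" "\<And>h. 0 < h \<Longrightarrow> h < \<delta>2 \<Longrightarrow> 0 < \<rho>2 (p + h *\<^sub>R v)"
      using DERIV_pos_inc_right[OF d2 g2] z by auto
    have "open ((\<lambda>t. p + t *\<^sub>R v) -` (U1 \<inter> U2))"
      using U1(1) U2(1) by (intro open_vimage open_Int continuous_intros)
    moreover have "0 \<in> (\<lambda>t. p + t *\<^sub>R v) -` (U1 \<inter> U2)" using U1(2) U2(2) by simp
    ultimately obtain \<delta> where \<delta>: "0 < \<delta>" "ball 0 \<delta> \<subseteq> (\<lambda>t. p + t *\<^sub>R v) -` (U1 \<inter> U2)"
      using open_contains_ball by metis
    define h where "h = min \<delta> (min \<delta>1 \<delta>2) / 2"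
    have h: "0 < h" "h < \<delta>1" "h < \<delta>2" "h \<in> ball 0 \<delta>" using \<delta> \<delta>1 \<delta>2 by (auto simp: h_def)
    have "h \<in> (\<lambda>t. p + t *\<^sub>R v) -` (U1 \<inter> U2)" by (rule subsetD[OF \<delta>(2) h(4)])
    then have "p + h *\<^sub>R v \<in> U1" "p + h *\<^sub>R v \<in> U2" by simp_all
    then show False using U1(5) U2(5) \<delta>1(2)[of h] \<delta>2(2)[of h] h by force
  qed
  show ?thesis unfolding outward_normal_def
  proof (rule the_equality)
    show "\<exists>U' \<rho>'. defining_function \<Omega> p U' \<rho>' \<and> grad \<rho> p /\<^sub>R norm (grad \<rho> p) = grad \<rho>' p /\<^sub>R norm (grad \<rho>' p)"
      using assms(3) by blast
    fix n assume "\<exists>U' \<rho>'. defining_function \<Omega> p U' \<rho>' \<and> n = grad \<rho>' p /\<^sub>R norm (grad \<rho>' p)"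
    then obtain U' \<rho>' where "defining_function \<Omega> p U' \<rho>'" "n = grad \<rho>' p /\<^sub>R norm (grad \<rho>' p)" by blast
    then show "n = grad \<rho> p /\<^sub>R norm (grad \<rho> p)" using * assms(3) by blast
  qed
qed

definition perp :: "real^2 \<Rightarrow> real^2" where "perp n = vector [- (n $ 2), n $ 1]"

lemma perp: "norm (perp n) = norm n" "perp n \<bullet> n = 0" "n \<bullet> perp n = 0"
  by (simp_all add: perp_def norm_eq_sqrt_inner inner_vec2)

text \<open>\<open>pt p n t y\<close> is the point with coordinates \<open>(t, y)\<close> in the orthonormal frame at \<open>p\<close> whose second
  axis is \<open>n\<close>.\<close>
definition pt :: "real^2 \<Rightarrow> real^2 \<Rightarrow> real \<Rightarrow> real \<Rightarrow> real^2" where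
  "pt p n t y = p + t *\<^sub>R perp n + y *\<^sub>R n"

lemma norm_pt_diff:
  assumes "norm n = 1"
  shows "norm (pt p n t y - pt p n s z) \<le> \<bar>t - s\<bar> + \<bar>y - z\<bar>"
proof -
  have "pt p n t y - pt p n s z = (t - s) *\<^sub>R perp n + (y - z) *\<^sub>R n" by (simp add: pt_def algebra_simps)
  also have "norm \<dots> \<le> norm ((t - s) *\<^sub>R perp n) + norm ((y - z) *\<^sub>R n)" by (rule norm_triangle_ineq)
  finally show ?thesis using assms by (simp add: perp)
qed

lemma pt_coordinates:
  assumes "norm n = 1"
  shows "pt p n ((x - p) \<bullet> perp n) ((x - p) \<bullet> n) = x"
proof -
  have n: "n $ 1 * n $ 1 + n $ 2 * n $ 2 = 1" using assms by (simp add: norm_eq_1 inner_vec2)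
  define z where "z = x - p"
  have "z $ 1 * (n $ 1 * n $ 1 + n $ 2 * n $ 2) = z $ 1" "z $ 2 * (n $ 1 * n $ 1 + n $ 2 * n $ 2) = z $ 2"
    using n by simp_all
  then have "(z \<bullet> perp n) *\<^sub>R perp n + (z \<bullet> n) *\<^sub>R n = z"
    by (simp add: vec2_eq inner_vec2 perp_def algebra_simps)
  then show ?thesis by (simp add: pt_def z_def add.assoc)
qed

lemma pt_inner:
  assumes "norm n = 1"
  shows "(pt p n t y - p) \<bullet> perp n = t" "(pt p n t y - p) \<bullet> n = y"
proof -
  have "perp n \<bullet> perp n = 1" "n \<bullet> n = 1" using assms by (metis norm_eq_1 perp(1))+
  then show "(pt p n t y - p) \<bullet> perp n = t" "(pt p n t y - p) \<bullet> n = y"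
    using perp(2,3)[of n] by (simp_all add: pt_def inner_add_left)
qed

text \<open>Near \<open>p\<close> the region lies below the graph of \<open>g\<close> in the frame at \<open>p\<close>.\<close>
definition boundary_chart :: "(real^2) set \<Rightarrow> real^2 \<Rightarrow> real^2 \<Rightarrow> real \<Rightarrow> real \<Rightarrow> (real \<Rightarrow> real) \<Rightarrow> bool" where
  "boundary_chart \<Omega> p n \<epsilon> r g \<longleftrightarrow> norm n = 1 \<and> 0 < r \<and>
     (\<forall>t y. \<bar>t\<bar> < r \<longrightarrow> \<bar>y\<bar> < r \<longrightarrow> (pt p n t y \<in> \<Omega> \<longleftrightarrow> y < g t)) \<and>
     (\<forall>t. \<bar>t\<bar> < r \<longrightarrow> \<bar>g t\<bar> \<le> \<epsilon> * \<bar>t\<bar>) \<and>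
     (\<forall>s t. \<bar>s\<bar> < r \<longrightarrow> \<bar>t\<bar> < r \<longrightarrow> \<bar>g s - g t\<bar> \<le> \<epsilon> * \<bar>s - t\<bar>)"

lemma abs_convex_less:
  fixes z1 z2 s r :: real
  assumes "\<bar>z1\<bar> < r" "\<bar>z2\<bar> < r" "0 \<le> s" "s \<le> 1"
  shows "\<bar>z1 + s * (z2 - z1)\<bar> < r"
  using convexD[OF convex_ball[of 0 r], of z1 z2 "1 - s" s] assms by (simp add: algebra_simps)

text \<open>The zero set of \<open>\<rho>\<close> is solved for the normal coordinate. Near \<open>p\<close> the tangential derivative \<open>Rt\<close> of \<open>\<rho>\<close> is
  at most \<open>\<epsilon>\<close> times the normal derivative \<open>Rn\<close>, and the mean value theorem turns this into existence,
  uniqueness, the Lipschitz bound and differentiability of the solution \<open>g\<close>. As \<open>g' = - Rt / Rn\<close> along the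
  graph, \<open>g'\<close> is differentiable as well, which the curvature needs.\<close>
lemma boundary_chart_exists:
  fixes \<Omega> :: "(real^2) set"
  assumes \<Omega>: "open \<Omega>" and p: "p \<in> frontier \<Omega>" and df: "defining_function \<Omega> p U \<rho>"
    and \<epsilon>: "0 < \<epsilon>" "\<epsilon> \<le> 1/4" and r0: "0 < r0"
  obtains r g g' where "boundary_chart \<Omega> p (outward_normal \<Omega> p) \<epsilon> r g" "r \<le> r0"
    "\<And>t. \<bar>t\<bar> < r \<Longrightarrow> (g has_real_derivative g' t) (at t)"
    "\<And>t. \<bar>t\<bar> < r \<Longrightarrow> g' differentiable (at t)" "g' 0 = 0"
proof -
  have U: "open U" "p \<in> U" "smooth_on \<rho> U" "grad \<rho> p \<noteq> 0" "\<And>x. x \<in> U \<Longrightarrow> x \<in> \<Omega> \<longleftrightarrow> \<rho> x < 0"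
    using df unfolding defining_function_def by blast+
  define A where "A = norm (grad \<rho> p)"
  define n where "n = outward_normal \<Omega> p"
  have A: "0 < A" using U(4) by (simp add: A_def)
  have n_eq: "n = grad \<rho> p /\<^sub>R A" unfolding n_def A_def by (rule outward_normal_eq[OF \<Omega> p df])
  have n: "norm n = 1" using A by (simp add: n_eq A_def)
  have gp: "grad \<rho> p = A *\<^sub>R n" using A by (simp add: n_eq)
  define Rn where "Rn x = grad \<rho> x \<bullet> n" for x
  define Rt where "Rt x = grad \<rho> x \<bullet> perp n" for x
  have Rp: "Rn p = A" "Rt p = 0" using n perp[of n] by (simp_all add: Rn_def Rt_def gp norm_eq_1)
  have diff: "Rn differentiable (at x)" "Rt differentiable (at x)" if "x \<in> U" for x
    unfolding Rn_def Rt_def using smooth_on_gradient(2)[OF U(3,1) that] by auto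
  have contR: "isCont Rn x" "isCont Rt x" if "x \<in> U" for x
    using diff[OF that] differentiable_imp_continuous_within by blast+
  have \<rho>_der: "(\<rho> has_derivative (\<lambda>h. grad \<rho> x \<bullet> h)) (at x)" if "x \<in> U" for x
    using smooth_on_gradient(1)[OF U(3,1) that] .
  obtain \<delta>0 where \<delta>0: "0 < \<delta>0" "ball p \<delta>0 \<subseteq> U" using U(1,2) open_contains_ball by metis
  obtain \<delta>1 where \<delta>1: "0 < \<delta>1" "\<And>x. dist x p < \<delta>1 \<Longrightarrow> dist (Rn x) (Rn p) < A / 2"
    using contR(1)[OF U(2)] A unfolding continuous_at_eps_delta by (metis half_gt_zero)
  have "0 < \<epsilon> * A / 2" using \<epsilon> A by simp
  then obtain \<delta>2 where \<delta>2: "0 < \<delta>2" "\<And>x. dist x p < \<delta>2 \<Longrightarrow> dist (Rt x) (Rt p) < \<epsilon> * A / 2"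
    using contR(2)[OF U(2)] unfolding continuous_at_eps_delta by metis
  define \<delta> where "\<delta> = min \<delta>0 (min \<delta>1 \<delta>2)"
  define r where "r = min r0 (\<delta> / 2)"
  have \<delta>: "0 < \<delta>" using \<delta>0 \<delta>1 \<delta>2 by (simp add: \<delta>_def)
  have r: "0 < r" "r \<le> r0" "2 * r \<le> \<delta>" using r0 \<delta> by (auto simp: r_def)
  have near: "x \<in> U \<and> 0 < Rn x \<and> \<bar>Rt x\<bar> \<le> \<epsilon> * Rn x" if x: "dist x p < \<delta>" for x
  proof -
    have "x \<in> U" using x \<delta>0(2) by (auto simp: \<delta>_def dist_commute)
    moreover have 1: "A / 2 < Rn x"
    proof -
      have "\<bar>Rn x - A\<bar> < A / 2" using \<delta>1(2)[of x] x Rp by (simp add: \<delta>_def dist_real_def)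
      then show ?thesis by linarith
    qed
    moreover have "\<bar>Rt x\<bar> < \<epsilon> * A / 2" using \<delta>2(2)[of x] x Rp by (simp add: \<delta>_def dist_real_def)
    moreover have "\<epsilon> * (A / 2) \<le> \<epsilon> * Rn x" using 1 \<epsilon> by (intro mult_left_mono) auto
    ultimately show ?thesis using A by auto
  qed
  define Q where "Q t y = pt p n t y" for t y
  have Q0: "Q 0 0 = p" by (simp add: Q_def pt_def)
  have Qin: "dist (Q t y) p < \<delta>" if "\<bar>t\<bar> < r" "\<bar>y\<bar> < r" for t y
    using norm_pt_diff[OF n, of p t y 0 0] that r Q0 by (simp add: Q_def dist_norm)
  have mvt: "\<exists>s. 0 < s \<and> s < 1 \<and> \<rho> (Q t2 y2) - \<rho> (Q t1 y1)
        = Rt (Q (t1 + s * (t2 - t1)) (y1 + s * (y2 - y1))) * (t2 - t1)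
        + Rn (Q (t1 + s * (t2 - t1)) (y1 + s * (y2 - y1))) * (y2 - y1)"
    if t: "\<bar>t1\<bar> < r" "\<bar>t2\<bar> < r" "\<bar>y1\<bar> < r" "\<bar>y2\<bar> < r" for t1 t2 y1 y2
  proof -
    define v where "v = (t2 - t1) *\<^sub>R perp n + (y2 - y1) *\<^sub>R n"
    have pos: "Q t1 y1 + s *\<^sub>R v = Q (t1 + s * (t2 - t1)) (y1 + s * (y2 - y1))" for s
      by (simp add: Q_def pt_def v_def algebra_simps)
    have conv: "\<bar>t1 + s * (t2 - t1)\<bar> < r" "\<bar>y1 + s * (y2 - y1)\<bar> < r" if s: "0 \<le> s" "s \<le> 1" for s
    proof -
      show "\<bar>t1 + s * (t2 - t1)\<bar> < r" "\<bar>y1 + s * (y2 - y1)\<bar> < r" using abs_convex_less t s by auto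
    qed
    have inU: "Q t1 y1 + s *\<^sub>R v \<in> U" if "0 \<le> s" "s \<le> 1" for s
      unfolding pos using near[OF Qin[OF conv[OF that]]] by simp
    obtain s where s: "0 < s" "s < 1" "\<rho> (Q t1 y1 + 1 *\<^sub>R v) - \<rho> (Q t1 y1) = 1 * (grad \<rho> (Q t1 y1 + s *\<^sub>R v) \<bullet> v)"
    proof (rule mvt_along_line[where s=1 and f=\<rho> and q="Q t1 y1" and v=v and F="\<lambda>x h. grad \<rho> x \<bullet> h"])
      show "isCont \<rho> (Q t1 y1 + t *\<^sub>R v)" if "0 \<le> t" "t \<le> 1" for t
        using has_derivative_continuous[OF \<rho>_der[OF inU[OF that]]] .
      show "(\<rho> has_derivative (\<bullet>) (grad \<rho> (Q t1 y1 + t *\<^sub>R v))) (at (Q t1 y1 + t *\<^sub>R v))" if "0 < t" "t < 1" for t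
        using \<rho>_der[OF inU[of t]] that by simp
    qed auto
    have "Q t1 y1 + 1 *\<^sub>R v = Q t2 y2" by (simp only: pos) simp
    then have "\<rho> (Q t2 y2) - \<rho> (Q t1 y1) = grad \<rho> (Q t1 y1 + s *\<^sub>R v) \<bullet> v" using s(3) by simp
    also have "\<dots> = Rt (Q t1 y1 + s *\<^sub>R v) * (t2 - t1) + Rn (Q t1 y1 + s *\<^sub>R v) * (y2 - y1)"
      by (simp add: v_def Rt_def Rn_def inner_add_right)
    finally show ?thesis using s(1,2) unfolding pos by blast
  qed
  have est: "0 < Rn (Q (t1 + s * (t2 - t1)) (y1 + s * (y2 - y1))) \<and>
      \<bar>Rt (Q (t1 + s * (t2 - t1)) (y1 + s * (y2 - y1)))\<bar> \<le> \<epsilon> * Rn (Q (t1 + s * (t2 - t1)) (y1 + s * (y2 - y1)))"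
    if t: "\<bar>t1\<bar> < r" "\<bar>t2\<bar> < r" "\<bar>y1\<bar> < r" "\<bar>y2\<bar> < r" "0 < s" "s < 1" for t1 t2 y1 y2 s
  proof -
    show ?thesis using near[OF Qin[OF abs_convex_less abs_convex_less]] t by simp
  qed
  have mono: "\<rho> (Q t y1) < \<rho> (Q t y2)" if "\<bar>t\<bar> < r" "\<bar>y1\<bar> < r" "\<bar>y2\<bar> < r" "y1 < y2" for t y1 y2
  proof -
    obtain s where s: "0 < s" "s < 1" "\<rho> (Q t y2) - \<rho> (Q t y1) = Rt (Q (t + s * (t - t)) (y1 + s * (y2 - y1))) * (t - t)
        + Rn (Q (t + s * (t - t)) (y1 + s * (y2 - y1))) * (y2 - y1)"
      using mvt[of t t y1 y2] \<open>\<bar>t\<bar> < r\<close> \<open>\<bar>y1\<bar> < r\<close> \<open>\<bar>y2\<bar> < r\<close> by blast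
    have "0 < Rn (Q (t + s * (t - t)) (y1 + s * (y2 - y1))) * (y2 - y1)"
      using est[of t t y1 y2 s] s that by (intro mult_pos_pos) auto
    then show ?thesis using s(3) by simp
  qed
  have \<rho>p: "\<rho> p = 0" by (rule defining_function_eq_0[OF \<Omega> p df])
  have el: "\<epsilon> * \<bar>t\<bar> < r" if "\<bar>t\<bar> < r" for t
  proof -
    have "\<epsilon> * \<bar>t\<bar> \<le> 1 * \<bar>t\<bar>" using \<epsilon> by (intro mult_right_mono) auto
    then show ?thesis using that by simp
  qed
  have root: "\<exists>y. \<bar>y\<bar> \<le> \<epsilon> * \<bar>t\<bar> \<and> \<rho> (Q t y) = 0" if t: "\<bar>t\<bar> < r" for t
  proof -
    have e0: "0 \<le> \<epsilon> * \<bar>t\<bar>" "\<bar>\<epsilon> * \<bar>t\<bar>\<bar> < r" "\<bar>- (\<epsilon> * \<bar>t\<bar>)\<bar> < r" using \<epsilon> el[OF t] by auto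
    have small: "\<bar>Rt x * t\<bar> \<le> Rn x * (\<epsilon> * \<bar>t\<bar>)" if "\<bar>Rt x\<bar> \<le> \<epsilon> * Rn x" for x
      using mult_right_mono[OF that, of "\<bar>t\<bar>"] by (simp add: abs_mult mult_ac)
    have up: "0 \<le> \<rho> (Q t (\<epsilon> * \<bar>t\<bar>))"
    proof -
      obtain s where s: "0 < s" "s < 1" "\<rho> (Q t (\<epsilon> * \<bar>t\<bar>)) - \<rho> (Q 0 0)
          = Rt (Q (0 + s * (t - 0)) (0 + s * (\<epsilon> * \<bar>t\<bar> - 0))) * (t - 0)
          + Rn (Q (0 + s * (t - 0)) (0 + s * (\<epsilon> * \<bar>t\<bar> - 0))) * (\<epsilon> * \<bar>t\<bar> - 0)"
        using mvt[of 0 t 0 "\<epsilon> * \<bar>t\<bar>"] t e0 r(1) by auto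
      show ?thesis using small[OF conjunct2[OF est[of 0 t 0 "\<epsilon> * \<bar>t\<bar>" s]]] s t e0 r(1) Q0 \<rho>p by (auto simp: abs_le_iff)
    qed
    have down: "\<rho> (Q t (- (\<epsilon> * \<bar>t\<bar>))) \<le> 0"
    proof -
      obtain s where s: "0 < s" "s < 1" "\<rho> (Q t (- (\<epsilon> * \<bar>t\<bar>))) - \<rho> (Q 0 0)
          = Rt (Q (0 + s * (t - 0)) (0 + s * (- (\<epsilon> * \<bar>t\<bar>) - 0))) * (t - 0)
          + Rn (Q (0 + s * (t - 0)) (0 + s * (- (\<epsilon> * \<bar>t\<bar>) - 0))) * (- (\<epsilon> * \<bar>t\<bar>) - 0)"
        using mvt[of 0 t 0 "- (\<epsilon> * \<bar>t\<bar>)"] t e0 r(1) by auto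
      show ?thesis using small[OF conjunct2[OF est[of 0 t 0 "- (\<epsilon> * \<bar>t\<bar>)" s]]] s t e0 r(1) Q0 \<rho>p by (auto simp: abs_le_iff)
    qed
    have "continuous_on {- (\<epsilon> * \<bar>t\<bar>)..\<epsilon> * \<bar>t\<bar>} (\<lambda>y. \<rho> (Q t y))"
    proof (intro continuous_at_imp_continuous_on ballI)
      fix y assume "y \<in> {- (\<epsilon> * \<bar>t\<bar>)..\<epsilon> * \<bar>t\<bar>}"
      then have "\<bar>y\<bar> < r" using el[OF t] by auto
      then have 1: "isCont \<rho> (Q t y)" using has_derivative_continuous[OF \<rho>_der] near[OF Qin[OF t]] by blast
      have 2: "isCont (\<lambda>y. Q t y) y" unfolding Q_def pt_def by (intro continuous_intros)
      show "isCont (\<lambda>y. \<rho> (Q t y)) y" using 2 1 by (rule isCont_o2)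
    qed
    then obtain y where "- (\<epsilon> * \<bar>t\<bar>) \<le> y" "y \<le> \<epsilon> * \<bar>t\<bar>" "\<rho> (Q t y) = 0"
      using IVT'[of "\<lambda>y. \<rho> (Q t y)" "- (\<epsilon> * \<bar>t\<bar>)" 0 "\<epsilon> * \<bar>t\<bar>"] up down e0(1) by auto
    then show ?thesis by (intro exI[of _ y]) auto
  qed
  define g where "g t = (SOME y. \<bar>y\<bar> \<le> \<epsilon> * \<bar>t\<bar> \<and> \<rho> (Q t y) = 0)" for t
  have g: "\<bar>g t\<bar> \<le> \<epsilon> * \<bar>t\<bar>" "\<rho> (Q t (g t)) = 0" if "\<bar>t\<bar> < r" for t
    using someI_ex[OF root[OF that]] unfolding g_def by auto
  have gr: "\<bar>g t\<bar> < r" if "\<bar>t\<bar> < r" for t using g(1)[OF that] el[OF that] by linarith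
  have chart: "Q t y \<in> \<Omega> \<longleftrightarrow> y < g t" if "\<bar>t\<bar> < r" "\<bar>y\<bar> < r" for t y
  proof -
    have "Q t y \<in> \<Omega> \<longleftrightarrow> \<rho> (Q t y) < 0" using U(5) near[OF Qin[OF that]] by blast
    also have "\<dots> \<longleftrightarrow> y < g t"
      using mono[of t y "g t"] mono[of t "g t" y] g(2)[OF that(1)] gr[OF that(1)] that
      by (cases y "g t" rule: linorder_cases) auto
    finally show ?thesis .
  qed
  define K where "K x = - Rt x / Rn x" for x
  have slope: "\<exists>s. 0 < s \<and> s < 1 \<and> g t2 - g t1 = K (Q (t1 + s * (t2 - t1)) (g t1 + s * (g t2 - g t1))) * (t2 - t1) \<and>
      \<bar>K (Q (t1 + s * (t2 - t1)) (g t1 + s * (g t2 - g t1)))\<bar> \<le> \<epsilon>"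
    if t: "\<bar>t1\<bar> < r" "\<bar>t2\<bar> < r" for t1 t2
  proof -
    obtain s where s: "0 < s" "s < 1" "\<rho> (Q t2 (g t2)) - \<rho> (Q t1 (g t1))
        = Rt (Q (t1 + s * (t2 - t1)) (g t1 + s * (g t2 - g t1))) * (t2 - t1)
        + Rn (Q (t1 + s * (t2 - t1)) (g t1 + s * (g t2 - g t1))) * (g t2 - g t1)"
      using mvt[OF t gr[OF t(1)] gr[OF t(2)]] by blast
    define x where "x = Q (t1 + s * (t2 - t1)) (g t1 + s * (g t2 - g t1))"
    have x: "0 < Rn x" "\<bar>Rt x\<bar> \<le> \<epsilon> * Rn x"
      using est[OF t gr[OF t(1)] gr[OF t(2)] s(1,2)] unfolding x_def by auto
    have "0 = Rt x * (t2 - t1) + Rn x * (g t2 - g t1)" using s(3) g(2) t by (simp add: x_def)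
    then have "g t2 - g t1 = K x * (t2 - t1)" using x(1) by (simp add: K_def field_simps)
    moreover have "\<bar>K x\<bar> \<le> \<epsilon>" using x by (simp add: K_def field_simps)
    ultimately show ?thesis using s unfolding x_def by blast
  qed
  have lip: "\<bar>g s - g t\<bar> \<le> \<epsilon> * \<bar>s - t\<bar>" if st: "\<bar>s\<bar> < r" "\<bar>t\<bar> < r" for s t
  proof -
    obtain x where "g s - g t = K x * (s - t)" "\<bar>K x\<bar> \<le> \<epsilon>" using slope[OF st(2,1)] by blast
    then show ?thesis by (simp add: abs_mult mult_right_mono)
  qed
  define g' where "g' t = K (Q t (g t))" for t
  have QU: "Q t (g t) \<in> U" "0 < Rn (Q t (g t))" if "\<bar>t\<bar> < r" for t
    using near[OF Qin[OF that gr[OF that]]] by auto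
  have g_der: "(g has_real_derivative g' t) (at t)" if t: "\<bar>t\<bar> < r" for t
    unfolding has_field_derivative_iff LIM_eq
  proof (intro allI impI)
    fix e :: real assume e: "0 < e"
    have "isCont K (Q t (g t))"
      unfolding K_def using contR[OF QU(1)[OF t]] QU(2)[OF t] by (intro continuous_intros) auto
    then obtain \<delta>' where \<delta>': "0 < \<delta>'" "\<And>x. dist x (Q t (g t)) < \<delta>' \<Longrightarrow> dist (K x) (K (Q t (g t))) < e"
      using e unfolding continuous_at_eps_delta by metis
    show "\<exists>\<eta>>0. \<forall>s. s \<noteq> t \<and> norm (s - t) < \<eta> \<longrightarrow> norm ((g s - g t) / (s - t) - g' t) < e"
    proof (intro exI[of _ "min (r - \<bar>t\<bar>) (\<delta>' / 2)"] conjI allI impI)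
      show "0 < min (r - \<bar>t\<bar>) (\<delta>' / 2)" using t \<delta>'(1) by simp
      fix s assume s: "s \<noteq> t \<and> norm (s - t) < min (r - \<bar>t\<bar>) (\<delta>' / 2)"
      then have sr: "\<bar>s\<bar> < r" by (simp add: abs_if split: if_splits)
      obtain l where l: "0 < l" "l < 1" "g s - g t = K (Q (t + l * (s - t)) (g t + l * (g s - g t))) * (s - t)"
        using slope[OF t sr] by blast
      define x where "x = Q (t + l * (s - t)) (g t + l * (g s - g t))"
      have le: "\<bar>l * z\<bar> \<le> \<bar>z\<bar>" for z using l by (simp add: abs_mult mult_left_le_one_le)
      have "dist x (Q t (g t)) \<le> \<bar>l * (s - t)\<bar> + \<bar>l * (g s - g t)\<bar>"
        using norm_pt_diff[OF n, of p "t + l * (s - t)" "g t + l * (g s - g t)" t "g t"]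
        by (simp add: x_def Q_def dist_norm)
      also have "\<dots> \<le> \<bar>s - t\<bar> + \<bar>g s - g t\<bar>" by (intro add_mono le)
      also have "\<bar>g s - g t\<bar> \<le> \<epsilon> * \<bar>s - t\<bar>" by (rule lip[OF sr t])
      also have "\<epsilon> * \<bar>s - t\<bar> \<le> 1 * \<bar>s - t\<bar>" using \<epsilon> by (intro mult_right_mono) auto
      finally have "dist x (Q t (g t)) < \<delta>'" using s by simp
      then have "dist (K x) (K (Q t (g t))) < e" by (rule \<delta>'(2))
      moreover have "(g s - g t) / (s - t) = K x"
        using l(3)[folded x_def] s by simp
      ultimately show "norm ((g s - g t) / (s - t) - g' t) < e" by (simp add: g'_def dist_real_def)
    qed
  qed
  have g'_diff: "g' differentiable (at t)" if t: "\<bar>t\<bar> < r" for t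
  proof -
    have 1: "(\<lambda>t. Q t (g t)) differentiable (at t)"
    proof -
      have "g differentiable (at t)" using g_der[OF t] real_differentiable_def by blast
      then show ?thesis unfolding Q_def pt_def by (intro derivative_intros) auto
    qed
    have "(\<lambda>t. Rt (Q t (g t))) differentiable (at t)" "(\<lambda>t. Rn (Q t (g t))) differentiable (at t)"
      using differentiable_compose[OF diff(2)[OF QU(1)[OF t]] 1] differentiable_compose[OF diff(1)[OF QU(1)[OF t]] 1] by auto
    then show ?thesis unfolding g'_def K_def using QU(2)[OF t]
      by (intro differentiable_divide differentiable_minus) auto
  qed
  have "g 0 = 0" using g(1)[of 0] r(1) by simp
  then have "g' 0 = 0" by (simp add: g'_def K_def Q0 Rp)
  moreover have "boundary_chart \<Omega> p n \<epsilon> r g"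
    unfolding boundary_chart_def using n r(1) chart g(1) lip by (auto simp: Q_def)
  ultimately show thesis using r(2) g_der g'_diff by (intro that[of r g g']) (auto simp: n_def)
qed

lemma boundary_chart_frontier:
  assumes ch: "boundary_chart \<Omega> p n \<epsilon> r g" and \<Omega>: "open \<Omega>" and t: "\<bar>t\<bar> < r" "\<bar>y\<bar> < r"
  shows "pt p n t y \<in> frontier \<Omega> \<longleftrightarrow> y = g t"
proof -
  have n: "norm n = 1" and r: "0 < r"
    and iff: "\<And>t y. \<bar>t\<bar> < r \<Longrightarrow> \<bar>y\<bar> < r \<Longrightarrow> pt p n t y \<in> \<Omega> \<longleftrightarrow> y < g t"
    and lip: "\<And>s t. \<bar>s\<bar> < r \<Longrightarrow> \<bar>t\<bar> < r \<Longrightarrow> \<bar>g s - g t\<bar> \<le> \<epsilon> * \<bar>s - t\<bar>"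
    using ch unfolding boundary_chart_def by auto
  have fr: "x \<in> frontier \<Omega> \<longleftrightarrow> x \<notin> \<Omega> \<and> x \<in> closure \<Omega>" for x
    using \<Omega> by (auto simp: frontier_def interior_open)
  show ?thesis
  proof
    assume a: "pt p n t y \<in> frontier \<Omega>"
    then have ge: "g t \<le> y" using iff[OF t] fr by auto
    have "\<not> g t < y"
    proof
      assume lt: "g t < y"
      define e where "e = min (min (r - \<bar>t\<bar>) (r - \<bar>y\<bar>)) ((y - g t) / (\<bar>\<epsilon>\<bar> + 2))"
      have e: "0 < e" using t lt by (simp add: e_def add_nonneg_pos)
      obtain x where x: "x \<in> \<Omega>" "dist x (pt p n t y) < e"
        using a fr e closure_approachable by metis
      define s z where "s = (x - p) \<bullet> perp n" and "z = (x - p) \<bullet> n"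
      have xs: "x = pt p n s z" unfolding s_def z_def by (rule pt_coordinates[OF n, symmetric])
      have st: "\<bar>s - t\<bar> \<le> dist x (pt p n t y)"
      proof -
        have "s - t = (x - pt p n t y) \<bullet> perp n"
          using pt_inner(1)[OF n, of p t y] by (simp add: s_def inner_diff_left algebra_simps)
        then show ?thesis using Cauchy_Schwarz_ineq2[of "x - pt p n t y" "perp n"] n by (simp add: dist_norm perp)
      qed
      have zy: "\<bar>z - y\<bar> \<le> dist x (pt p n t y)"
      proof -
        have "z - y = (x - pt p n t y) \<bullet> n"
          using pt_inner(2)[OF n, of p t y] by (simp add: z_def inner_diff_left algebra_simps)
        then show ?thesis using Cauchy_Schwarz_ineq2[of "x - pt p n t y" n] n by (simp add: dist_norm)
      qed
      have sr: "\<bar>s\<bar> < r" "\<bar>z\<bar> < r" using st zy x(2) unfolding e_def by linarith+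
      have "z < g s" using iff[OF sr] x(1) xs by simp
      have "e \<le> (y - g t) / (\<bar>\<epsilon>\<bar> + 2)" unfolding e_def by simp
      then have "e * (\<bar>\<epsilon>\<bar> + 2) \<le> y - g t" by (simp add: pos_le_divide_eq)
      then have e2: "e * \<bar>\<epsilon>\<bar> + 2 * e \<le> y - g t" by (simp add: algebra_simps)
      have "\<bar>g s - g t\<bar> \<le> \<bar>\<epsilon>\<bar> * \<bar>s - t\<bar>"
        using lip[OF sr(1) t(1)] mult_right_mono[OF abs_ge_self[of \<epsilon>], of "\<bar>s - t\<bar>"] by linarith
      also have "\<dots> \<le> \<bar>\<epsilon>\<bar> * e" using st x(2) by (intro mult_left_mono) auto
      finally have "\<bar>g s - g t\<bar> \<le> e * \<bar>\<epsilon>\<bar>" by (simp add: mult.commute)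
      then show False using \<open>z < g s\<close> zy x(2) e2 e by linarith
    qed
    with ge show "y = g t" by simp
  next
    assume y: "y = g t"
    have "pt p n t y \<notin> \<Omega>" using iff[OF t] y by simp
    moreover have "pt p n t y \<in> closure \<Omega>"
    proof (rule closure_approachable[THEN iffD2], intro allI impI)
      fix e :: real assume e: "0 < e"
      define h where "h = min (e / 2) ((r - \<bar>y\<bar>) / 2)"
      have h: "0 < h" "h < e" using e t by (auto simp: h_def)
      have "h \<le> (r - \<bar>y\<bar>) / 2" unfolding h_def by (rule min.cobounded2)
      then have "2 * h \<le> r - \<bar>y\<bar>" by simp
      then have "\<bar>y\<bar> + h < r" using h(1) by simp
      moreover have "\<bar>y - h\<bar> \<le> \<bar>y\<bar> + h" using abs_triangle_ineq4[of y h] h(1) by simp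
      ultimately have "\<bar>y - h\<bar> < r" by (rule order.strict_trans1[rotated])
      note h = h this
      have "pt p n t (y - h) \<in> \<Omega>" using iff[OF t(1) h(3)] h y by simp
      moreover have "dist (pt p n t (y - h)) (pt p n t y) < e"
        using norm_pt_diff[OF n, of p t "y - h" t y] h by (simp add: dist_norm)
      ultimately show "\<exists>x\<in>\<Omega>. dist x (pt p n t y) < e" by blast
    qed
    ultimately show "pt p n t y \<in> frontier \<Omega>" using fr by blast
  qed
qed

section \<open>Normal and curvature of the free boundary\<close>

text \<open>The arc-length function of the graph has derivative at least 1, so its inverse exists and is
  Lipschitz, hence differentiable.\<close>
lemma arclength_graph:
  fixes g g' :: "real \<Rightarrow> real"
  assumes n: "norm n = 1" and r: "0 < r"
    and g: "\<And>t. \<bar>t\<bar> < r \<Longrightarrow> (g has_real_derivative g' t) (at t)"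
    and g': "\<And>t. \<bar>t\<bar> < r \<Longrightarrow> g' differentiable (at t)"
    and g'0: "g' 0 = 0"
  obtains \<gamma> \<gamma>' \<theta> K \<epsilon> where "0 < \<epsilon>" "\<And>s. \<bar>s\<bar> < \<epsilon> \<Longrightarrow> \<bar>\<theta> s\<bar> < r" "\<theta> 0 = 0"
    "\<And>s. \<gamma> s = pt p n (\<theta> s) (g (\<theta> s))"
    "\<And>s. \<bar>s\<bar> < \<epsilon> \<Longrightarrow> (\<gamma> has_vector_derivative \<gamma>' s) (at s)"
    "\<And>s. \<bar>s\<bar> < \<epsilon> \<Longrightarrow> norm (\<gamma>' s) = 1"
    "(\<gamma>' has_vector_derivative K) (at 0)" "\<gamma>' 0 = perp n"
proof -
  define \<epsilon> where "\<epsilon> = r / 2"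
  have \<epsilon>: "0 < \<epsilon>" "\<epsilon> < r" using r by (auto simp: \<epsilon>_def)
  define v where "v t = sqrt (1 + (g' t)\<^sup>2)" for t
  have v1: "1 \<le> v t" for t by (simp add: v_def)
  have sq: "(v t)\<^sup>2 = 1 + (g' t)\<^sup>2" for t by (simp add: v_def)
  have v_diff: "v differentiable (at t)" if t: "\<bar>t\<bar> < r" for t
  proof -
    obtain D where D: "(g' has_real_derivative D) (at t)" using g'[OF t] real_differentiable_def by blast
    have "0 < 1 + (g' t)\<^sup>2" by (simp add: add_pos_nonneg)
    then have "((\<lambda>t. sqrt (1 + (g' t)\<^sup>2)) has_real_derivative inverse (sqrt (1 + (g' t)\<^sup>2)) / 2 * (2 * g' t * D)) (at t)"
      by (auto intro!: derivative_eq_intros D)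
    then show ?thesis unfolding v_def real_differentiable_def by blast
  qed
  have v_cont: "continuous_on {-\<epsilon>..\<epsilon>} v"
  proof (intro continuous_at_imp_continuous_on ballI)
    fix t assume "t \<in> {-\<epsilon>..\<epsilon>}"
    then have "\<bar>t\<bar> < r" using \<epsilon> by auto
    then show "isCont v t" using v_diff differentiable_imp_continuous_within by blast
  qed
  define F where "F t = integral {-\<epsilon>..t} v" for t
  define S where "S t = F t - F 0" for t
  have F_der: "(F has_real_derivative v t) (at t within {-\<epsilon>..\<epsilon>})" if "t \<in> {-\<epsilon>..\<epsilon>}" for t
    unfolding F_def using v_cont that by (rule integral_has_real_derivative)
  have S_der_within: "(S has_real_derivative v t) (at t within {-\<epsilon>..\<epsilon>})" if "t \<in> {-\<epsilon>..\<epsilon>}" for t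
    unfolding S_def using F_der[OF that] by (auto intro!: derivative_eq_intros)
  have S_der: "(S has_real_derivative v t) (at t)" if "\<bar>t\<bar> < \<epsilon>" for t
  proof -
    have "t \<in> {-\<epsilon>..\<epsilon>}" "-\<epsilon> < t" "t < \<epsilon>" using that by auto
    then show ?thesis using S_der_within[of t] at_within_Icc_at[of "-\<epsilon>" t \<epsilon>] by simp
  qed
  have S_cont: "continuous_on {-\<epsilon>..\<epsilon>} S"
    unfolding continuous_on_eq_continuous_within using DERIV_continuous[OF S_der_within] by blast
  have expand: "t - s \<le> S t - S s" if st: "s \<in> {-\<epsilon>..\<epsilon>}" "t \<in> {-\<epsilon>..\<epsilon>}" "s \<le> t" for s t
  proof (cases "s = t")
    case False
    then have "s < t" using st by simp
    moreover have "continuous_on {s..t} S" using st by (intro continuous_on_subset[OF S_cont]) auto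
    moreover have "S differentiable (at x)" if x: "s < x" "x < t" for x
    proof -
      have "\<bar>x\<bar> < \<epsilon>" using x st by auto
      then show ?thesis using S_der[of x] real_differentiable_def by blast
    qed
    ultimately obtain l z where z: "s < z" "z < t" "(S has_real_derivative l) (at z)" "S t - S s = (t - s) * l"
      using MVT[of s t S] by blast
    have "\<bar>z\<bar> < \<epsilon>" using z st by auto
    then have "l = v z" using DERIV_unique[OF z(3) S_der] by blast
    then have "(t - s) * 1 \<le> (t - s) * l" using v1[of z] \<open>s < t\<close> by (intro mult_left_mono) auto
    then show ?thesis using z(4) by simp
  qed simp
  have S0: "S 0 = 0" by (simp add: S_def)
  have ex: "\<exists>t. \<bar>t\<bar> < \<epsilon> \<and> S t = s" if s: "\<bar>s\<bar> < \<epsilon>" for s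
  proof -
    have "S (-\<epsilon>) \<le> s" "s \<le> S \<epsilon>" using expand[of "-\<epsilon>" 0] expand[of 0 \<epsilon>] \<epsilon> S0 s by auto
    then obtain t where t: "-\<epsilon> \<le> t" "t \<le> \<epsilon>" "S t = s"
      using IVT'[of S "-\<epsilon>" s \<epsilon>] S_cont \<epsilon> by auto
    have "S (-\<epsilon>) < s" "s < S \<epsilon>" using expand[of "-\<epsilon>" 0] expand[of 0 \<epsilon>] \<epsilon> S0 s by auto
    then have "t \<noteq> -\<epsilon>" "t \<noteq> \<epsilon>" using t(3) by auto
    then show ?thesis using t by (intro exI[of _ t]) auto
  qed
  define \<theta> where "\<theta> s = (SOME t. \<bar>t\<bar> < \<epsilon> \<and> S t = s)" for s
  have \<theta>: "\<bar>\<theta> s\<bar> < \<epsilon>" "S (\<theta> s) = s" if "\<bar>s\<bar> < \<epsilon>" for s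
    using someI_ex[OF ex[OF that]] unfolding \<theta>_def by auto
  have \<theta>_lip: "\<bar>\<theta> s - \<theta> s'\<bar> \<le> \<bar>s - s'\<bar>" if ss: "\<bar>s\<bar> < \<epsilon>" "\<bar>s'\<bar> < \<epsilon>" for s s'
  proof (cases "\<theta> s \<le> \<theta> s'")
    case True
    have "\<theta> s' - \<theta> s \<le> S (\<theta> s') - S (\<theta> s)" using \<theta>(1)[OF ss(1)] \<theta>(1)[OF ss(2)] True by (intro expand) auto
    then show ?thesis using \<theta>(2)[OF ss(1)] \<theta>(2)[OF ss(2)] True by simp
  next
    case False
    have "\<theta> s - \<theta> s' \<le> S (\<theta> s) - S (\<theta> s')" using \<theta>(1)[OF ss(1)] \<theta>(1)[OF ss(2)] False by (intro expand) auto
    then show ?thesis using \<theta>(2)[OF ss(1)] \<theta>(2)[OF ss(2)] False by simp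
  qed
  have \<theta>0: "\<theta> 0 = 0"
  proof -
    have 0: "\<bar>\<theta> 0\<bar> < \<epsilon>" "S (\<theta> 0) = 0" using \<theta>[of 0] \<epsilon> by auto
    show ?thesis
    proof (cases "0 \<le> \<theta> 0")
      case True then show ?thesis using expand[of 0 "\<theta> 0"] 0 S0 \<epsilon> by auto
    next
      case False then show ?thesis using expand[of "\<theta> 0" 0] 0 S0 \<epsilon> by auto
    qed
  qed
  have \<theta>_cont: "isCont \<theta> s" if s: "\<bar>s\<bar> < \<epsilon>" for s
    unfolding continuous_at_eps_delta
  proof (intro allI impI)
    fix e :: real assume e: "0 < e"
    show "\<exists>d>0. \<forall>s'. dist s' s < d \<longrightarrow> dist (\<theta> s') (\<theta> s) < e"
    proof (intro exI[of _ "min e (\<epsilon> - \<bar>s\<bar>)"] conjI allI impI)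
      show "0 < min e (\<epsilon> - \<bar>s\<bar>)" using e s by simp
      fix s' assume d: "dist s' s < min e (\<epsilon> - \<bar>s\<bar>)"
      then have "\<bar>s' - s\<bar> < \<epsilon> - \<bar>s\<bar>" by (simp add: dist_real_def)
      then have "\<bar>s'\<bar> < \<epsilon>" using abs_triangle_ineq2[of s' s] by linarith
      then show "dist (\<theta> s') (\<theta> s) < e" using \<theta>_lip[of s' s] s d by (simp add: dist_real_def)
    qed
  qed
  have \<theta>_der: "(\<theta> has_real_derivative inverse (v (\<theta> s))) (at s)" if s: "\<bar>s\<bar> < \<epsilon>" for s
  proof (rule DERIV_inverse_function[where f=S and a="-\<epsilon>" and b=\<epsilon>])
    show "(S has_real_derivative v (\<theta> s)) (at (\<theta> s))" using S_der[OF \<theta>(1)[OF s]] .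
    show "v (\<theta> s) \<noteq> 0" using v1[of "\<theta> s"] by linarith
    show "S (\<theta> y) = y" if "-\<epsilon> < y" "y < \<epsilon>" for y using \<theta>(2)[of y] that by simp
    show "isCont \<theta> s" by (rule \<theta>_cont[OF s])
  qed (use s in auto)
  define \<gamma> where "\<gamma> s = pt p n (\<theta> s) (g (\<theta> s))" for s
  define \<gamma>' where "\<gamma>' s = inverse (v (\<theta> s)) *\<^sub>R (perp n + g' (\<theta> s) *\<^sub>R n)" for s
  have \<theta>r: "\<bar>\<theta> s\<bar> < r" if "\<bar>s\<bar> < \<epsilon>" for s using \<theta>(1)[OF that] \<epsilon> by linarith
  have \<gamma>_der: "(\<gamma> has_vector_derivative \<gamma>' s) (at s)" if s: "\<bar>s\<bar> < \<epsilon>" for s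
  proof -
    have 1: "(\<theta> has_vector_derivative inverse (v (\<theta> s))) (at s)"
      using \<theta>_der[OF s] by (simp add: has_real_derivative_iff_has_vector_derivative)
    have 2: "((\<lambda>s. g (\<theta> s)) has_vector_derivative g' (\<theta> s) * inverse (v (\<theta> s))) (at s)"
      using DERIV_chain2[OF g[OF \<theta>r[OF s]] \<theta>_der[OF s]] by (simp add: has_real_derivative_iff_has_vector_derivative)
    have "((\<lambda>s. p + \<theta> s *\<^sub>R perp n + g (\<theta> s) *\<^sub>R n) has_vector_derivative
        (0 + inverse (v (\<theta> s)) *\<^sub>R perp n) + (g' (\<theta> s) * inverse (v (\<theta> s))) *\<^sub>R n) (at s)"
      by (intro has_vector_derivative_add has_vector_derivative_const
          bounded_linear.has_vector_derivative[OF bounded_linear_scaleR_left] 1 2)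
    moreover have "(0 + inverse (v (\<theta> s)) *\<^sub>R perp n) + (g' (\<theta> s) * inverse (v (\<theta> s))) *\<^sub>R n = \<gamma>' s"
      by (simp add: \<gamma>'_def algebra_simps)
    moreover have "(\<lambda>s. p + \<theta> s *\<^sub>R perp n + g (\<theta> s) *\<^sub>R n) = \<gamma>" by (simp add: fun_eq_iff \<gamma>_def pt_def)
    ultimately show ?thesis by simp
  qed
  have \<gamma>_norm: "norm (\<gamma>' s) = 1" for s
  proof -
    define t where "t = \<theta> s"
    have pp: "perp n \<bullet> perp n = 1" "n \<bullet> n = 1" using n by (metis norm_eq_1 perp(1))+
    have "(norm (perp n + g' t *\<^sub>R n))\<^sup>2 = 1 + (g' t)\<^sup>2"
      unfolding power2_norm_eq_inner using pp perp(2,3)[of n]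
      by (simp add: inner_add_left inner_add_right power2_eq_square)
    then have "(norm (perp n + g' t *\<^sub>R n))\<^sup>2 = (v t)\<^sup>2" using sq by simp
    then have "norm (perp n + g' t *\<^sub>R n) = v t"
      by (rule power2_eq_imp_eq) (use v1[of t] in auto)
    then show ?thesis using v1[of t] by (simp add: \<gamma>'_def t_def[symmetric])
  qed
  have "\<exists>K. (\<gamma>' has_vector_derivative K) (at 0)"
  proof -
    have z: "\<bar>0::real\<bar> < \<epsilon>" using \<epsilon> by simp
    have \<theta>d: "\<theta> differentiable (at 0)" using \<theta>_der[OF z] real_differentiable_def by blast
    have "(\<lambda>s. v (\<theta> s)) differentiable (at 0)" "(\<lambda>s. g' (\<theta> s)) differentiable (at 0)"
      using differentiable_compose[OF v_diff[OF \<theta>r[OF z]] \<theta>d] differentiable_compose[OF g'[OF \<theta>r[OF z]] \<theta>d] by auto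
    moreover have "v (\<theta> 0) \<noteq> 0" using v1[of "\<theta> 0"] by linarith
    ultimately have "\<gamma>' differentiable (at 0)" unfolding \<gamma>'_def
      by (intro differentiable_scaleR differentiable_inverse differentiable_add differentiable_const) auto
    then show ?thesis using vector_derivative_works by blast
  qed
  then obtain K where "(\<gamma>' has_vector_derivative K) (at 0)" by blast
  moreover have "\<gamma>' 0 = perp n" by (simp add: \<gamma>'_def \<theta>0 g'0 v_def)
  ultimately show thesis
    using \<epsilon>(1) \<theta>r \<theta>0 \<gamma>_der \<gamma>_norm by (intro that[of \<epsilon> \<theta> \<gamma> \<gamma>' K]) (auto simp: \<gamma>_def)
qed

context free_boundary
begin

lemma chart:
  assumes p: "p \<in> frontier \<Omega>" and "0 < \<epsilon>" "\<epsilon> \<le> 1/4" "0 < r0"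
  obtains r g g' where "boundary_chart \<Omega> p (outward_normal \<Omega> p) \<epsilon> r g" "r \<le> r0"
    "\<And>t. \<bar>t\<bar> < r \<Longrightarrow> (g has_real_derivative g' t) (at t)"
    "\<And>t. \<bar>t\<bar> < r \<Longrightarrow> g' differentiable (at t)" "g' 0 = 0"
proof -
  obtain U \<rho> where "defining_function \<Omega> p U \<rho>" using smooth p unfolding smooth_boundary_def by blast
  from boundary_chart_exists[OF open_Omega p this assms(2-4)] that show thesis by metis
qed

text \<open>A function with continuous extensions of its derivatives is differentiable along the
  boundary: two boundary points are joined, through the region, by a path of three segments whose
  length is comparable to their distance.\<close>
lemma has_derivative_within_frontier:
  fixes h :: "real^2 \<Rightarrow> real" and w :: "real^2 \<Rightarrow> real^2"
  assumes h: "continuous_on UNIV h" and w: "continuous_on UNIV w"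
    and der: "\<And>x. x \<in> \<Omega> \<Longrightarrow> (h has_derivative (\<lambda>v. w x \<bullet> v)) (at x)"
    and p: "p \<in> frontier \<Omega>"
  shows "(h has_derivative (\<lambda>v. w p \<bullet> v)) (at p within frontier \<Omega>)"
  unfolding has_derivative_within_alt
proof (intro conjI allI impI)
  show "bounded_linear ((\<bullet>) (w p))" by (rule bounded_linear_inner_right)
  fix e :: real assume e: "0 < e"
  define n where "n = outward_normal \<Omega> p"
  obtain r g g' where ch: "boundary_chart \<Omega> p n (1/4) r g"
    using chart[OF p, of "1/4" 1] unfolding n_def by (metis less_numeral_extra(1) order_refl zero_less_divide_1_iff zero_less_numeral)
  have n: "norm n = 1" and r: "0 < r"
    and iff: "\<And>t y. \<bar>t\<bar> < r \<Longrightarrow> \<bar>y\<bar> < r \<Longrightarrow> pt p n t y \<in> \<Omega> \<longleftrightarrow> y < g t"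
    and g: "\<And>t. \<bar>t\<bar> < r \<Longrightarrow> \<bar>g t\<bar> \<le> 1/4 * \<bar>t\<bar>"
    using ch unfolding boundary_chart_def by auto
  have "isCont w p" using w by (simp add: continuous_on_eq_continuous_at)
  then obtain \<delta> where \<delta>: "0 < \<delta>" "\<And>x. dist x p < \<delta> \<Longrightarrow> dist (w x) (w p) < e / 3"
    using e unfolding continuous_at_eps_delta by (metis zero_less_divide_iff zero_less_numeral)
  define k where "k x = h x - w p \<bullet> x" for x
  have k_der: "(k has_derivative (\<lambda>v. (w x - w p) \<bullet> v)) (at x)" if "x \<in> \<Omega>" for x
    unfolding k_def inner_diff_left
    by (intro has_derivative_diff der[OF that] bounded_linear_imp_has_derivative bounded_linear_inner_right)
  have k_cont: "isCont k x" for x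
  proof -
    have "isCont h x" using h by (simp add: continuous_on_eq_continuous_at)
    then show ?thesis unfolding k_def by (intro continuous_intros)
  qed
  \<comment> \<open>on segments inside \<open>\<Omega>\<close> near \<open>p\<close> the remainder \<open>k\<close> has gradient at most \<open>e / 3\<close>\<close>
  have seg: "\<bar>k (q + R *\<^sub>R v) - k q\<bar> \<le> R * (e / 3 * norm v)"
    if R: "0 < R" and in\<Omega>: "\<And>s. 0 < s \<Longrightarrow> s < R \<Longrightarrow> q + s *\<^sub>R v \<in> \<Omega> \<and> dist (q + s *\<^sub>R v) p < \<delta>" for q v R
  proof -
    obtain s where s: "0 < s" "s < R" "k (q + R *\<^sub>R v) - k q = R * ((w (q + s *\<^sub>R v) - w p) \<bullet> v)"
      by (rule mvt_along_line[where s=R and f=k and q=q and v=v and F="\<lambda>x v. (w x - w p) \<bullet> v"])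
        (use R k_cont k_der in\<Omega> in auto)
    have "\<bar>(w (q + s *\<^sub>R v) - w p) \<bullet> v\<bar> \<le> norm (w (q + s *\<^sub>R v) - w p) * norm v"
      by (rule Cauchy_Schwarz_ineq2)
    also have "\<dots> \<le> e / 3 * norm v"
      using \<delta>(2)[of "q + s *\<^sub>R v"] in\<Omega>[OF s(1,2)] by (intro mult_right_mono) (auto simp: dist_norm)
    finally show ?thesis using s(3) R by (simp add: abs_mult)
  qed
  define d where "d = min (r / 3) (\<delta> / 3)"
  show "\<exists>d>0. \<forall>y\<in>frontier \<Omega>. norm (y - p) < d \<longrightarrow> norm (h y - h p - w p \<bullet> (y - p)) \<le> e * norm (y - p)"
  proof (intro exI[of _ d] conjI ballI impI)
    show "0 < d" using r \<delta> by (simp add: d_def)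
    fix q assume q: "q \<in> frontier \<Omega>" and qd: "norm (q - p) < d"
    define R where "R = norm (q - p)"
    have R3: "3 * R < r" "3 * R < \<delta>" using qd by (auto simp: R_def d_def)
    show "norm (h q - h p - w p \<bullet> (q - p)) \<le> e * norm (q - p)"
    proof (cases "q = p")
      case False
      then have R: "0 < R" by (simp add: R_def)
      define t y where "t = (q - p) \<bullet> perp n" and "y = (q - p) \<bullet> n"
      have qpt: "q = pt p n t y" unfolding t_def y_def by (rule pt_coordinates[OF n, symmetric])
      have ty: "\<bar>t\<bar> \<le> R" "\<bar>y\<bar> \<le> R"
        using Cauchy_Schwarz_ineq2[of "q - p" "perp n"] Cauchy_Schwarz_ineq2[of "q - p" n] n
        by (simp_all add: t_def y_def R_def perp)
      have ty': "\<bar>t\<bar> < r" "\<bar>y\<bar> < r" using ty R3(1) R by linarith+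
      have y: "y = g t" using boundary_chart_frontier[OF ch open_Omega ty'] q qpt by simp
      have gy: "\<bar>y\<bar> \<le> R / 4" using g[OF ty'(1)] ty y by simp
      have dp: "dist (pt p n t' y') p \<le> \<bar>t'\<bar> + \<bar>y'\<bar>" for t' y'
        using norm_pt_diff[OF n, of p t' y' 0 0] by (simp add: dist_norm pt_def)
      have p0: "pt p n 0 0 = p" by (simp add: pt_def)
      \<comment> \<open>from \<open>p\<close> and from \<open>q\<close> straight into \<open>\<Omega>\<close> by \<open>R\<close>, and between the two end points; the slope 1/4 of the
        boundary keeps all three segments in \<open>\<Omega>\<close>\<close>
      have 1: "\<bar>k (p + R *\<^sub>R (- n)) - k p\<bar> \<le> R * (e / 3 * norm (- n))"
      proof (rule seg[OF R])
        fix s assume s: "0 < s" "s < R"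
        have "p + s *\<^sub>R (- n) = pt p n 0 (- s)" by (simp add: pt_def)
        moreover have "g 0 = 0" using g[of 0] r by simp
        then have "pt p n 0 (- s) \<in> \<Omega>" using iff[of 0 "-s"] s R3 r by simp
        moreover have "dist (pt p n 0 (- s)) p < \<delta>" using dp[of 0 "-s"] s R3 by simp
        ultimately show "p + s *\<^sub>R (- n) \<in> \<Omega> \<and> dist (p + s *\<^sub>R (- n)) p < \<delta>" by simp
      qed
      have 2: "\<bar>k (q + R *\<^sub>R (- n)) - k q\<bar> \<le> R * (e / 3 * norm (- n))"
      proof (rule seg[OF R])
        fix s assume s: "0 < s" "s < R"
        have "q + s *\<^sub>R (- n) = pt p n t (y - s)" unfolding qpt by (simp add: pt_def algebra_simps)
        moreover have ys: "\<bar>y - s\<bar> \<le> 2 * R" using gy s by (simp add: abs_if split: if_splits)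
        then have "pt p n t (y - s) \<in> \<Omega>" using iff[OF ty'(1), of "y - s"] s y R3 R by simp
        moreover have "dist (pt p n t (y - s)) p < \<delta>" using dp[of t "y - s"] ys ty R3 by simp
        ultimately show "q + s *\<^sub>R (- n) \<in> \<Omega> \<and> dist (q + s *\<^sub>R (- n)) p < \<delta>" by simp
      qed
      define q' where "q' = p + R *\<^sub>R (- n)"
      have q'': "q + R *\<^sub>R (- n) = q' + 1 *\<^sub>R (q - p)" by (simp add: q'_def)
      have 3: "\<bar>k (q' + 1 *\<^sub>R (q - p)) - k q'\<bar> \<le> 1 * (e / 3 * norm (q - p))"
      proof (rule seg)
        fix s :: real assume s: "0 < s" "s < 1"
        have "q' + s *\<^sub>R (q - p) = pt p n (s * t) (s * y - R)" unfolding q'_def qpt by (simp add: pt_def algebra_simps)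
        moreover have st: "\<bar>s * t\<bar> \<le> R" "\<bar>s * y\<bar> \<le> R / 4"
        proof -
          have *: "\<bar>s * z\<bar> \<le> \<bar>z\<bar>" for z using s by (simp add: abs_mult mult_left_le_one_le)
          show "\<bar>s * t\<bar> \<le> R" "\<bar>s * y\<bar> \<le> R / 4" using *[of t] *[of y] ty gy by linarith+
        qed
        then have str: "\<bar>s * t\<bar> < r" "\<bar>s * y - R\<bar> < r" using R3 R abs_triangle_ineq4[of "s * y" R] by linarith+
        have "\<bar>g (s * t)\<bar> \<le> R / 4" using g[OF str(1)] st by linarith
        then have "s * y - R < g (s * t)" using st R by linarith
        then have "pt p n (s * t) (s * y - R) \<in> \<Omega>" using iff[OF str] by simp
        moreover have "dist (pt p n (s * t) (s * y - R)) p < \<delta>"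
          using dp[of "s * t" "s * y - R"] st R3 R abs_triangle_ineq4[of "s * y" R] by linarith
        ultimately show "q' + s *\<^sub>R (q - p) \<in> \<Omega> \<and> dist (q' + s *\<^sub>R (q - p)) p < \<delta>" by simp
      qed simp
      have "\<bar>k q - k p\<bar> \<le> R * (e / 3) + R * (e / 3) + R * (e / 3)"
      proof -
        have "\<bar>k q' - k p\<bar> \<le> R * (e / 3)" using 1 n by (simp add: q'_def)
        moreover have "\<bar>k (q' + 1 *\<^sub>R (q - p)) - k q\<bar> \<le> R * (e / 3)" using 2 n unfolding q'' by simp
        moreover have "\<bar>k (q' + 1 *\<^sub>R (q - p)) - k q'\<bar> \<le> R * (e / 3)" using 3 by (simp add: R_def mult.commute)
        ultimately show ?thesis by linarith
      qed
      then have "\<bar>k q - k p\<bar> \<le> e * R" by (simp add: algebra_simps)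
      moreover have "h q - h p - w p \<bullet> (q - p) = k q - k p" by (simp add: k_def inner_diff_right)
      ultimately show ?thesis by (simp add: R_def)
    qed simp
  qed
qed

text \<open>\<open>G\<close> is the gradient of \<open>u\<close>, \<open>D2 x\<close> the Hessian as a linear map. \<open>H\<close> extends the curvature of the free
  boundary continuously: on the boundary, where \<open>\<nu> = u G\<close>, it is \<open>D2 x (G x) \<bullet> \<nu>\<close>.\<close>
definition G :: "real^2 \<Rightarrow> real^2" where "G x = vector [a x, b x]"
definition D2 :: "real^2 \<Rightarrow> real^2 \<Rightarrow> real^2" where
  "D2 x v = vector [c x * v $ 1 + d x * v $ 2, d x * v $ 1 - c x * v $ 2]"
definition H :: "real^2 \<Rightarrow> real" where "H x = u x * (D2 x (G x) \<bullet> G x)"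

lemma vector2_continuous:
  fixes f g :: "real^2 \<Rightarrow> real"
  assumes "continuous_on UNIV f" "continuous_on UNIV g"
  shows "continuous_on UNIV (\<lambda>x. vector [f x, g x] :: real^2)"
proof -
  have "(\<lambda>x. vector [f x, g x] :: real^2) = (\<lambda>x. f x *\<^sub>R axis 1 1 + g x *\<^sub>R axis 2 1)"
    by (auto simp: fun_eq_iff vec2_eq axis_def)
  moreover have "continuous_on UNIV (\<lambda>x. f x *\<^sub>R axis 1 1 + g x *\<^sub>R axis 2 1 :: real^2)"
    by (intro continuous_intros assms)
  ultimately show ?thesis by (simp only:)
qed

lemma G_continuous: "continuous_on UNIV G"
  unfolding G_def by (intro vector2_continuous cont)

lemma H_continuous: "continuous_on UNIV H"
  unfolding H_def D2_def G_def inner_vec2 by (simp, intro continuous_intros cont)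

lemma du_G: "x \<in> \<Omega> \<Longrightarrow> (u has_derivative (\<lambda>v. G x \<bullet> v)) (at x)"
  using du[of x] by (simp add: G_def inner_vec2)

lemma norm_G_frontier: "x \<in> frontier \<Omega> \<Longrightarrow> G x \<bullet> G x = 1"
  using unit_gradient[of x] by (simp add: G_def inner_vec2 power2_eq_square)

text \<open>Curves in the free boundary are level curves of \<open>u\<close>.\<close>
lemma curve_orthogonal:
  assumes "0 < \<epsilon>" and fr: "\<And>s. \<bar>s\<bar> < \<epsilon> \<Longrightarrow> \<gamma> s \<in> frontier \<Omega>"
    and der: "(\<gamma> has_vector_derivative \<gamma>') (at t)" and t: "\<bar>t\<bar> < \<epsilon>"
  shows "G (\<gamma> t) \<bullet> \<gamma>' = 0"
proof -
  let ?I = "{-\<epsilon><..<\<epsilon>}"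
  have tI: "t \<in> ?I" using t by auto
  have 1: "(\<gamma> has_derivative (\<lambda>h. h *\<^sub>R \<gamma>')) (at t within ?I)"
    using der unfolding has_vector_derivative_def by (rule has_derivative_at_withinI)
  have "(u has_derivative (\<lambda>v. G (\<gamma> t) \<bullet> v)) (at (\<gamma> t) within frontier \<Omega>)"
    by (rule has_derivative_within_frontier[OF cont(1) G_continuous du_G fr[OF t]])
  then have 2: "(u has_derivative (\<lambda>v. G (\<gamma> t) \<bullet> v)) (at (\<gamma> t) within \<gamma> ` ?I)"
    by (rule has_derivative_subset) (use fr in \<open>auto simp: abs_less_iff\<close>)
  have "(u \<circ> \<gamma> has_derivative (\<lambda>v. G (\<gamma> t) \<bullet> v) \<circ> (\<lambda>h. h *\<^sub>R \<gamma>')) (at t within ?I)"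
    using 1 2 by (rule diff_chain_within)
  then have chain: "(u \<circ> \<gamma> has_derivative (\<lambda>h. h * (G (\<gamma> t) \<bullet> \<gamma>'))) (at t)"
    using tI by (simp add: at_within_open[OF _ open_greaterThanLessThan] comp_def)
  \<comment> \<open>\<open>u\<close> takes only the values 1 and -1 on the boundary, so it is constant along the curve near \<open>t\<close>\<close>
  have "isCont \<gamma> t" using der has_vector_derivative_continuous by blast
  then have "isCont (u \<circ> \<gamma>) t" unfolding comp_def by (rule isCont_o2) (rule cont_at)
  then obtain \<delta> where \<delta>: "0 < \<delta>" "\<And>s. dist s t < \<delta> \<Longrightarrow> dist ((u \<circ> \<gamma>) s) ((u \<circ> \<gamma>) t) < 1"
    unfolding continuous_at_eps_delta using zero_less_one by metis
  have const: "(u \<circ> \<gamma>) s = (u \<circ> \<gamma>) t" if s: "s \<in> ball t \<delta> \<inter> ?I" for s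
  proof -
    have "u (\<gamma> s) = 1 \<or> u (\<gamma> s) = -1" "u (\<gamma> t) = 1 \<or> u (\<gamma> t) = -1"
      using frontier_value fr t s by (auto simp: abs_less_iff)
    moreover have "dist (u (\<gamma> s)) (u (\<gamma> t)) < 1" using \<delta>(2)[of s] s by (simp add: dist_commute)
    ultimately show ?thesis by (auto simp: dist_real_def)
  qed
  have "((\<lambda>s. (u \<circ> \<gamma>) t) has_derivative (\<lambda>h. 0)) (at t)" by simp
  then have "(u \<circ> \<gamma> has_derivative (\<lambda>h. 0)) (at t)"
    by (rule has_derivative_transform_within_open[where s="ball t \<delta> \<inter> ?I"])
      (use \<delta>(1) tI in \<open>auto intro: const[symmetric] simp del: o_apply\<close>)
  then have "(\<lambda>h. h * (G (\<gamma> t) \<bullet> \<gamma>')) = (\<lambda>h. 0)" using chain has_derivative_unique by blast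
  then show ?thesis by (metis mult_1)
qed

lemma orthogonal_unit_vec2:
  fixes v w n :: "real^2"
  assumes "norm w = 1" "v \<bullet> w = 0" "w = s *\<^sub>R perp n" "norm n = 1"
  shows "v = (v \<bullet> n) *\<^sub>R n"
proof -
  have n: "n $ 1 * n $ 1 + n $ 2 * n $ 2 = 1" using assms(4) by (simp add: norm_eq_1 inner_vec2)
  have "\<bar>s\<bar> = 1" using assms(1,3,4) by (simp add: perp)
  then have "v \<bullet> perp n = 0" using assms(2,3) by auto
  then have vp: "v $ 2 * n $ 1 = v $ 1 * n $ 2" by (simp add: inner_vec2 perp_def)
  have "v $ 1 = v $ 1 * (n $ 1 * n $ 1 + n $ 2 * n $ 2)" using n by simp
  also have "\<dots> = (v $ 1 * n $ 1 + v $ 2 * n $ 2) * n $ 1" using vp by (simp add: algebra_simps)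
  finally have 1: "v $ 1 = (v $ 1 * n $ 1 + v $ 2 * n $ 2) * n $ 1" .
  have "v $ 2 = v $ 2 * (n $ 1 * n $ 1 + n $ 2 * n $ 2)" using n by simp
  also have "\<dots> = (v $ 1 * n $ 1 + v $ 2 * n $ 2) * n $ 2"
  proof -
    have "v $ 2 * (n $ 1 * n $ 1) = (v $ 1 * n $ 2) * n $ 1" by (simp add: vp[symmetric])
    then show ?thesis by (simp add: algebra_simps)
  qed
  finally have 2: "v $ 2 = (v $ 1 * n $ 1 + v $ 2 * n $ 2) * n $ 2" .
  from 1 2 show ?thesis by (simp add: vec2_eq inner_vec2)
qed

text \<open>The graph of the chart, parametrized by arc length, is an admissible curve.\<close>
lemma boundary_curve:
  assumes p: "p \<in> frontier \<Omega>"
  obtains \<epsilon> \<gamma> \<gamma>' k where "0 < \<epsilon>" "\<gamma> 0 = p" "\<And>s. \<bar>s\<bar> < \<epsilon> \<Longrightarrow> \<gamma> s \<in> frontier \<Omega>"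
    "\<And>s. \<bar>s\<bar> < \<epsilon> \<Longrightarrow> (\<gamma> has_vector_derivative \<gamma>' s) (at s)" "\<And>s. \<bar>s\<bar> < \<epsilon> \<Longrightarrow> norm (\<gamma>' s) = 1"
    "(\<gamma>' has_vector_derivative k *\<^sub>R outward_normal \<Omega> p) (at 0)"
    "\<gamma>' 0 = perp (outward_normal \<Omega> p)"
proof -
  define n where "n = outward_normal \<Omega> p"
  obtain r g g' where ch: "boundary_chart \<Omega> p n (1/4) r g"
    and g: "\<And>t. \<bar>t\<bar> < r \<Longrightarrow> (g has_real_derivative g' t) (at t)"
    and g': "\<And>t. \<bar>t\<bar> < r \<Longrightarrow> g' differentiable (at t)" and g'0: "g' 0 = 0"
    by (rule chart[OF p, of "1/4" 1, folded n_def]) (simp, simp, simp, rule that)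
  have n: "norm n = 1" and r: "0 < r" and gb: "\<And>t. \<bar>t\<bar> < r \<Longrightarrow> \<bar>g t\<bar> \<le> 1/4 * \<bar>t\<bar>"
    using ch unfolding boundary_chart_def by auto
  obtain \<gamma> \<gamma>' \<theta> K \<epsilon> where \<epsilon>: "0 < \<epsilon>" and \<theta>: "\<And>s. \<bar>s\<bar> < \<epsilon> \<Longrightarrow> \<bar>\<theta> s\<bar> < r" "\<theta> 0 = 0"
    and \<gamma>: "\<And>s. \<gamma> s = pt p n (\<theta> s) (g (\<theta> s))"
    and \<gamma>d: "\<And>s. \<bar>s\<bar> < \<epsilon> \<Longrightarrow> (\<gamma> has_vector_derivative \<gamma>' s) (at s)"
    and \<gamma>n: "\<And>s. \<bar>s\<bar> < \<epsilon> \<Longrightarrow> norm (\<gamma>' s) = 1" and K: "(\<gamma>' has_vector_derivative K) (at 0)"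
    and \<gamma>'0: "\<gamma>' 0 = perp n"
    by (rule arclength_graph[OF n r g g' g'0, of p]) (assumption, assumption, rule that)
  have gr: "\<bar>g t\<bar> < r" if "\<bar>t\<bar> < r" for t using gb[OF that] that by linarith
  have fr: "\<gamma> s \<in> frontier \<Omega>" if "\<bar>s\<bar> < \<epsilon>" for s
    unfolding \<gamma> using boundary_chart_frontier[OF ch open_Omega \<theta>(1)[OF that] gr[OF \<theta>(1)[OF that]]] by simp
  have "g 0 = 0" using gb[of 0] r by simp
  then have "\<gamma> 0 = p" by (simp add: \<gamma> \<theta>(2) pt_def)
  have "((\<lambda>s. \<gamma>' s \<bullet> \<gamma>' s) has_derivative (\<lambda>h. \<gamma>' 0 \<bullet> (h *\<^sub>R K) + (h *\<^sub>R K) \<bullet> \<gamma>' 0)) (at 0)"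
    using K unfolding has_vector_derivative_def by (intro has_derivative_inner)
  moreover have "((\<lambda>s. \<gamma>' s \<bullet> \<gamma>' s) has_derivative (\<lambda>h. 0)) (at 0)"
  proof (rule has_derivative_transform_within_open[where s="ball 0 \<epsilon>"])
    show "((\<lambda>s::real. 1::real) has_derivative (\<lambda>h. 0)) (at 0)" by simp
    show "1 = \<gamma>' s \<bullet> \<gamma>' s" if "s \<in> ball 0 \<epsilon>" for s using \<gamma>n[of s] that by (simp add: norm_eq_1)
  qed (use \<epsilon> in auto)
  ultimately have "(\<lambda>h. \<gamma>' 0 \<bullet> (h *\<^sub>R K) + (h *\<^sub>R K) \<bullet> \<gamma>' 0) = (\<lambda>h. 0)" by (rule has_derivative_unique)
  then have "\<gamma>' 0 \<bullet> (1 *\<^sub>R K) + (1 *\<^sub>R K) \<bullet> \<gamma>' 0 = 0" by metis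
  then have "K \<bullet> \<gamma>' 0 = 0" by (simp add: inner_commute)
  then have "K = (K \<bullet> n) *\<^sub>R n"
    using orthogonal_unit_vec2[of "\<gamma>' 0" K 1 n] \<gamma>'0 n by (simp add: perp)
  then have "(\<gamma>' has_vector_derivative (K \<bullet> n) *\<^sub>R n) (at 0)" using K by metis
  with \<epsilon> \<open>\<gamma> 0 = p\<close> fr \<gamma>d \<gamma>n \<gamma>'0 show thesis
    by (intro that[of \<epsilon> \<gamma> \<gamma>' "K \<bullet> n"]) (simp_all add: n_def)
qed

text \<open>By \<open>curve_orthogonal\<close> the unit vector \<open>G p\<close> is normal to the boundary; its sign is determined by whether
  \<open>u\<close> increases or decreases towards the boundary.\<close>
lemma outward_normal_G:
  assumes p: "p \<in> frontier \<Omega>"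
  shows "outward_normal \<Omega> p = u p *\<^sub>R G p"
proof -
  define n where "n = outward_normal \<Omega> p"
  obtain r g g' where ch: "boundary_chart \<Omega> p n (1/4) r g"
    by (rule chart[OF p, of "1/4" 1, folded n_def]) (simp, simp, simp, rule that)
  have n: "norm n = 1" and r: "0 < r"
    and iff: "\<And>t y. \<bar>t\<bar> < r \<Longrightarrow> \<bar>y\<bar> < r \<Longrightarrow> pt p n t y \<in> \<Omega> \<longleftrightarrow> y < g t"
    and gb: "\<And>t. \<bar>t\<bar> < r \<Longrightarrow> \<bar>g t\<bar> \<le> 1/4 * \<bar>t\<bar>"
    using ch unfolding boundary_chart_def by auto
  obtain \<epsilon> \<gamma> \<gamma>' k where \<gamma>: "0 < \<epsilon>" "\<gamma> 0 = p" "\<And>s. \<bar>s\<bar> < \<epsilon> \<Longrightarrow> \<gamma> s \<in> frontier \<Omega>"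
    "\<And>s. \<bar>s\<bar> < \<epsilon> \<Longrightarrow> (\<gamma> has_vector_derivative \<gamma>' s) (at s)"
    "\<And>s. \<bar>s\<bar> < \<epsilon> \<Longrightarrow> norm (\<gamma>' s) = 1"
    "(\<gamma>' has_vector_derivative k *\<^sub>R n) (at 0)" "\<gamma>' 0 = perp n"
    by (rule boundary_curve[OF p, folded n_def]) (rule that)
  have "G (\<gamma> 0) \<bullet> \<gamma>' 0 = 0"
    by (rule curve_orthogonal[OF \<gamma>(1) \<gamma>(3) \<gamma>(4)]) (use \<gamma>(1) in simp_all)
  then have Gp: "G p = (G p \<bullet> n) *\<^sub>R n"
    using orthogonal_unit_vec2[of "perp n" "G p" 1 n] n \<gamma>(2,7) by (simp add: perp)
  have nn: "n \<bullet> n = 1" using n by (simp add: norm_eq_1)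
  have "(G p \<bullet> n) * (G p \<bullet> n) = 1"
    using norm_G_frontier[OF p] nn by (subst (asm) (1 2) Gp) simp
  then have pm: "G p \<bullet> n = 1 \<or> G p \<bullet> n = -1" by (simp add: square_eq_1_iff)
  have up: "u p = 1 \<or> u p = -1" by (rule frontier_value[OF p])
  \<comment> \<open>along the inner normal \<open>u p * u\<close> decreases from its maximal value 1, which fixes the sign\<close>
  have "0 \<le> u p * (G p \<bullet> n)"
  proof (rule ccontr)
    assume neg: "\<not> 0 \<le> u p * (G p \<bullet> n)"
    have "continuous_on UNIV (\<lambda>x. u p * (G x \<bullet> n))" by (intro continuous_intros G_continuous)
    then have "isCont (\<lambda>x. u p * (G x \<bullet> n)) p" by (simp add: continuous_on_eq_continuous_at)
    moreover have "0 < - (u p * (G p \<bullet> n))" using neg by simp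
    ultimately obtain \<delta> where \<delta>: "0 < \<delta>" "\<And>x. dist x p < \<delta> \<Longrightarrow> dist (u p * (G x \<bullet> n)) (u p * (G p \<bullet> n)) < - (u p * (G p \<bullet> n))"
      unfolding continuous_at_eps_delta by metis
    define s where "s = min (r / 2) (\<delta> / 2)"
    have s: "0 < s" "s < r" "s < \<delta>" using r \<delta>(1) by (auto simp: s_def)
    have g0: "g 0 = 0" using gb[of 0] r by simp
    have inn: "p + t *\<^sub>R (- n) \<in> \<Omega>" if t: "0 < t" "t \<le> s" for t
    proof -
      have "p + t *\<^sub>R (- n) = pt p n 0 (- t)" by (simp add: pt_def)
      then show ?thesis using iff[of 0 "- t"] t s r g0 by simp
    qed
    obtain t where t: "0 < t" "t < s" "u (p + s *\<^sub>R (- n)) - u p = s * (G (p + t *\<^sub>R (- n)) \<bullet> (- n))"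
      by (rule mvt_along_line[where s=s and f=u and q=p and v="- n" and F="\<lambda>x v. G x \<bullet> v"])
        (use s cont_at du_G inn in auto)
    have "dist (p + t *\<^sub>R (- n)) p < \<delta>" using t s n by (simp add: dist_norm)
    then have "dist (u p * (G (p + t *\<^sub>R (- n)) \<bullet> n)) (u p * (G p \<bullet> n)) < - (u p * (G p \<bullet> n))" by (rule \<delta>(2))
    then have neg2: "u p * (G (p + t *\<^sub>R (- n)) \<bullet> n) < 0" unfolding dist_real_def by linarith
    have "u p * (u (p + s *\<^sub>R (- n)) - u p) = - (s * (u p * (G (p + t *\<^sub>R (- n)) \<bullet> n)))"
      unfolding t(3) by simp
    moreover have "s * (u p * (G (p + t *\<^sub>R (- n)) \<bullet> n)) < 0" using s(1) neg2 by (rule mult_pos_neg)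
    ultimately have "0 < u p * (u (p + s *\<^sub>R (- n)) - u p)" by linarith
    moreover have "-1 < u (p + s *\<^sub>R (- n))" "u (p + s *\<^sub>R (- n)) < 1"
      using inn[of s] s(1) by (auto simp: Omega)
    ultimately show False using up by auto
  qed
  then have "u p * (G p \<bullet> n) = 1" using pm up by auto
  then have "u p *\<^sub>R G p = n" using Gp by (metis scaleR_one scaleR_scaleR)
  then show ?thesis by (simp add: n_def)
qed

text \<open>For every admissible curve the derivative of \<open>G(\<gamma>) \<bullet> \<gamma>' = 0\<close> at 0 is \<open>D\<^sup>2u \<gamma>' \<bullet> \<gamma>' + k G \<bullet> \<nu> = 0\<close>. Since the
  Hessian is trace free and \<open>\<gamma>'\<close> is orthogonal to \<open>\<nu>\<close>, this determines \<open>k\<close>, so the definite description of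
  the curvature denotes; \<open>boundary_curve\<close> supplies the existence.\<close>
lemma boundary_curvature_H:
  assumes p: "p \<in> frontier \<Omega>"
  shows "boundary_curvature \<Omega> p = H p"
  unfolding boundary_curvature_def
proof (rule the_equality)
  have *: "k = H p"
    if \<epsilon>: "0 < \<epsilon>" and \<gamma>0: "\<gamma> 0 = p" and fr: "\<And>t. \<bar>t\<bar> < \<epsilon> \<Longrightarrow> \<gamma> t \<in> frontier \<Omega>"
      and der: "\<And>t. \<bar>t\<bar> < \<epsilon> \<Longrightarrow> (\<gamma> has_vector_derivative \<gamma>' t) (at t)"
      and nrm: "\<And>t. \<bar>t\<bar> < \<epsilon> \<Longrightarrow> norm (\<gamma>' t) = 1"
      and der2: "(\<gamma>' has_vector_derivative k *\<^sub>R outward_normal \<Omega> p) (at 0)" for k \<epsilon> and \<gamma> \<gamma>' :: "real \<Rightarrow> real^2"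
  proof -
    let ?I = "{-\<epsilon><..<\<epsilon>}"
    have 0: "\<bar>0::real\<bar> < \<epsilon>" using \<epsilon> by simp
    have orth: "G (\<gamma> t) \<bullet> \<gamma>' t = 0" if "\<bar>t\<bar> < \<epsilon>" for t
      by (rule curve_orthogonal[OF \<epsilon> fr der[OF that] that])
    define v where "v = \<gamma>' 0"
    have along: "((\<lambda>t. h (\<gamma> t)) has_derivative (\<lambda>s. s * (w p \<bullet> v))) (at 0)"
      if h: "continuous_on UNIV h" "continuous_on UNIV w" "\<And>x. x \<in> \<Omega> \<Longrightarrow> (h has_derivative (\<lambda>v. w x \<bullet> v)) (at x)"
      for h :: "real^2 \<Rightarrow> real" and w
    proof -
      have 1: "(\<gamma> has_derivative (\<lambda>s. s *\<^sub>R v)) (at 0 within ?I)"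
        using der[OF 0] unfolding has_vector_derivative_def v_def by (rule has_derivative_at_withinI)
      have "(h has_derivative (\<lambda>v. w p \<bullet> v)) (at p within frontier \<Omega>)"
        by (rule has_derivative_within_frontier[OF h p])
      then have 2: "(h has_derivative (\<lambda>v. w p \<bullet> v)) (at (\<gamma> 0) within \<gamma> ` ?I)"
        unfolding \<gamma>0 by (rule has_derivative_subset) (use fr in \<open>auto simp: abs_less_iff\<close>)
      have "(h \<circ> \<gamma> has_derivative (\<lambda>v. w p \<bullet> v) \<circ> (\<lambda>s. s *\<^sub>R v)) (at 0 within ?I)"
        using 1 2 by (rule diff_chain_within)
      then show ?thesis using \<epsilon> by (simp add: at_within_open[OF _ open_greaterThanLessThan] comp_def)
    qed
    have A: "((\<lambda>t. a (\<gamma> t)) has_derivative (\<lambda>s. s * (vector [c p, d p] \<bullet> v))) (at 0)"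
      by (rule along[of a "\<lambda>x. vector [c x, d x]"]) (use cont da vector2_continuous in \<open>auto simp: inner_vec2\<close>)
    have B: "((\<lambda>t. b (\<gamma> t)) has_derivative (\<lambda>s. s * (vector [d p, - c p] \<bullet> v))) (at 0)"
      by (rule along[of b "\<lambda>x. vector [d x, - c x]"])
        (use cont db vector2_continuous continuous_on_minus[OF cont(4)] in \<open>auto simp: inner_vec2\<close>)
    define \<nu> where "\<nu> = outward_normal \<Omega> p"
    have nth: "((\<lambda>t. \<gamma>' t $ i) has_derivative (\<lambda>s. s * (k * \<nu> $ i))) (at 0)" for i
    proof -
      have "((\<lambda>t. \<gamma>' t $ i) has_derivative (\<lambda>s. (s *\<^sub>R (k *\<^sub>R \<nu>)) $ i)) (at 0)"
        using der2 unfolding has_vector_derivative_def \<nu>_def[symmetric]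
        by (rule bounded_linear.has_derivative[OF bounded_linear_vec_nth])
      then show ?thesis by (simp add: mult.assoc)
    qed
    have "((\<lambda>t. a (\<gamma> t) * \<gamma>' t $ 1 + b (\<gamma> t) * \<gamma>' t $ 2) has_derivative
        (\<lambda>s. (a (\<gamma> 0) * (s * (k * \<nu> $ 1)) + s * (vector [c p, d p] \<bullet> v) * \<gamma>' 0 $ 1)
          + (b (\<gamma> 0) * (s * (k * \<nu> $ 2)) + s * (vector [d p, - c p] \<bullet> v) * \<gamma>' 0 $ 2))) (at 0)"
      by (intro has_derivative_add has_derivative_mult A B nth)
    moreover have "((\<lambda>t. a (\<gamma> t) * \<gamma>' t $ 1 + b (\<gamma> t) * \<gamma>' t $ 2) has_derivative (\<lambda>s. 0)) (at 0)"
    proof (rule has_derivative_transform_within_open[where s="ball 0 \<epsilon>"])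
      show "((\<lambda>s::real. 0::real) has_derivative (\<lambda>h. 0)) (at 0)" by simp
      show "0 = a (\<gamma> t) * \<gamma>' t $ 1 + b (\<gamma> t) * \<gamma>' t $ 2" if "t \<in> ball 0 \<epsilon>" for t
        using orth[of t] that by (simp add: G_def inner_vec2)
    qed (use \<epsilon> in auto)
    ultimately have "(\<lambda>s. (a (\<gamma> 0) * (s * (k * \<nu> $ 1)) + s * (vector [c p, d p] \<bullet> v) * \<gamma>' 0 $ 1)
          + (b (\<gamma> 0) * (s * (k * \<nu> $ 2)) + s * (vector [d p, - c p] \<bullet> v) * \<gamma>' 0 $ 2)) = (\<lambda>s. 0)"
      by (rule has_derivative_unique)
    then have "(a (\<gamma> 0) * (1 * (k * \<nu> $ 1)) + 1 * (vector [c p, d p] \<bullet> v) * \<gamma>' 0 $ 1)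
          + (b (\<gamma> 0) * (1 * (k * \<nu> $ 2)) + 1 * (vector [d p, - c p] \<bullet> v) * \<gamma>' 0 $ 2) = 0"
      by metis
    then have eq: "k * (a p * \<nu> $ 1 + b p * \<nu> $ 2) + (c p * v $ 1 + d p * v $ 2) * v $ 1 + (d p * v $ 1 - c p * v $ 2) * v $ 2 = 0"
      by (simp add: \<gamma>0 inner_vec2 v_def[symmetric] algebra_simps)
    have \<nu>: "\<nu> $ 1 = u p * a p" "\<nu> $ 2 = u p * b p"
      unfolding \<nu>_def outward_normal_G[OF p] by (simp_all add: G_def)
    have ab: "a p * a p + b p * b p = 1" using norm_G_frontier[OF p] by (simp add: G_def inner_vec2)
    have "a p * \<nu> $ 1 + b p * \<nu> $ 2 = u p * (a p * a p + b p * b p)" unfolding \<nu> by (simp add: algebra_simps)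
    then have ku: "k * u p + (c p * v $ 1 + d p * v $ 2) * v $ 1 + (d p * v $ 1 - c p * v $ 2) * v $ 2 = 0"
      using eq ab by simp
    have vn: "v $ 1 * v $ 1 + v $ 2 * v $ 2 = 1" using nrm[OF 0] by (simp add: v_def norm_eq_1 inner_vec2)
    have vo: "a p * v $ 1 + b p * v $ 2 = 0" using orth[OF 0] \<gamma>0 by (simp add: v_def G_def inner_vec2)
    \<comment> \<open>\<open>v\<close> is the rotated gradient up to sign, and the Hessian is trace free\<close>
    have v1: "v $ 1 * v $ 1 = b p * b p" and v2: "v $ 2 * v $ 2 = a p * a p" and v12: "v $ 1 * v $ 2 = - (a p * b p)"
    proof -
      define l where "l = a p * v $ 2 - b p * v $ 1"
      have "v $ 1 = (a p * a p + b p * b p) * v $ 1" using ab by simp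
      also have "\<dots> = a p * (a p * v $ 1 + b p * v $ 2) - b p * l" by (simp add: l_def algebra_simps)
      finally have x1: "v $ 1 = - (b p * l)" using vo by simp
      have "v $ 2 = (a p * a p + b p * b p) * v $ 2" using ab by simp
      also have "\<dots> = b p * (a p * v $ 1 + b p * v $ 2) + a p * l" by (simp add: l_def algebra_simps)
      finally have x2: "v $ 2 = a p * l" using vo by simp
      have "v $ 1 * v $ 1 + v $ 2 * v $ 2 = (a p * a p + b p * b p) * (l * l)"
        unfolding x1 x2 by (simp add: algebra_simps)
      then have l: "l * l = 1" using vn ab by simp
      have "v $ 1 * v $ 1 = (b p * b p) * (l * l)" "v $ 2 * v $ 2 = (a p * a p) * (l * l)"
        "v $ 1 * v $ 2 = - (a p * b p) * (l * l)" unfolding x1 x2 by (simp_all add: algebra_simps)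
      then show "v $ 1 * v $ 1 = b p * b p" "v $ 2 * v $ 2 = a p * a p" "v $ 1 * v $ 2 = - (a p * b p)"
        using l by simp_all
    qed
    have "(c p * v $ 1 + d p * v $ 2) * v $ 1 + (d p * v $ 1 - c p * v $ 2) * v $ 2
        = c p * (v $ 1 * v $ 1) + 2 * d p * (v $ 1 * v $ 2) - c p * (v $ 2 * v $ 2)"
      by (simp add: algebra_simps)
    then have "k * u p = c p * (a p * a p) + 2 * d p * (a p * b p) - c p * (b p * b p)"
      using ku unfolding v1 v2 v12 by simp
    also have "\<dots> = D2 p (G p) \<bullet> G p" by (simp add: D2_def G_def inner_vec2 algebra_simps)
    finally have "k * u p * u p = H p" by (simp add: H_def)
    moreover have "u p * u p = 1" using frontier_value[OF p] by auto
    ultimately show ?thesis by (simp add: mult.assoc)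
  qed
  show "k = H p"
    if ex: "\<exists>\<epsilon>>0. \<exists>\<gamma> \<gamma>'. \<gamma> 0 = p \<and> (\<forall>t\<in>{-\<epsilon><..<\<epsilon>}. \<gamma> t \<in> frontier \<Omega> \<and>
            (\<gamma> has_vector_derivative \<gamma>' t) (at t) \<and> norm (\<gamma>' t) = 1) \<and>
        (\<gamma>' has_vector_derivative k *\<^sub>R outward_normal \<Omega> p) (at 0)" for k
  proof -
    obtain \<epsilon> \<gamma> \<gamma>' where "0 < \<epsilon>" "\<gamma> 0 = p" "\<forall>t\<in>{-\<epsilon><..<\<epsilon>}. \<gamma> t \<in> frontier \<Omega> \<and>
            (\<gamma> has_vector_derivative \<gamma>' t) (at t) \<and> norm (\<gamma>' t) = 1"
        "(\<gamma>' has_vector_derivative k *\<^sub>R outward_normal \<Omega> p) (at 0)" using ex by blast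
    then show ?thesis by (intro *[of \<epsilon> \<gamma> \<gamma>' k]) (auto simp: abs_less_iff)
  qed
  obtain \<epsilon> \<gamma> \<gamma>' k where \<gamma>: "0 < \<epsilon>" "\<gamma> 0 = p" "\<And>s. \<bar>s\<bar> < \<epsilon> \<Longrightarrow> \<gamma> s \<in> frontier \<Omega>"
    "\<And>s. \<bar>s\<bar> < \<epsilon> \<Longrightarrow> (\<gamma> has_vector_derivative \<gamma>' s) (at s)"
    "\<And>s. \<bar>s\<bar> < \<epsilon> \<Longrightarrow> norm (\<gamma>' s) = 1"
    "(\<gamma>' has_vector_derivative k *\<^sub>R outward_normal \<Omega> p) (at 0)" "\<gamma>' 0 = perp (outward_normal \<Omega> p)"
    by (rule boundary_curve[OF p]) (rule that)
  have "k = H p" by (rule *[OF \<gamma>(1-6)])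
  then show "\<exists>\<epsilon>>0. \<exists>\<gamma> \<gamma>'. \<gamma> 0 = p \<and> (\<forall>t\<in>{-\<epsilon><..<\<epsilon>}. \<gamma> t \<in> frontier \<Omega> \<and>
            (\<gamma> has_vector_derivative \<gamma>' t) (at t) \<and> norm (\<gamma>' t) = 1) \<and>
        (\<gamma>' has_vector_derivative H p *\<^sub>R outward_normal \<Omega> p) (at 0)"
    using \<gamma>(1-6) by (intro exI[of _ \<epsilon>] conjI exI[of _ \<gamma>] exI[of _ \<gamma>']) (auto simp: abs_less_iff)
qed

end

section \<open>Concentration of the cut-off on the free boundary\<close>

text \<open>The density \<open>m\<close> has total mass \<open>z(-\<rho>) - z \<rho>\<close>, and where it does not vanish \<open>\<psi>\<close> is close to \<open>C\<close>.\<close>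
lemma integral_against_derivative:
  fixes z m \<psi> :: "real \<Rightarrow> real"
  assumes "0 \<le> \<rho>"
    and der: "\<And>y. -\<rho> \<le> y \<Longrightarrow> y \<le> \<rho> \<Longrightarrow> (z has_real_derivative - m y) (at y)"
    and m: "\<And>y. isCont m y" and \<psi>: "\<And>y. isCont \<psi> y"
    and m0: "\<And>y. -\<rho> \<le> y \<Longrightarrow> y \<le> \<rho> \<Longrightarrow> 0 \<le> m y"
    and near: "\<And>y. -\<rho> \<le> y \<Longrightarrow> y \<le> \<rho> \<Longrightarrow> m y \<noteq> 0 \<Longrightarrow> \<bar>\<psi> y - C\<bar> \<le> \<eta>"
  shows "\<bar>(LINT y|lborel. m y * \<psi> y * indicator {-\<rho>..\<rho>} y) - C * (z (-\<rho>) - z \<rho>)\<bar> \<le> \<eta> * (z (-\<rho>) - z \<rho>)"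
proof -
  have "((\<lambda>y. - z y) has_real_derivative m y) (at y)" if "-\<rho> \<le> y" "y \<le> \<rho>" for y
    using DERIV_minus[OF der[OF that]] by simp
  then have M: "has_bochner_integral lborel (\<lambda>y. m y * indicator {-\<rho>..\<rho>} y) (- z \<rho> - (- z (-\<rho>)))"
    using assms(1) m by (intro has_bochner_integral_FTC_Icc_real) auto
  then have Mi: "integrable lborel (\<lambda>y. m y * indicator {-\<rho>..\<rho>} y)"
    and Mv: "(LINT y|lborel. m y * indicator {-\<rho>..\<rho>} y) = z (-\<rho>) - z \<rho>"
    by (auto simp: has_bochner_integral_iff)
  have int: "integrable lborel (\<lambda>y. m y * \<psi> y * indicator {-\<rho>..\<rho>} y)"
  proof -
    have "continuous_on {-\<rho>..\<rho>} (\<lambda>y. m y * \<psi> y)"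
      using m \<psi> by (intro continuous_at_imp_continuous_on ballI continuous_intros) auto
    then have "integrable lborel (\<lambda>y. indicator {-\<rho>..\<rho>} y *\<^sub>R (m y * \<psi> y))"
      by (intro borel_integrable_compact) auto
    then show ?thesis by (simp add: mult.commute)
  qed
  have "(LINT y|lborel. m y * \<psi> y * indicator {-\<rho>..\<rho>} y) - C * (z (-\<rho>) - z \<rho>)
      = (LINT y|lborel. m y * \<psi> y * indicator {-\<rho>..\<rho>} y - C * (m y * indicator {-\<rho>..\<rho>} y))"
    using int Mi by (simp add: Mv)
  moreover have "norm (LINT y|lborel. m y * \<psi> y * indicator {-\<rho>..\<rho>} y - C * (m y * indicator {-\<rho>..\<rho>} y))
      \<le> (LINT y|lborel. \<eta> * (m y * indicator {-\<rho>..\<rho>} y))"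
  proof (rule Bochner_Integration.integral_norm_bound_integral)
    show "integrable lborel (\<lambda>y. m y * \<psi> y * indicator {-\<rho>..\<rho>} y - C * (m y * indicator {-\<rho>..\<rho>} y))"
      using int Mi by simp
    show "integrable lborel (\<lambda>y. \<eta> * (m y * indicator {-\<rho>..\<rho>} y))" using Mi by simp
    show "norm (m y * \<psi> y * indicator {-\<rho>..\<rho>} y - C * (m y * indicator {-\<rho>..\<rho>} y)) \<le> \<eta> * (m y * indicator {-\<rho>..\<rho>} y)" for y
    proof (cases "y \<in> {-\<rho>..\<rho>} \<and> m y \<noteq> 0")
      case True
      then have "\<bar>\<psi> y - C\<bar> \<le> \<eta>" "0 \<le> m y" using near m0 by auto
      then have "m y * \<bar>\<psi> y - C\<bar> \<le> m y * \<eta>" by (intro mult_left_mono)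
      moreover have "m y * \<psi> y - C * m y = m y * (\<psi> y - C)" by (simp add: algebra_simps)
      ultimately show ?thesis using True \<open>0 \<le> m y\<close> by (simp add: abs_mult mult.commute)
    qed auto
  qed
  ultimately show ?thesis by (simp add: Mv)
qed

text \<open>A step of class \<open>C\<^sup>1\<close> from 0 to 1 on the interval \<open>[1, 2]\<close>, whose derivative is a tent with vertex at
  \<open>3/2\<close>.\<close>
definition zeta :: "real \<Rightarrow> real" where
  "zeta s = 2 * ((max 0 (s - 1))\<^sup>2 - 2 * (max 0 (s - 3/2))\<^sup>2 + (max 0 (s - 2))\<^sup>2)"
definition zeta' :: "real \<Rightarrow> real" where
  "zeta' s = 4 * (max 0 (s - 1) - 2 * max 0 (s - 3/2) + max 0 (s - 2))"

lemma positive_part_square_derivative: "((\<lambda>s::real. (max 0 (s - c))\<^sup>2) has_real_derivative 2 * max 0 (s - c)) (at s)"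
proof (cases s c rule: linorder_cases)
  case less
  have "((\<lambda>s. 0::real) has_real_derivative 0) (at s)" by simp
  then have "((\<lambda>s. (max 0 (s - c))\<^sup>2) has_real_derivative 0) (at s)"
    by (rule has_field_derivative_transform_within_open[where S="{..<c}"]) (use less in auto)
  then show ?thesis using less by simp
next
  case greater
  have "((\<lambda>s. (s - c)\<^sup>2) has_real_derivative 2 * (s - c)) (at s)"
    by (auto intro!: derivative_eq_intros)
  then have "((\<lambda>s. (max 0 (s - c))\<^sup>2) has_real_derivative 2 * (s - c)) (at s)"
    by (rule has_field_derivative_transform_within_open[where S="{c<..}"]) (use greater in auto)
  then show ?thesis using greater by simp
next
  case equal
  have "((\<lambda>h::real. (max 0 h)\<^sup>2 / h) \<longlongrightarrow> 0) (at 0)"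
  proof (rule Lim_null_comparison[where g="\<lambda>h. \<bar>h\<bar>"])
    show "\<forall>\<^sub>F h in at 0. norm ((max 0 h)\<^sup>2 / h) \<le> \<bar>h\<bar>"
      by (intro always_eventually allI) (auto simp: max_def power2_eq_square)
    show "((\<lambda>h::real. \<bar>h\<bar>) \<longlongrightarrow> 0) (at 0)" by (rule tendsto_rabs_zero) (rule tendsto_ident_at)
  qed
  then show ?thesis using equal by (simp add: DERIV_def)
qed

lemma zeta_derivative: "(zeta has_real_derivative zeta' s) (at s)"
proof -
  have "((\<lambda>s. 2 * ((max 0 (s - 1))\<^sup>2 - 2 * (max 0 (s - 3/2))\<^sup>2 + (max 0 (s - 2))\<^sup>2)) has_real_derivative
     2 * (2 * max 0 (s - 1) - 2 * (2 * max 0 (s - 3/2)) + 2 * max 0 (s - 2))) (at s)"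
    by (intro DERIV_cmult DERIV_add DERIV_diff positive_part_square_derivative)
  moreover have "(\<lambda>s. 2 * ((max 0 (s - 1))\<^sup>2 - 2 * (max 0 (s - 3/2))\<^sup>2 + (max 0 (s - 2))\<^sup>2)) = zeta"
    by (simp add: fun_eq_iff zeta_def)
  moreover have "2 * (2 * max 0 (s - 1) - 2 * (2 * max 0 (s - 3/2)) + 2 * max 0 (s - 2)) = zeta' s"
    by (simp add: zeta'_def)
  ultimately show ?thesis by simp
qed

lemma zeta_values:
  "s \<le> 1 \<Longrightarrow> zeta s = 0" "2 \<le> s \<Longrightarrow> zeta s = 1" "s \<le> 1 \<Longrightarrow> zeta' s = 0" "2 \<le> s \<Longrightarrow> zeta' s = 0" "0 \<le> zeta' s"
  by (auto simp: zeta_def zeta'_def max_def power2_eq_square algebra_simps)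

lemma zeta_bounds: "0 \<le> zeta s" "zeta s \<le> 1"
proof -
  have mono: "zeta x \<le> zeta y" if "x \<le> y" for x y
    using that by (rule DERIV_nonneg_imp_nondecreasing) (use zeta_derivative zeta_values(5) in blast)
  show "0 \<le> zeta s" using mono[of "min s 1" s] zeta_values(1)[of "min s 1"] by simp
  show "zeta s \<le> 1" using mono[of s "max s 2"] zeta_values(2)[of "max s 2"] by simp
qed

lemma zeta'_continuous: "continuous_on UNIV zeta'"
  unfolding zeta'_def by (intro continuous_intros)

context free_boundary
begin

text \<open>\<open>w\<close> vanishes exactly outside \<open>\<Omega>\<close>, so the cut-off \<open>Z k\<close> is 0 near the complement of \<open>\<Omega>\<close> and tends to 1
  inside. The gradient of \<open>Z k\<close> is \<open>- q k\<close> times the field \<open>u G\<close>, which extends the outward normal.\<close>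
definition w :: "real^2 \<Rightarrow> real" where "w x = 1 - (u x)\<^sup>2"
definition Z :: "real \<Rightarrow> real^2 \<Rightarrow> real" where "Z k x = zeta (k * w x)"
definition q :: "real \<Rightarrow> real^2 \<Rightarrow> real" where "q k x = 2 * k * zeta' (k * w x)"

lemma w_outside: "x \<notin> \<Omega> \<Longrightarrow> w x = 0"
  using outside[of x] by (auto simp: w_def)

lemma w_inside: "x \<in> \<Omega> \<Longrightarrow> 0 < w x"
proof -
  assume "x \<in> \<Omega>"
  then have "0 < (1 - u x) * (1 + u x)" by (intro mult_pos_pos) (auto simp: Omega)
  then show ?thesis by (simp add: w_def power2_eq_square algebra_simps)
qed

lemma w_continuous: "continuous_on UNIV w"
  unfolding w_def by (intro continuous_intros cont)

lemma q_continuous: "continuous_on UNIV (q k)"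
  unfolding q_def by (intro continuous_intros continuous_on_compose2[OF zeta'_continuous] w_continuous) auto

lemma q_nonneg: "0 \<le> k \<Longrightarrow> 0 \<le> q k x"
  using zeta_values(5) by (simp add: q_def)

lemma q_outside: "x \<notin> \<Omega> \<Longrightarrow> q k x = 0"
  using zeta_values(3)[of 0] by (simp add: q_def w_outside)

lemma Z_outside: "x \<notin> \<Omega> \<Longrightarrow> Z k x = 0"
  using zeta_values(1)[of 0] by (simp add: Z_def w_outside)

lemma Z_bounds: "0 \<le> Z k x" "Z k x \<le> 1"
  using zeta_bounds by (simp_all add: Z_def)

text \<open>Outside \<open>\<Omega>\<close> both sides vanish in a neighbourhood, because \<open>zeta\<close> is 0 up to 1.\<close>
lemma Z_derivative: "(Z k has_derivative (\<lambda>v. - (q k x * (u x * (G x \<bullet> v))))) (at x)"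
proof (cases "x \<in> \<Omega>")
  case True
  have "(w has_derivative (\<lambda>v. - (2 * u x * (G x \<bullet> v)))) (at x)"
    unfolding w_def by (auto intro!: derivative_eq_intros du_G[OF True])
  then have 1: "((\<lambda>x. k * w x) has_derivative (\<lambda>v. k * - (2 * u x * (G x \<bullet> v)))) (at x)"
    by (rule has_derivative_mult_right)
  have 2: "(zeta has_derivative (\<lambda>h. zeta' (k * w x) * h)) (at (k * w x))"
    using zeta_derivative by (simp add: has_field_derivative_def)
  have "((\<lambda>x. zeta (k * w x)) has_derivative (\<lambda>v. zeta' (k * w x) * (k * - (2 * u x * (G x \<bullet> v))))) (at x)"
    by (rule has_derivative_compose[OF 1 2])
  moreover have "(\<lambda>x. zeta (k * w x)) = Z k" by (simp add: fun_eq_iff Z_def)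
  moreover have "(\<lambda>v. zeta' (k * w x) * (k * - (2 * u x * (G x \<bullet> v)))) = (\<lambda>v. - (q k x * (u x * (G x \<bullet> v))))"
    by (simp add: fun_eq_iff q_def algebra_simps)
  ultimately show ?thesis by simp
next
  case False
  have "open {y. k * w y < 1}" using w_continuous by (intro open_Collect_less continuous_intros) auto
  moreover have "x \<in> {y. k * w y < 1}" using w_outside[OF False] by simp
  ultimately have "(Z k has_derivative (\<lambda>v. 0)) (at x)"
    by (rule has_derivative_transform_within_open[where f="\<lambda>_. 0", rotated]) (auto simp: Z_def zeta_values(1))
  then show ?thesis by (simp add: q_outside[OF False])
qed

lemma eventually_q_eq_0_on_compact:
  assumes "compact K" "K \<subseteq> \<Omega>"
  shows "\<forall>\<^sub>F k in sequentially. \<forall>x\<in>K. q (real k) x = 0 \<and> Z (real k) x = 1"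
proof (cases "K = {}")
  case False
  have "continuous_on K w" using w_continuous continuous_on_subset by blast
  then obtain x0 where x0: "x0 \<in> K" "\<And>x. x \<in> K \<Longrightarrow> w x0 \<le> w x"
    using continuous_attains_inf[OF assms(1) False] by metis
  have w0: "0 < w x0" using w_inside x0(1) assms(2) by blast
  have "\<forall>\<^sub>F k in sequentially. 2 / w x0 \<le> real k"
    using eventually_ge_at_top[of "nat \<lceil>2 / w x0\<rceil>"] by eventually_elim linarith
  then show ?thesis
  proof eventually_elim
    case (elim k)
    have "2 \<le> real k * w x" if "x \<in> K" for x
    proof -
      have "2 \<le> real k * w x0" using elim w0 by (simp add: field_simps)
      also have "\<dots> \<le> real k * w x" using x0(2)[OF that] by (intro mult_left_mono) auto
      finally show ?thesis .
    qed
    then show ?case by (simp add: q_def Z_def zeta_values)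
  qed
qed simp

text \<open>On each line in the normal direction the densities \<open>q k * u * (G \<bullet> n)\<close> are nonnegative, have total
  mass tending to 1 and concentrate at the boundary point.\<close>
lemma local_limit:
  assumes ch: "boundary_chart \<Omega> p n \<epsilon> r g" and \<epsilon>: "\<epsilon> \<le> 1/4"
    and pos: "\<And>x. dist x p < 2 * r \<Longrightarrow> 0 \<le> u x * (G x \<bullet> n)"
    and \<Psi>: "continuous_on UNIV \<Psi>" and supp: "\<And>x. r / 2 \<le> dist x p \<Longrightarrow> \<Psi> x = 0"
  shows "(\<lambda>k. LINT x|lborel. q (real k) x * (u x * (G x \<bullet> n)) * \<Psi> x)
     \<longlonglongrightarrow> (LINT t|lborel. indicator {- (r / 2)<..<r / 2} t * \<Psi> (pt p n t (g t)))"
    and "integrable lborel (\<lambda>t. indicator {- (r / 2)<..<r / 2} t * \<Psi> (pt p n t (g t)))"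
proof -
  have n: "norm n = 1" and r: "0 < r"
    and iff: "\<And>t y. \<bar>t\<bar> < r \<Longrightarrow> \<bar>y\<bar> < r \<Longrightarrow> pt p n t y \<in> \<Omega> \<longleftrightarrow> y < g t"
    and gb: "\<And>t. \<bar>t\<bar> < r \<Longrightarrow> \<bar>g t\<bar> \<le> \<epsilon> * \<bar>t\<bar>"
    and lip: "\<And>s t. \<bar>s\<bar> < r \<Longrightarrow> \<bar>t\<bar> < r \<Longrightarrow> \<bar>g s - g t\<bar> \<le> \<epsilon> * \<bar>s - t\<bar>"
    using ch unfolding boundary_chart_def by auto
  define \<rho> where "\<rho> = r / 2"
  have \<rho>: "0 < \<rho>" "\<rho> < r" using r by (auto simp: \<rho>_def)
  have suppR: "\<Psi> x = 0" if "norm p + \<rho> < norm x" for x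
    using supp[of x] norm_triangle_ineq2[of x p] that by (simp add: dist_norm \<rho>_def)
  obtain M where M: "0 < M" "\<And>x. \<bar>\<Psi> x\<bar> \<le> M"
    using compactly_supported_bounded[OF \<Psi> suppR] by metis
  have tn: "norm (perp n) = 1" "perp n \<bullet> n = 0" using n perp by auto
  define m where "m k x = q (real k) x * (u x * (G x \<bullet> n))" for k and x :: "real^2"
  have m_cont: "continuous_on UNIV (m k)" for k
    unfolding m_def by (intro continuous_intros q_continuous cont G_continuous)
  have F_cont: "continuous_on UNIV (\<lambda>x. m k x * \<Psi> x)" for k by (intro continuous_intros m_cont \<Psi>)
  have F_int: "integrable lborel (\<lambda>x. m k x * \<Psi> x)" for k
    by (rule compactly_supported_integrable[OF F_cont, of "norm p + \<rho>"]) (simp add: suppR)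
  define I where "I k t = (LINT y|lborel. m k (pt p n t y) * \<Psi> (pt p n t y))" for k t
  define f where "f t = indicator {-\<rho><..<\<rho>} t * \<Psi> (pt p n t (g t))" for t
  have rot: "(LINT x|lborel. m k x * \<Psi> x) = (LINT t|lborel. I k t)" for k
    using integral_rotated_coordinates(2)[OF tn(1) n tn(2) F_int[of k], of p] by (simp add: I_def pt_def)
  have I_meas: "I k \<in> borel_measurable lborel" for k
  proof -
    have "integrable (lborel \<Otimes>\<^sub>M lborel) (\<lambda>(t, y). m k (pt p n t y) * \<Psi> (pt p n t y))"
      using integral_rotated_coordinates(1)[OF tn(1) n tn(2) F_int[of k], of p] by (simp add: pt_def)
    from borel_measurable_integrable[OF lborel_pair.integrable_fst'[OF this]]
    moreover have "I k = (\<lambda>t. LINT y|lborel. m k (pt p n t y) * \<Psi> (pt p n t y))" by (simp add: fun_eq_iff I_def)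
    ultimately show ?thesis by simp
  qed
  have far: "\<Psi> (pt p n t y) = 0" if "\<rho> \<le> \<bar>t\<bar> \<or> \<rho> \<le> \<bar>y\<bar>" for t y
  proof (rule supp)
    have "\<bar>t\<bar> \<le> norm (pt p n t y - p)" "\<bar>y\<bar> \<le> norm (pt p n t y - p)"
      using Cauchy_Schwarz_ineq2[of "pt p n t y - p" "perp n"] Cauchy_Schwarz_ineq2[of "pt p n t y - p" n]
        pt_inner[OF n, of p t y] n tn by auto
    then show "r / 2 \<le> dist (pt p n t y) p" using that by (auto simp: dist_norm \<rho>_def)
  qed
  have I0: "I k t = 0" if "\<rho> \<le> \<bar>t\<bar>" for k t using far[of t] that by (simp add: I_def)
  have I_eq: "I k t = (LINT y|lborel. m k (pt p n t y) * \<Psi> (pt p n t y) * indicator {-\<rho>..\<rho>} y)" for k t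
    unfolding I_def
  proof (intro Bochner_Integration.integral_cong refl)
    fix y
    show "m k (pt p n t y) * \<Psi> (pt p n t y) = m k (pt p n t y) * \<Psi> (pt p n t y) * indicator {-\<rho>..\<rho>} y"
    proof (cases "y \<in> {-\<rho>..\<rho>}")
      case False
      then have "\<rho> \<le> \<bar>y\<bar>" by auto
      then show ?thesis using far[of t y] by simp
    qed simp
  qed
  have pt_cont: "isCont (pt p n t) y" for t y unfolding pt_def by (intro continuous_intros)
  have line: "\<bar>I k t - C * (Z (real k) (pt p n t (-\<rho>)) - Z (real k) (pt p n t \<rho>))\<bar>
      \<le> \<eta> * (Z (real k) (pt p n t (-\<rho>)) - Z (real k) (pt p n t \<rho>))"
    if t: "\<bar>t\<bar> < \<rho>"
      and near: "\<And>y. -\<rho> \<le> y \<Longrightarrow> y \<le> \<rho> \<Longrightarrow> m k (pt p n t y) \<noteq> 0 \<Longrightarrow> \<bar>\<Psi> (pt p n t y) - C\<bar> \<le> \<eta>" for k t C \<eta>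
    unfolding I_eq
  proof (rule integral_against_derivative[where z="\<lambda>y. Z (real k) (pt p n t y)" and m="\<lambda>y. m k (pt p n t y)"
        and \<psi>="\<lambda>y. \<Psi> (pt p n t y)"])
    show "0 \<le> \<rho>" using \<rho> by simp
    show "((\<lambda>y. Z (real k) (pt p n t y)) has_real_derivative - m k (pt p n t y)) (at y)" for y
      unfolding m_def pt_def by (rule has_real_derivative_along_line) (rule Z_derivative)
    show "isCont (\<lambda>y. m k (pt p n t y)) y" for y
      by (rule isCont_o2[OF pt_cont]) (use m_cont in \<open>simp add: continuous_on_eq_continuous_at\<close>)
    show "isCont (\<lambda>y. \<Psi> (pt p n t y)) y" for y
      by (rule isCont_o2[OF pt_cont]) (use \<Psi> in \<open>simp add: continuous_on_eq_continuous_at\<close>)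
    show "0 \<le> m k (pt p n t y)" if "-\<rho> \<le> y" "y \<le> \<rho>" for y
    proof -
      have "norm (pt p n t y - pt p n 0 0) \<le> \<bar>t - 0\<bar> + \<bar>y - 0\<bar>" by (rule norm_pt_diff[OF n])
      then have "dist (pt p n t y) p < 2 * r" using t that \<rho> by (simp add: dist_norm pt_def)
      then show ?thesis using pos q_nonneg by (simp add: m_def)
    qed
  qed (rule near)
  have Zr: "Z k (pt p n t \<rho>) = 0" if t: "\<bar>t\<bar> < \<rho>" for k t
  proof -
    have "\<bar>g t\<bar> \<le> 1/4 * \<bar>t\<bar>" using gb[of t] mult_right_mono[OF \<epsilon>, of "\<bar>t\<bar>"] t \<rho> by simp
    then have "pt p n t \<rho> \<notin> \<Omega>" using iff[of t \<rho>] t \<rho> by auto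
    then show ?thesis by (rule Z_outside)
  qed
  have bound: "\<bar>I k t\<bar> \<le> M * indicator {-\<rho><..<\<rho>} t" for k t
  proof (cases "\<bar>t\<bar> < \<rho>")
    case True
    have "\<bar>I k t\<bar> \<le> M * Z (real k) (pt p n t (-\<rho>))"
      using line[OF True, of k 0 M] M(2) Zr[OF True] by simp
    also have "\<dots> \<le> M * 1" using M(1) Z_bounds by (intro mult_left_mono) auto
    finally show ?thesis using True by (simp add: indicator_def abs_less_iff)
  qed (use I0 M(1) in auto)
  have lim: "(\<lambda>k. I k t) \<longlonglongrightarrow> f t" for t
  proof (cases "\<bar>t\<bar> < \<rho>")
    case False
    then show ?thesis using I0[of t] by (auto simp: f_def indicator_def abs_less_iff)
  next
    case t: True
    have g4: "\<bar>g t\<bar> \<le> 1/4 * \<bar>t\<bar>" using gb[of t] mult_right_mono[OF \<epsilon>, of "\<bar>t\<bar>"] t \<rho> by simp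
    have ft: "f t = \<Psi> (pt p n t (g t))" using t by (auto simp: f_def abs_less_iff)
    show ?thesis
      unfolding tendsto_iff
    proof (intro allI impI)
      fix e :: real assume e: "0 < e"
      have "isCont (\<lambda>y. \<Psi> (pt p n t y)) (g t)"
        by (rule isCont_o2[OF pt_cont]) (use \<Psi> in \<open>simp add: continuous_on_eq_continuous_at\<close>)
      then obtain \<delta> where \<delta>: "0 < \<delta>" "\<And>y. dist y (g t) < \<delta> \<Longrightarrow> dist (\<Psi> (pt p n t y)) (\<Psi> (pt p n t (g t))) < e / 2"
        using e unfolding continuous_at_eps_delta by (metis half_gt_zero)
      define \<delta>' where "\<delta>' = min \<delta> (\<rho> / 2)"
      have \<delta>': "0 < \<delta>'" "\<delta>' \<le> \<delta>" "\<delta>' \<le> \<rho> / 2" using \<delta>(1) \<rho> by (auto simp: \<delta>'_def)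
      \<comment> \<open>away from the boundary point the density vanishes for large \<open>k\<close>\<close>
      let ?K = "pt p n t ` {-\<rho>..g t - \<delta>'}"
      have "compact ?K"
        by (intro compact_continuous_image continuous_at_imp_continuous_on ballI pt_cont) auto
      moreover have "?K \<subseteq> \<Omega>" using iff[of t] t \<rho> \<delta>' g4 by (auto simp: abs_less_iff)
      ultimately have "\<forall>\<^sub>F k in sequentially. \<forall>x\<in>?K. q (real k) x = 0 \<and> Z (real k) x = 1"
        by (rule eventually_q_eq_0_on_compact)
      then show "\<forall>\<^sub>F k in sequentially. dist (I k t) (f t) < e"
      proof eventually_elim
        case (elim k)
        have "-\<rho> \<in> {-\<rho>..g t - \<delta>'}" using g4 t \<delta>' \<rho> by auto
        then have Z1: "Z (real k) (pt p n t (-\<rho>)) = 1" using elim by blast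
        have "\<bar>I k t - \<Psi> (pt p n t (g t)) * (Z (real k) (pt p n t (-\<rho>)) - Z (real k) (pt p n t \<rho>))\<bar>
            \<le> e / 2 * (Z (real k) (pt p n t (-\<rho>)) - Z (real k) (pt p n t \<rho>))"
        proof (rule line[OF t])
          fix y assume y: "-\<rho> \<le> y" "y \<le> \<rho>" "m k (pt p n t y) \<noteq> 0"
          have q: "q (real k) (pt p n t y) \<noteq> 0" using y(3) by (auto simp: m_def)
          then have "pt p n t y \<in> \<Omega>" using q_outside by blast
          then have "y < g t" using iff[of t y] t y \<rho> by auto
          moreover have "\<not> y \<le> g t - \<delta>'" using elim y(1) q by (metis atLeastAtMost_iff imageI)
          ultimately have "dist y (g t) < \<delta>" using \<delta>' by (simp add: dist_real_def)
          then show "\<bar>\<Psi> (pt p n t y) - \<Psi> (pt p n t (g t))\<bar> \<le> e / 2"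
            using \<delta>(2)[of y] by (simp add: dist_real_def)
        qed
        then have "\<bar>I k t - f t\<bar> \<le> e / 2" using Z1 Zr[OF t] ft by simp
        then show ?case using e by (simp add: dist_real_def)
      qed
    qed
  qed
  have f_meas: "f \<in> borel_measurable lborel" using I_meas lim by (rule borel_measurable_LIMSEQ_real[rotated])
  have dom: "integrable lborel (\<lambda>t. M * indicator {-\<rho><..<\<rho>} t)"
    using \<rho> by (intro integrable_mult_right integrable_real_indicator) auto
  have "(\<lambda>k. LINT t|lborel. I k t) \<longlonglongrightarrow> (LINT t|lborel. f t)"
    by (rule integral_dominated_convergence[where w="\<lambda>t. M * indicator {-\<rho><..<\<rho>} t"])
      (use f_meas I_meas dom lim bound in auto)
  then show "(\<lambda>k. LINT x|lborel. q (real k) x * (u x * (G x \<bullet> n)) * \<Psi> x)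
     \<longlonglongrightarrow> (LINT t|lborel. indicator {- (r / 2)<..<r / 2} t * \<Psi> (pt p n t (g t)))"
    using rot by (simp add: m_def f_def \<rho>_def)
  have "integrable lborel f"
  proof (rule Bochner_Integration.integrable_bound[OF dom f_meas])
    show "AE t in lborel. norm (f t) \<le> norm (M * indicator {-\<rho><..<\<rho>} t)"
      using M by (intro AE_I2) (auto simp: f_def indicator_def)
  qed
  then show "integrable lborel (\<lambda>t. indicator {- (r / 2)<..<r / 2} t * \<Psi> (pt p n t (g t)))"
    by (simp add: f_def[abs_def] \<rho>_def)
qed

end

section \<open>Arc length in a chart\<close>

text \<open>In a chart of slope at most \<open>\<epsilon>\<close>, arc length and the coordinate along the tangent agree up to the
  factor \<open>1 + \<epsilon>\<close>.\<close>
lemma hausdorff1_chart_integral: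
  fixes \<Omega> :: "(real^2) set"
  assumes ch: "boundary_chart \<Omega> p n \<epsilon> r g" and \<epsilon>: "0 \<le> \<epsilon>" "\<epsilon> \<le> 1/4" and \<Omega>: "open \<Omega>"
    and \<Psi>: "continuous_on UNIV \<Psi>" and supp: "\<And>x. r / 2 \<le> dist x p \<Longrightarrow> \<Psi> x = 0" and \<Psi>0: "\<And>x. 0 \<le> \<Psi> x"
    and int: "integrable lborel (\<lambda>t. indicator {- (r / 2)<..<r / 2} t * \<Psi> (pt p n t (g t)))"
  defines "J \<equiv> (LINT t|lborel. indicator {- (r / 2)<..<r / 2} t * \<Psi> (pt p n t (g t)))"
  shows "set_integrable hausdorff1 (frontier \<Omega>) \<Psi>"
    and "J \<le> (LINT x:frontier \<Omega>|hausdorff1. \<Psi> x)"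
    and "(LINT x:frontier \<Omega>|hausdorff1. \<Psi> x) \<le> (1 + \<epsilon>) * J"
proof -
  have n: "norm n = 1" and r: "0 < r"
    and gb: "\<And>t. \<bar>t\<bar> < r \<Longrightarrow> \<bar>g t\<bar> \<le> \<epsilon> * \<bar>t\<bar>"
    and lip: "\<And>s t. \<bar>s\<bar> < r \<Longrightarrow> \<bar>t\<bar> < r \<Longrightarrow> \<bar>g s - g t\<bar> \<le> \<epsilon> * \<bar>s - t\<bar>"
    using ch unfolding boundary_chart_def by auto
  define \<rho> where "\<rho> = r / 2"
  have \<rho>: "0 < \<rho>" "\<rho> < r" using r by (auto simp: \<rho>_def)
  let ?I = "{-\<rho><..<\<rho>}"
  define \<Gamma> where "\<Gamma> t = pt p n t (g t)" for t
  define \<pi> where "\<pi> x = (x - p) \<bullet> perp n" for x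
  define f where "f t = indicator ?I t * \<Psi> (\<Gamma> t)" for t
  have f0: "0 \<le> f t" for t using \<Psi>0 by (simp add: f_def)
  have f_int: "integrable lborel f" using int by (simp add: f_def[abs_def] \<Gamma>_def \<rho>_def)
  have tn: "norm (perp n) = 1" using n by (simp add: perp)
  have gr: "\<bar>g t\<bar> < \<rho>" if t: "\<bar>t\<bar> < \<rho>" for t
  proof -
    have "\<bar>g t\<bar> \<le> 1/4 * \<bar>t\<bar>" using gb[of t] mult_right_mono[OF \<epsilon>(2), of "\<bar>t\<bar>"] t \<rho> by simp
    then show ?thesis using t by linarith
  qed
  have \<pi>\<Gamma>: "\<pi> (\<Gamma> t) = t" for t unfolding \<pi>_def \<Gamma>_def by (rule pt_inner(1)[OF n])
  have \<Gamma>fr: "\<Gamma> t \<in> frontier \<Omega>" if "\<bar>t\<bar> < \<rho>" for t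
    using boundary_chart_frontier[OF ch \<Omega>, of t "g t"] that gr[OF that] \<rho> by (simp add: \<Gamma>_def)
  define A where "A = frontier \<Omega> \<inter> {x. \<bar>\<pi> x\<bar> < \<rho> \<and> \<bar>(x - p) \<bullet> n\<bar> < \<rho>}"
  have A_eq: "A = \<Gamma> ` ?I"
  proof
    show "\<Gamma> ` ?I \<subseteq> A"
      using \<Gamma>fr gr \<pi>\<Gamma> pt_inner(2)[OF n] by (auto simp: A_def \<Gamma>_def abs_less_iff)
    show "A \<subseteq> \<Gamma> ` ?I"
    proof
      fix x assume x: "x \<in> A"
      define t y where "t = (x - p) \<bullet> perp n" and "y = (x - p) \<bullet> n"
      have xp: "x = pt p n t y" unfolding t_def y_def by (rule pt_coordinates[OF n, symmetric])
      have ty: "\<bar>t\<bar> < \<rho>" "\<bar>y\<bar> < \<rho>" using x by (auto simp: A_def \<pi>_def t_def y_def)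
      then have "y = g t" using boundary_chart_frontier[OF ch \<Omega>, of t y] \<rho> x xp by (simp add: A_def)
      then show "x \<in> \<Gamma> ` ?I" using xp ty by (intro image_eqI[of _ _ t]) (auto simp: \<Gamma>_def)
    qed
  qed
  have \<pi>_cont: "continuous_on UNIV \<pi>" unfolding \<pi>_def by (intro continuous_intros)
  have \<pi>_meas[measurable]: "\<pi> \<in> borel_measurable borel" by (rule borel_measurable_continuous_onI[OF \<pi>_cont])
  have \<Psi>_meas[measurable]: "\<Psi> \<in> borel_measurable borel" by (rule borel_measurable_continuous_onI[OF \<Psi>])
  have f_meas[measurable]: "f \<in> borel_measurable borel" using f_int by auto
  have A_meas: "A \<in> sets borel"
  proof -
    have "open {x. \<bar>\<pi> x\<bar> < \<rho> \<and> \<bar>(x - p) \<bullet> n\<bar> < \<rho>}"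
      by (intro open_Collect_conj open_Collect_less continuous_intros \<pi>_cont)
    then show ?thesis unfolding A_def by (intro sets.Int borel_open borel_closed) auto
  qed
  \<comment> \<open>arc length and Lebesgue measure, both as measures of the tangential coordinate\<close>
  define \<nu> where "\<nu> = distr (density hausdorff1 (indicator A)) borel \<pi>"
  define \<mu> where "\<mu> = density lborel (indicator ?I :: real \<Rightarrow> ennreal)"
  have \<nu>_sets [simp]: "sets \<nu> = sets borel" "space \<nu> = UNIV" by (simp_all add: \<nu>_def)
  have \<mu>_sets [simp]: "sets \<mu> = sets borel" "space \<mu> = UNIV" by (simp_all add: \<mu>_def)
  have \<nu>_em: "emeasure \<nu> T = hausdorff1_outer (\<Gamma> ` (T \<inter> ?I))" if T: "T \<in> sets borel" for T
  proof -
    have PT: "\<pi> -` T \<in> sets borel" using measurable_sets[OF \<pi>_meas T] by simp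
    have "emeasure \<nu> T = emeasure (density hausdorff1 (indicator A)) (\<pi> -` T)"
      unfolding \<nu>_def using T by (subst emeasure_distr) (simp_all add: measurable_def space_hausdorff1 measurable_sets[OF \<pi>_meas, simplified])
    also have "\<dots> = emeasure hausdorff1 (A \<inter> \<pi> -` T)"
      using PT A_meas by (subst emeasure_density) (simp_all add: nn_integral_indicator indicator_inter_arith[symmetric])
    also have "A \<inter> \<pi> -` T = \<Gamma> ` (T \<inter> ?I)" unfolding A_eq using \<pi>\<Gamma> by auto
    also have "emeasure hausdorff1 (\<Gamma> ` (T \<inter> ?I)) = hausdorff1_outer (\<Gamma> ` (T \<inter> ?I))"
    proof (rule emeasure_hausdorff1)
      have "\<Gamma> ` (T \<inter> ?I) = A \<inter> \<pi> -` T" unfolding A_eq using \<pi>\<Gamma> by auto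
      then show "\<Gamma> ` (T \<inter> ?I) \<in> sets borel" using PT A_meas by simp
    qed
    finally show ?thesis .
  qed
  have \<mu>_em: "emeasure \<mu> T = emeasure lborel (T \<inter> ?I)" if T: "T \<in> sets borel" for T
    unfolding \<mu>_def using T by (subst emeasure_density) (simp_all add: nn_integral_indicator indicator_inter_arith[symmetric] Int_commute)
  have low: "emeasure \<mu> T \<le> emeasure \<nu> T" if T: "T \<in> sets borel" for T
    unfolding \<nu>_em[OF T] \<mu>_em[OF T]
  proof (rule hausdorff1_outer_projection[where \<pi>=\<pi>])
    fix x y
    have "\<pi> x - \<pi> y = (x - y) \<bullet> perp n" by (simp add: \<pi>_def inner_diff_left)
    then show "\<bar>\<pi> x - \<pi> y\<bar> \<le> dist x y" using Cauchy_Schwarz_ineq2[of "x - y" "perp n"] tn by (simp add: dist_norm)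
    show "T \<inter> ?I \<in> sets borel" using T by simp
    show "T \<inter> ?I \<subseteq> \<pi> ` (\<Gamma> ` (T \<inter> ?I))" using \<pi>\<Gamma> by (auto simp: image_image)
  qed
  have up: "emeasure \<nu> T \<le> ennreal (1 + \<epsilon>) * emeasure \<mu> T" if T: "T \<in> sets borel" for T
    unfolding \<nu>_em[OF T] \<mu>_em[OF T]
  proof (rule hausdorff1_outer_lipschitz_image[where \<alpha>="-\<rho>" and \<beta>=\<rho>])
    fix s t assume st: "s \<in> ?I" "t \<in> ?I"
    have "dist (\<Gamma> s) (\<Gamma> t) \<le> \<bar>s - t\<bar> + \<bar>g s - g t\<bar>" unfolding \<Gamma>_def dist_norm by (rule norm_pt_diff[OF n])
    also have "\<bar>g s - g t\<bar> \<le> \<epsilon> * \<bar>s - t\<bar>" using lip[of s t] st \<rho> by auto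
    finally show "dist (\<Gamma> s) (\<Gamma> t) \<le> (1 + \<epsilon>) * \<bar>s - t\<bar>" by (simp add: algebra_simps)
  qed (use T \<epsilon> in auto)
  have \<mu>\<nu>: "\<mu> \<le> \<nu>"
    unfolding le_measure_iff using low by (auto simp: le_fun_def emeasure_notin_sets intro: le_funI)
      (metis \<mu>_sets(1) \<nu>_sets(1) emeasure_notin_sets low order_refl)
  have \<nu>\<mu>: "\<nu> \<le> scale_measure (ennreal (1 + \<epsilon>)) \<mu>"
  proof -
    have "emeasure \<nu> T \<le> emeasure (scale_measure (ennreal (1 + \<epsilon>)) \<mu>) T" for T
      using up[of T] by (cases "T \<in> sets borel") (auto simp: emeasure_notin_sets)
    then show ?thesis unfolding le_measure_iff by (simp add: le_fun_def space_scale_measure)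
  qed
  let ?f = "\<lambda>t. ennreal (f t)"
  have nu_int: "(\<integral>\<^sup>+ x. indicator (frontier \<Omega>) x * ennreal (\<Psi> x) \<partial>hausdorff1) = (\<integral>\<^sup>+ t. ?f t \<partial>\<nu>)"
  proof -
    have "indicator (frontier \<Omega>) x * ennreal (\<Psi> x) = indicator A x * ?f (\<pi> x)" for x
    proof (cases "x \<in> A")
      case True
      then obtain t where t: "t \<in> ?I" "x = \<Gamma> t" using A_eq by auto
      then show ?thesis using True \<pi>\<Gamma> by (simp add: f_def A_def)
    next
      case False
      show ?thesis
      proof (cases "x \<in> frontier \<Omega>")
        case True
        have "\<rho> \<le> \<bar>\<pi> x\<bar> \<or> \<rho> \<le> \<bar>(x - p) \<bullet> n\<bar>" using False True by (auto simp: A_def)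
        then have "\<rho> \<le> dist x p"
          using Cauchy_Schwarz_ineq2[of "x - p" "perp n"] Cauchy_Schwarz_ineq2[of "x - p" n] n tn
          by (auto simp: dist_norm \<pi>_def)
        then show ?thesis using supp[of x] False by (simp add: \<rho>_def)
      qed (use False in simp)
    qed
    then have "(\<integral>\<^sup>+ x. indicator (frontier \<Omega>) x * ennreal (\<Psi> x) \<partial>hausdorff1) = (\<integral>\<^sup>+ x. indicator A x * ?f (\<pi> x) \<partial>hausdorff1)"
      by simp
    also have "\<dots> = (\<integral>\<^sup>+ x. ?f (\<pi> x) \<partial>density hausdorff1 (indicator A))"
      using A_meas by (subst nn_integral_density) auto
    also have "\<dots> = (\<integral>\<^sup>+ t. ?f t \<partial>\<nu>)"
      unfolding \<nu>_def by (subst nn_integral_distr) auto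
    finally show ?thesis .
  qed
  have mu_int: "(\<integral>\<^sup>+ t. ?f t \<partial>\<mu>) = ennreal J"
  proof -
    have "(\<integral>\<^sup>+ t. ?f t \<partial>\<mu>) = (\<integral>\<^sup>+ t. indicator ?I t * ?f t \<partial>lborel)"
      unfolding \<mu>_def by (subst nn_integral_density) auto
    also have "\<dots> = (\<integral>\<^sup>+ t. ?f t \<partial>lborel)"
      by (intro nn_integral_cong) (auto simp: f_def indicator_def)
    also have "\<dots> = ennreal (LINT t|lborel. f t)" using f_int f0 by (intro nn_integral_eq_integral) auto
    also have "(LINT t|lborel. f t) = J" by (simp add: J_def f_def \<Gamma>_def \<rho>_def)
    finally show ?thesis .
  qed
  have J0: "0 \<le> J" unfolding J_def using \<Psi>0 by (intro Bochner_Integration.integral_nonneg) auto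
  have le1: "ennreal J \<le> (\<integral>\<^sup>+ x. indicator (frontier \<Omega>) x * ennreal (\<Psi> x) \<partial>hausdorff1)"
    unfolding nu_int mu_int[symmetric] using \<mu>\<nu> by (intro nn_integral_mono_measure) auto
  have le2: "(\<integral>\<^sup>+ x. indicator (frontier \<Omega>) x * ennreal (\<Psi> x) \<partial>hausdorff1) \<le> ennreal ((1 + \<epsilon>) * J)"
  proof -
    have "(\<integral>\<^sup>+ t. ?f t \<partial>\<nu>) \<le> (\<integral>\<^sup>+ t. ?f t \<partial>scale_measure (ennreal (1 + \<epsilon>)) \<mu>)"
      using \<nu>\<mu> by (intro nn_integral_mono_measure) auto
    also have "\<dots> = ennreal (1 + \<epsilon>) * ennreal J"
      unfolding mu_int[symmetric]
    proof (rule nn_integral_scale_measure)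
      have "?f \<in> borel_measurable borel" by measurable
      moreover have "borel_measurable \<mu> = (borel_measurable borel :: (real \<Rightarrow> ennreal) set)"
        by (rule measurable_cong_sets) simp_all
      ultimately show "?f \<in> borel_measurable \<mu>" by blast
    qed
    finally show ?thesis using nu_int \<epsilon> J0 by (simp add: ennreal_mult)
  qed
  let ?h = "\<lambda>x. indicator (frontier \<Omega>) x *\<^sub>R \<Psi> x"
  have h_meas: "?h \<in> borel_measurable hausdorff1"
  proof -
    have "frontier \<Omega> \<in> sets borel" by (intro borel_closed) auto
    then have "?h \<in> borel_measurable borel" by measurable
    moreover have "borel_measurable hausdorff1 = (borel_measurable borel :: (real^2 \<Rightarrow> real) set)"
      by (rule measurable_cong_sets) simp_all
    ultimately show ?thesis by blast
  qed
  have h_nn: "(\<integral>\<^sup>+ x. ennreal (?h x) \<partial>hausdorff1) = (\<integral>\<^sup>+ x. indicator (frontier \<Omega>) x * ennreal (\<Psi> x) \<partial>hausdorff1)"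
    by (intro nn_integral_cong) (auto simp: indicator_def)
  have h0: "0 \<le> ?h x" for x using \<Psi>0 by simp
  have fin: "(\<integral>\<^sup>+ x. ennreal (?h x) \<partial>hausdorff1) < \<infinity>"
    using le2 unfolding h_nn by (rule order_le_less_trans) simp
  have hi: "integrable hausdorff1 ?h"
    using h_meas fin h0 by (intro integrableI_nonneg) auto
  then show "set_integrable hausdorff1 (frontier \<Omega>) \<Psi>" by (simp add: set_integrable_def)
  have I: "(\<integral>\<^sup>+ x. ennreal (?h x) \<partial>hausdorff1) = ennreal (LINT x:frontier \<Omega>|hausdorff1. \<Psi> x)"
    unfolding set_lebesgue_integral_def using hi h0 by (intro nn_integral_eq_integral) auto
  have I0: "0 \<le> (LINT x:frontier \<Omega>|hausdorff1. \<Psi> x)"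
    unfolding set_lebesgue_integral_def using h0 by (intro Bochner_Integration.integral_nonneg) auto
  show "J \<le> (LINT x:frontier \<Omega>|hausdorff1. \<Psi> x)" using le1 I I0 J0 unfolding h_nn by simp
  show "(LINT x:frontier \<Omega>|hausdorff1. \<Psi> x) \<le> (1 + \<epsilon>) * J" using le2 I \<epsilon> J0 unfolding h_nn by simp
qed

section \<open>Boundary integrals as limits of area integrals\<close>

context free_boundary
begin

definition flux :: "(real^2 \<Rightarrow> real) \<Rightarrow> nat \<Rightarrow> real" where
  "flux \<Psi> k = (LINT x|lborel. q (real k) x * \<Psi> x)"

definition length_integral :: "(real^2 \<Rightarrow> real) \<Rightarrow> real" where
  "length_integral \<Psi> = (LINT x:frontier \<Omega>|hausdorff1. \<Psi> x)"

text \<open>The flux converges to the boundary integral up to the relative error \<open>4 \<epsilon>\<close>. This weaker statement is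
  local and additive in \<open>\<Psi>\<close>, so it passes from charts to the whole boundary.\<close>
definition nearly :: "real \<Rightarrow> (real^2 \<Rightarrow> real) \<Rightarrow> bool" where
  "nearly \<epsilon> \<Psi> \<longleftrightarrow> set_integrable hausdorff1 (frontier \<Omega>) \<Psi> \<and>
     (\<forall>\<eta>>0. \<forall>\<^sub>F k in sequentially. (1 - 4 * \<epsilon>) * length_integral \<Psi> - \<eta> \<le> flux \<Psi> k
        \<and> flux \<Psi> k \<le> (1 + 4 * \<epsilon>) * length_integral \<Psi> + \<eta>)"

lemma flux_integrable:
  assumes "continuous_on UNIV \<Psi>" "\<And>x. R < norm x \<Longrightarrow> \<Psi> x = 0"
  shows "integrable lborel (\<lambda>x. q (real k) x * \<Psi> x)"
  by (rule compactly_supported_integrable[of _ R]) (use assms in \<open>auto intro!: continuous_intros q_continuous\<close>)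

text \<open>In a chart of slope at most \<open>\<epsilon>\<close> both sides are compared with the integral \<open>J\<close> of \<open>\<Psi>\<close> over the tangential
  coordinate: \<open>local_limit\<close> evaluates the flux of the field \<open>n\<close>, which differs from \<open>q k\<close> by the factor
  \<open>u G \<bullet> n\<close> between \<open>1 - \<epsilon>\<close> and \<open>1 + \<epsilon>\<close>, and \<open>hausdorff1_chart_integral\<close> compares \<open>J\<close> with arc length.\<close>
lemma nearly_boundary:
  assumes p: "p \<in> frontier \<Omega>" and \<epsilon>: "0 < \<epsilon>" "\<epsilon> \<le> 1/4"
  shows "\<exists>R>0. \<forall>\<Psi>. continuous_on UNIV \<Psi> \<longrightarrow> (\<forall>x. 0 \<le> \<Psi> x) \<longrightarrow> (\<forall>x. R \<le> dist x p \<longrightarrow> \<Psi> x = 0) \<longrightarrow> nearly \<epsilon> \<Psi>"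
proof -
  define n where "n = outward_normal \<Omega> p"
  have n_eq: "n = u p *\<^sub>R G p" unfolding n_def by (rule outward_normal_G[OF p])
  define s where "s x = u x * (G x \<bullet> n)" for x
  have s_cont: "continuous_on UNIV s" unfolding s_def by (intro continuous_intros cont G_continuous)
  have "u p * u p = 1" using frontier_value[OF p] by auto
  then have sp: "s p = 1" using norm_G_frontier[OF p] by (simp add: s_def n_eq)
  obtain \<delta> where \<delta>: "0 < \<delta>" "\<And>x. dist x p < \<delta> \<Longrightarrow> dist (s x) (s p) < \<epsilon>"
    using s_cont \<epsilon>(1) unfolding continuous_on_eq_continuous_at[OF open_UNIV] continuous_at_eps_delta by (metis UNIV_I)
  have s1: "\<bar>s x - 1\<bar> < \<epsilon>" if "dist x p < \<delta>" for x using \<delta>(2)[OF that] sp by (simp add: dist_real_def)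
  obtain r g g' where ch: "boundary_chart \<Omega> p n \<epsilon> r g" and r\<delta>: "r \<le> \<delta> / 2"
    by (rule chart[OF p \<epsilon>, of "\<delta> / 2", folded n_def]) (use \<delta>(1) in simp, rule that)
  have r: "0 < r" using ch unfolding boundary_chart_def by simp
  show ?thesis
  proof (intro exI[of _ "r / 2"] conjI allI impI)
    show "0 < r / 2" using r by simp
    fix \<Psi> :: "real^2 \<Rightarrow> real"
    assume \<Psi>: "continuous_on UNIV \<Psi>" and \<Psi>0: "\<forall>x. 0 \<le> \<Psi> x" and supp: "\<forall>x. r / 2 \<le> dist x p \<longrightarrow> \<Psi> x = 0"
    have suppR: "\<Psi> x = 0" if "norm p + r / 2 < norm x" for x
      using supp norm_triangle_ineq2[of x p] that by (simp add: dist_norm)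
    define A where "A k = (LINT x|lborel. q (real k) x * s x * \<Psi> x)" for k
    define J where "J = (LINT t|lborel. indicator {- (r / 2)<..<r / 2} t * \<Psi> (pt p n t (g t)))"
    define I where "I = length_integral \<Psi>"
    have pos: "0 \<le> u x * (G x \<bullet> n)" if "dist x p < 2 * r" for x
    proof -
      have "dist x p < \<delta>" using that r\<delta> by linarith
      then have "\<bar>s x - 1\<bar> < \<epsilon>" by (rule s1)
      then have "0 \<le> s x" using \<epsilon> by linarith
      then show ?thesis by (simp add: s_def)
    qed
    have A_lim: "A \<longlonglongrightarrow> J" and J_int: "integrable lborel (\<lambda>t. indicator {- (r / 2)<..<r / 2} t * \<Psi> (pt p n t (g t)))"
      using local_limit[OF ch \<epsilon>(2) pos \<Psi>] supp by (auto simp: A_def[abs_def] s_def J_def)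
    have H: "set_integrable hausdorff1 (frontier \<Omega>) \<Psi>" "J \<le> I" "I \<le> (1 + \<epsilon>) * J"
      unfolding I_def J_def length_integral_def
      by (rule hausdorff1_chart_integral[OF ch _ \<epsilon>(2) open_Omega \<Psi> _ _ J_int]; use \<epsilon> supp \<Psi>0 in simp)+
    have int1: "integrable lborel (\<lambda>x. q (real k) x * \<Psi> x)" for k by (rule flux_integrable[OF \<Psi> suppR])
    have int2: "integrable lborel (\<lambda>x. q (real k) x * s x * \<Psi> x)" for k
      by (rule compactly_supported_integrable[of _ "norm p + r / 2"])
        (use suppR \<Psi> in \<open>auto intro!: continuous_intros q_continuous s_cont\<close>)
    have ptw: "(1 - \<epsilon>) * (q (real k) x * \<Psi> x) \<le> q (real k) x * s x * \<Psi> x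
        \<and> q (real k) x * s x * \<Psi> x \<le> (1 + \<epsilon>) * (q (real k) x * \<Psi> x)" for k x
    proof (cases "r / 2 \<le> dist x p")
      case False
      then have "\<bar>s x - 1\<bar> < \<epsilon>" using r r\<delta> by (intro s1) simp
      then have "1 - \<epsilon> \<le> s x" "s x \<le> 1 + \<epsilon>" by (auto simp: abs_less_iff)
      moreover have "0 \<le> q (real k) x * \<Psi> x" using q_nonneg \<Psi>0 by simp
      ultimately have "(1 - \<epsilon>) * (q (real k) x * \<Psi> x) \<le> s x * (q (real k) x * \<Psi> x)"
        "s x * (q (real k) x * \<Psi> x) \<le> (1 + \<epsilon>) * (q (real k) x * \<Psi> x)" by (auto intro: mult_right_mono)
      then show ?thesis by (simp add: mult_ac)
    qed (use supp in simp)
    have AB: "(1 - \<epsilon>) * flux \<Psi> k \<le> A k" "A k \<le> (1 + \<epsilon>) * flux \<Psi> k" for k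
    proof -
      have "(LINT x|lborel. (1 - \<epsilon>) * (q (real k) x * \<Psi> x)) \<le> A k"
        unfolding A_def using int1 int2 ptw by (intro integral_mono) auto
      then show "(1 - \<epsilon>) * flux \<Psi> k \<le> A k" by (simp add: flux_def)
      have "A k \<le> (LINT x|lborel. (1 + \<epsilon>) * (q (real k) x * \<Psi> x))"
        unfolding A_def using int1 int2 ptw by (intro integral_mono) auto
      then show "A k \<le> (1 + \<epsilon>) * flux \<Psi> k" by (simp add: flux_def)
    qed
    have I0: "0 \<le> I" unfolding I_def length_integral_def set_lebesgue_integral_def
      using \<Psi>0 by (intro Bochner_Integration.integral_nonneg) auto
    define X Y where "X = \<epsilon> * I" and "Y = \<epsilon> * (\<epsilon> * I)"
    have XY: "0 \<le> X" "0 \<le> Y" "Y \<le> X / 4"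
      unfolding X_def Y_def using I0 \<epsilon> mult_right_mono[OF \<epsilon>(2), of "\<epsilon> * I"] by auto
    have Jlow: "I - X \<le> J"
    proof -
      have "\<epsilon> * J \<le> \<epsilon> * I" using H(2) \<epsilon> by (intro mult_left_mono) auto
      then show ?thesis using H(3) by (simp add: X_def algebra_simps)
    qed
    show "nearly \<epsilon> \<Psi>"
      unfolding nearly_def I_def[symmetric]
    proof (intro conjI allI impI H(1))
      fix \<eta> :: real assume \<eta>: "0 < \<eta>"
      have "\<forall>\<^sub>F k in sequentially. dist (A k) J < \<eta> / 2" using A_lim \<eta> by (intro tendstoD) auto
      then show "\<forall>\<^sub>F k in sequentially. (1 - 4 * \<epsilon>) * I - \<eta> \<le> flux \<Psi> k \<and> flux \<Psi> k \<le> (1 + 4 * \<epsilon>) * I + \<eta>"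
      proof eventually_elim
        case (elim k)
        then have AJ: "J - \<eta> / 2 < A k" "A k < J + \<eta> / 2" unfolding dist_real_def by linarith+
        define W where "W = \<epsilon> * \<eta>"
        have W: "0 \<le> W" "W \<le> \<eta> / 4" unfolding W_def using \<epsilon> \<eta> by auto
        have "(1 - \<epsilon>) * flux \<Psi> k \<le> (1 - \<epsilon>) * ((1 + 4 * \<epsilon>) * I + \<eta>)"
        proof -
          have eq: "(1 - \<epsilon>) * ((1 + 4 * \<epsilon>) * I + \<eta>) = I + 3 * X - 4 * Y + \<eta> - W"
            by (simp add: X_def Y_def W_def algebra_simps)
          have "(1 - \<epsilon>) * flux \<Psi> k \<le> J + \<eta> / 2" using AB(1)[of k] AJ(2) by (meson less_imp_le order_trans)
          also have "\<dots> \<le> I + 3 * X - 4 * Y + \<eta> - W" using H(2) XY W \<eta> by linarith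
          finally show ?thesis unfolding eq .
        qed
        then have "flux \<Psi> k \<le> (1 + 4 * \<epsilon>) * I + \<eta>" using \<epsilon> by simp
        moreover have "(1 + \<epsilon>) * ((1 - 4 * \<epsilon>) * I - \<eta>) \<le> (1 + \<epsilon>) * flux \<Psi> k"
        proof -
          have eq: "(1 + \<epsilon>) * ((1 - 4 * \<epsilon>) * I - \<eta>) = I - 3 * X - 4 * Y - \<eta> - W"
            by (simp add: X_def Y_def W_def algebra_simps)
          have "I - 3 * X - 4 * Y - \<eta> - W \<le> J - \<eta> / 2" using Jlow XY W \<eta> by linarith
          also have "\<dots> \<le> (1 + \<epsilon>) * flux \<Psi> k" using AB(2)[of k] AJ(1) by (meson less_imp_le order_trans)
          finally show ?thesis unfolding eq .
        qed
        then have "(1 - 4 * \<epsilon>) * I - \<eta> \<le> flux \<Psi> k" using \<epsilon> by simp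
        ultimately show ?case by simp
      qed
    qed
  qed
qed

lemma nearly_zero:
  assumes "\<And>x. x \<in> frontier \<Omega> \<Longrightarrow> \<Psi> x = 0" "\<forall>\<^sub>F k in sequentially. flux \<Psi> k = 0"
  shows "nearly \<epsilon> \<Psi>"
proof -
  have 0: "(\<lambda>x. indicator (frontier \<Omega>) x *\<^sub>R \<Psi> x) = (\<lambda>x. 0)"
    using assms(1) by (auto simp: fun_eq_iff indicator_def)
  have I: "set_integrable hausdorff1 (frontier \<Omega>) \<Psi>" "length_integral \<Psi> = 0"
    unfolding set_integrable_def length_integral_def set_lebesgue_integral_def 0 by simp_all
  show ?thesis unfolding nearly_def I(2)
  proof (intro conjI allI impI I(1))
    fix \<eta> :: real assume \<eta>: "0 < \<eta>"
    from assms(2) show "\<forall>\<^sub>F k in sequentially. (1 - 4 * \<epsilon>) * 0 - \<eta> \<le> flux \<Psi> k \<and> flux \<Psi> k \<le> (1 + 4 * \<epsilon>) * 0 + \<eta>"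
      by eventually_elim (use \<eta> in simp)
  qed
qed

lemma nearly_away:
  assumes p: "p \<notin> frontier \<Omega>"
  shows "\<exists>R>0. \<forall>\<Psi>. (\<forall>x. R \<le> dist x p \<longrightarrow> \<Psi> x = 0) \<longrightarrow> nearly \<epsilon> \<Psi>"
proof (cases "p \<in> \<Omega>")
  case True
  obtain R where R: "0 < R" "cball p R \<subseteq> \<Omega>" using open_Omega True open_contains_cball by metis
  show ?thesis
  proof (intro exI[of _ R] conjI allI impI R(1) nearly_zero)
    fix \<Psi> :: "real^2 \<Rightarrow> real" assume supp: "\<forall>x. R \<le> dist x p \<longrightarrow> \<Psi> x = 0"
    show "\<Psi> x = 0" if "x \<in> frontier \<Omega>" for x
    proof -
      have "x \<notin> \<Omega>" using that open_Omega by (auto simp: frontier_def interior_open)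
      then have "x \<notin> cball p R" using R by blast
      then show ?thesis using supp by (simp add: dist_commute)
    qed
    have "\<forall>\<^sub>F k in sequentially. \<forall>x\<in>cball p R. q (real k) x = 0 \<and> Z (real k) x = 1"
      using R by (intro eventually_q_eq_0_on_compact) auto
    then show "\<forall>\<^sub>F k in sequentially. flux \<Psi> k = 0"
    proof eventually_elim
      case (elim k)
      have "q (real k) x * \<Psi> x = 0" for x
        using elim supp by (cases "x \<in> cball p R") (auto simp: dist_commute)
      then have 0: "(\<lambda>x. q (real k) x * \<Psi> x) = (\<lambda>x. 0)" by (rule ext)
      show ?case unfolding flux_def 0 by simp
    qed
  qed
next
  case False
  then have "p \<notin> closure \<Omega>" using p open_Omega by (auto simp: frontier_def interior_open)
  then obtain R where R: "0 < R" "ball p R \<subseteq> - closure \<Omega>"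
    using open_contains_ball[of "- closure \<Omega>"] by auto
  show ?thesis
  proof (intro exI[of _ R] conjI allI impI R(1) nearly_zero)
    fix \<Psi> :: "real^2 \<Rightarrow> real" assume supp: "\<forall>x. R \<le> dist x p \<longrightarrow> \<Psi> x = 0"
    have out: "\<Psi> x = 0" if "x \<in> closure \<Omega>" for x
    proof -
      have "x \<notin> ball p R" using R that by blast
      then show ?thesis using supp by (simp add: dist_commute)
    qed
    show "\<Psi> x = 0" if "x \<in> frontier \<Omega>" for x using that by (intro out) (simp add: frontier_def)
    have "q (real k) x * \<Psi> x = 0" for k x
      using out[of x] q_outside[of x] closure_subset[of \<Omega>] by (cases "x \<in> \<Omega>") auto
    then have 0: "(\<lambda>x. q (real k) x * \<Psi> x) = (\<lambda>x. 0)" for k by (intro ext)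
    show "\<forall>\<^sub>F k in sequentially. flux \<Psi> k = 0" unfolding flux_def 0 by simp
  qed
qed

lemma nearly_add:
  assumes 1: "nearly \<epsilon> \<Psi>1" "\<And>k. integrable lborel (\<lambda>x. q (real k) x * \<Psi>1 x)"
    and 2: "nearly \<epsilon> \<Psi>2" "\<And>k. integrable lborel (\<lambda>x. q (real k) x * \<Psi>2 x)"
  shows "nearly \<epsilon> (\<lambda>x. \<Psi>1 x + \<Psi>2 x)"
proof -
  have i: "set_integrable hausdorff1 (frontier \<Omega>) \<Psi>1" "set_integrable hausdorff1 (frontier \<Omega>) \<Psi>2"
    using 1 2 by (auto simp: nearly_def)
  have L: "length_integral (\<lambda>x. \<Psi>1 x + \<Psi>2 x) = length_integral \<Psi>1 + length_integral \<Psi>2"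
    unfolding length_integral_def by (rule set_integral_add(2)[OF i])
  have F: "flux (\<lambda>x. \<Psi>1 x + \<Psi>2 x) k = flux \<Psi>1 k + flux \<Psi>2 k" for k
    using 1(2)[of k] 2(2)[of k] by (simp add: flux_def distrib_left)
  show ?thesis unfolding nearly_def L F
  proof (intro conjI allI impI set_integral_add(1)[OF i])
    fix \<eta> :: real assume "0 < \<eta>"
    then have \<eta>: "0 < \<eta> / 2" by simp
    have "\<forall>\<^sub>F k in sequentially. (1 - 4 * \<epsilon>) * length_integral \<Psi>1 - \<eta>/2 \<le> flux \<Psi>1 k
        \<and> flux \<Psi>1 k \<le> (1 + 4 * \<epsilon>) * length_integral \<Psi>1 + \<eta>/2"
      "\<forall>\<^sub>F k in sequentially. (1 - 4 * \<epsilon>) * length_integral \<Psi>2 - \<eta>/2 \<le> flux \<Psi>2 k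
        \<and> flux \<Psi>2 k \<le> (1 + 4 * \<epsilon>) * length_integral \<Psi>2 + \<eta>/2"
      using 1(1) 2(1) \<eta> unfolding nearly_def by blast+
    then show "\<forall>\<^sub>F k in sequentially. (1 - 4 * \<epsilon>) * (length_integral \<Psi>1 + length_integral \<Psi>2) - \<eta> \<le> flux \<Psi>1 k + flux \<Psi>2 k \<and>
        flux \<Psi>1 k + flux \<Psi>2 k \<le> (1 + 4 * \<epsilon>) * (length_integral \<Psi>1 + length_integral \<Psi>2) + \<eta>"
      by eventually_elim (simp add: distrib_left)
  qed
qed

lemma nearly_sum:
  assumes "finite C" "\<And>i. i \<in> C \<Longrightarrow> nearly \<epsilon> (\<Psi> i)"
    "\<And>i k. i \<in> C \<Longrightarrow> integrable lborel (\<lambda>x. q (real k) x * \<Psi> i x)"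
  shows "nearly \<epsilon> (\<lambda>x. \<Sum>i\<in>C. \<Psi> i x)"
  using assms
proof (induction C rule: finite_induct)
  case empty
  show ?case by (rule nearly_zero) (simp_all add: flux_def)
next
  case (insert i C)
  have "nearly \<epsilon> (\<lambda>x. \<Psi> i x + (\<Sum>i\<in>C. \<Psi> i x))"
    using insert by (intro nearly_add) (auto simp: sum_distrib_left)
  then show ?case using insert(1,2) by simp
qed

text \<open>A finite cover of the support by balls on which the local statement holds, with a continuous
  partition of unity subordinate to it.\<close>
lemma nearly_nonneg:
  assumes \<Psi>: "continuous_on UNIV \<Psi>" and \<Psi>0: "\<And>x. 0 \<le> \<Psi> x" and supp: "\<And>x. R < norm x \<Longrightarrow> \<Psi> x = 0"
    and \<epsilon>: "0 < \<epsilon>" "\<epsilon> \<le> 1/4"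
  shows "nearly \<epsilon> \<Psi>"
proof -
  define K where "K = cball (0::real^2) \<bar>R\<bar>"
  have supp': "\<Psi> x = 0" if "x \<notin> K" for x using that by (intro supp) (auto simp: K_def)
  have "\<forall>p. \<exists>r>0. \<forall>\<Psi>. continuous_on UNIV \<Psi> \<longrightarrow> (\<forall>x. 0 \<le> \<Psi> x) \<longrightarrow> (\<forall>x. r \<le> dist x p \<longrightarrow> \<Psi> x = 0) \<longrightarrow> nearly \<epsilon> \<Psi>"
    using nearly_boundary[OF _ \<epsilon>] nearly_away by metis
  then obtain r where r: "\<And>p. 0 < r p"
    and near: "\<And>p \<Psi>. continuous_on UNIV \<Psi> \<Longrightarrow> (\<And>x. 0 \<le> \<Psi> x) \<Longrightarrow> (\<And>x. r p \<le> dist x p \<Longrightarrow> \<Psi> x = 0) \<Longrightarrow> nearly \<epsilon> \<Psi>"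
    by metis
  have "compact K" by (simp add: K_def)
  moreover have "K \<subseteq> (\<Union>p\<in>K. ball p (r p))" using r by auto
  ultimately obtain C where C: "C \<subseteq> K" "finite C" "K \<subseteq> (\<Union>p\<in>C. ball p (r p))"
    using compactE_image[of K K "\<lambda>p. ball p (r p)"] by (metis open_ball)
  define b where "b p x = max 0 (r p - dist x p)" for p x :: "real^2"
  define S where "S x = (\<Sum>p\<in>C. b p x)" for x
  have b_cont: "continuous_on UNIV (b p)" for p unfolding b_def by (intro continuous_intros)
  have S_cont: "continuous_on UNIV S" unfolding S_def by (intro continuous_intros b_cont)
  have b0: "0 \<le> b p x" for p x by (simp add: b_def)
  have S_pos: "0 < S x" if x: "x \<in> K" for x
  proof -
    obtain p where p: "p \<in> C" "x \<in> ball p (r p)" using C(3) x by blast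
    then have "0 < b p x" by (simp add: b_def dist_commute)
    also have "\<dots> \<le> S x" unfolding S_def using p C(2) b0 by (intro member_le_sum) auto
    finally show ?thesis .
  qed
  have "K \<noteq> {}" by (simp add: K_def)
  then obtain x0 where x0: "x0 \<in> K" "\<And>x. x \<in> K \<Longrightarrow> S x0 \<le> S x"
    using continuous_attains_inf[OF \<open>compact K\<close> _ continuous_on_subset[OF S_cont subset_UNIV]] by metis
  \<comment> \<open>\<open>T\<close> agrees with \<open>S\<close> on \<open>K\<close> and is bounded away from 0, so the quotients are continuous everywhere\<close>
  define T where "T x = max (S x0) (S x)" for x
  have T: "0 < T x" for x using S_pos[OF x0(1)] by (auto simp: T_def)
  have T_cont: "continuous_on UNIV T" unfolding T_def by (intro continuous_intros S_cont)
  define \<Psi>' where "\<Psi>' p x = \<Psi> x * b p x / T x" for p x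
  have \<Psi>'_cont: "continuous_on UNIV (\<Psi>' p)" for p
  proof -
    have "\<forall>x\<in>UNIV. T x \<noteq> 0" using T by (metis less_irrefl)
    then show ?thesis unfolding \<Psi>'_def by (intro continuous_intros \<Psi> b_cont T_cont) auto
  qed
  have sum: "(\<Sum>p\<in>C. \<Psi>' p x) = \<Psi> x" for x
  proof (cases "x \<in> K")
    case True
    then have "T x = S x" using x0(2) by (simp add: T_def)
    moreover have "(\<Sum>p\<in>C. \<Psi>' p x) = \<Psi> x * S x / T x"
      by (simp add: \<Psi>'_def S_def sum_distrib_left sum_divide_distrib)
    ultimately show ?thesis using S_pos[OF True] by simp
  qed (simp add: \<Psi>'_def supp')
  have "nearly \<epsilon> (\<lambda>x. \<Sum>p\<in>C. \<Psi>' p x)"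
  proof (rule nearly_sum[OF C(2)])
    show "nearly \<epsilon> (\<Psi>' p)" for p
    proof (rule near[OF \<Psi>'_cont])
      show "0 \<le> \<Psi>' p x" for x using \<Psi>0 b0 T[of x] by (simp add: \<Psi>'_def)
      show "\<Psi>' p x = 0" if "r p \<le> dist x p" for x using that by (simp add: \<Psi>'_def b_def)
    qed
    show "integrable lborel (\<lambda>x. q (real k) x * \<Psi>' p x)" for p k
      by (rule flux_integrable[OF \<Psi>'_cont, of R]) (simp add: \<Psi>'_def supp)
  qed
  then show ?thesis by (simp add: sum)
qed

lemma weak_limit_nonneg:
  assumes \<Psi>: "continuous_on UNIV \<Psi>" and \<Psi>0: "\<And>x. 0 \<le> \<Psi> x" and supp: "\<And>x. R < norm x \<Longrightarrow> \<Psi> x = 0"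
  shows "set_integrable hausdorff1 (frontier \<Omega>) \<Psi>" "flux \<Psi> \<longlonglongrightarrow> length_integral \<Psi>"
proof -
  have near: "nearly \<epsilon> \<Psi>" if "0 < \<epsilon>" "\<epsilon> \<le> 1/4" for \<epsilon> by (rule nearly_nonneg[OF \<Psi> \<Psi>0 supp that])
  from near[of "1/4"] show "set_integrable hausdorff1 (frontier \<Omega>) \<Psi>" by (simp add: nearly_def)
  define I where "I = length_integral \<Psi>"
  have I0: "0 \<le> I" unfolding I_def length_integral_def set_lebesgue_integral_def
    using \<Psi>0 by (intro Bochner_Integration.integral_nonneg) auto
  show "flux \<Psi> \<longlonglongrightarrow> length_integral \<Psi>"
    unfolding tendsto_iff
  proof (intro allI impI)
    fix e :: real assume e: "0 < e"
    define \<epsilon> where "\<epsilon> = min (1/4) (e / (8 * (I + 1)))"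
    have \<epsilon>: "0 < \<epsilon>" using e I0 by (auto simp: \<epsilon>_def)
    have "\<epsilon> \<le> 1/4" unfolding \<epsilon>_def by (rule min.cobounded1)
    note \<epsilon> = \<epsilon> this
    have "\<epsilon> * I \<le> \<epsilon> * (I + 1)" using \<epsilon> by simp
    also have "\<dots> \<le> e / (8 * (I + 1)) * (I + 1)" using I0 by (intro mult_right_mono) (auto simp: \<epsilon>_def)
    also have "\<dots> = e / 8" using I0 by (simp add: field_simps)
    finally have small: "4 * (\<epsilon> * I) \<le> e / 2" by simp
    have "\<forall>\<^sub>F k in sequentially. (1 - 4 * \<epsilon>) * I - e / 4 \<le> flux \<Psi> k \<and> flux \<Psi> k \<le> (1 + 4 * \<epsilon>) * I + e / 4"
      using near[OF \<epsilon>] e unfolding nearly_def I_def by simp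
    then show "\<forall>\<^sub>F k in sequentially. dist (flux \<Psi> k) (length_integral \<Psi>) < e"
    proof eventually_elim
      case (elim k)
      define X where "X = \<epsilon> * I"
      have "I - 4 * X - e / 4 \<le> flux \<Psi> k" "flux \<Psi> k \<le> I + 4 * X + e / 4"
        using elim by (simp_all add: X_def algebra_simps)
      moreover have "4 * X \<le> e / 2" using small by (simp add: X_def)
      ultimately have "\<bar>flux \<Psi> k - I\<bar> < e" using e by (simp add: abs_less_iff)
      then show ?case by (simp add: dist_real_def I_def)
    qed
  qed
qed

lemma weak_limit:
  assumes \<Psi>: "continuous_on UNIV \<Psi>" and supp: "\<And>x. R < norm x \<Longrightarrow> \<Psi> x = 0"
  shows "flux \<Psi> \<longlonglongrightarrow> length_integral \<Psi>"
proof -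
  define P N where "P x = max 0 (\<Psi> x)" and "N x = max 0 (- \<Psi> x)" for x
  have c: "continuous_on UNIV P" "continuous_on UNIV N" unfolding P_def N_def by (intro continuous_intros \<Psi>)+
  have s: "P x = 0" "N x = 0" if "R < norm x" for x using supp[OF that] by (simp_all add: P_def N_def)
  have nn: "0 \<le> P x" "0 \<le> N x" for x by (simp_all add: P_def N_def)
  have d: "\<Psi> x = P x - N x" for x by (simp add: P_def N_def)
  have fl: "flux \<Psi> k = flux P k - flux N k" for k
    using flux_integrable[of P R k, OF c(1) s(1)] flux_integrable[of N R k, OF c(2) s(2)]
    by (simp add: flux_def d right_diff_distrib)
  have "flux \<Psi> = (\<lambda>k. flux P k - flux N k)" using fl by (rule ext)
  moreover have "length_integral \<Psi> = length_integral P - length_integral N"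
    unfolding length_integral_def d
    by (rule set_integral_diff(2)[OF weak_limit_nonneg(1)[OF c(1) nn(1) s(1)] weak_limit_nonneg(1)[OF c(2) nn(2) s(2)]])
  moreover have "(\<lambda>k. flux P k - flux N k) \<longlonglongrightarrow> length_integral P - length_integral N"
    by (intro tendsto_diff weak_limit_nonneg(2)[OF c(1) nn(1) s(1)] weak_limit_nonneg(2)[OF c(2) nn(2) s(2)])
  ultimately show ?thesis by simp
qed

section \<open>Vanishing of the Hessian\<close>

text \<open>The third derivatives of \<open>u\<close>; by the Cauchy-Riemann equations for the derivative of \<open>f\<close> there are only
  two different ones up to sign.\<close>
definition third1 :: "real^2 \<Rightarrow> real" where "third1 x = Re (deriv (deriv f) (cvec x))"
definition third2 :: "real^2 \<Rightarrow> real" where "third2 x = - Im (deriv (deriv f) (cvec x))"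

lemma second_derivatives_derivative:
  assumes "x \<in> \<Omega>"
  shows "(c has_derivative (\<lambda>h. third1 x * h $ 1 + third2 x * h $ 2)) (at x)"
    and "(d has_derivative (\<lambda>h. third2 x * h $ 1 - third1 x * h $ 2)) (at x)"
proof -
  have z: "cvec x \<in> rvec -` \<Omega>" using assms by simp
  define P where "P = deriv (deriv f) (cvec x)"
  have "deriv f holomorphic_on rvec -` \<Omega>"
    using f_holomorphic open_rvec_Omega by (rule holomorphic_deriv)
  then have "(deriv f has_field_derivative P) (at (cvec x))"
    unfolding P_def using open_rvec_Omega z by (rule holomorphic_derivI)
  then have 1: "(deriv f has_derivative (*) P) (at (cvec x))" by (simp add: has_field_derivative_def)
  have "(cvec has_derivative cvec) (at x)"
    using bounded_linear_cvec by (rule bounded_linear_imp_has_derivative)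
  from has_derivative_compose[OF this 1]
  have 2: "((\<lambda>x. deriv f (cvec x)) has_derivative (\<lambda>h. P * cvec h)) (at x)" .
  have eq: "deriv f (cvec y) = Complex (c y) (- d y)" if "y \<in> \<Omega>" for y
    using f_has_field_derivative[of "cvec y"] that by (simp add: DERIV_imp_deriv)
  have C: "((\<lambda>x. Re (deriv f (cvec x))) has_derivative (\<lambda>h. Re (P * cvec h))) (at x)"
    using 2 by (rule has_derivative_Re)
  have D: "((\<lambda>x. - Im (deriv f (cvec x))) has_derivative (\<lambda>h. - Im (P * cvec h))) (at x)"
    using 2 by (intro has_derivative_minus has_derivative_Im)
  have "(c has_derivative (\<lambda>h. Re (P * cvec h))) (at x)"
    using C open_Omega assms by (rule has_derivative_transform_within_open) (simp add: eq)
  then show "(c has_derivative (\<lambda>h. third1 x * h $ 1 + third2 x * h $ 2)) (at x)"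
    by (simp add: cvec_def third1_def third2_def P_def)
  have "(d has_derivative (\<lambda>h. - Im (P * cvec h))) (at x)"
    using D open_Omega assms by (rule has_derivative_transform_within_open) (simp add: eq)
  then show "(d has_derivative (\<lambda>h. third2 x * h $ 1 - third1 x * h $ 2)) (at x)"
    by (simp add: cvec_def third1_def third2_def P_def algebra_simps)
qed

lemma third_continuous: "continuous_on \<Omega> third1" "continuous_on \<Omega> third2"
proof -
  have "deriv (deriv f) holomorphic_on rvec -` \<Omega>"
    using f_holomorphic open_rvec_Omega by (intro holomorphic_deriv)
  then have "continuous_on (rvec -` \<Omega>) (deriv (deriv f))" by (rule holomorphic_on_imp_continuous_on)
  then have "continuous_on \<Omega> (\<lambda>x. deriv (deriv f) (cvec x))"
    by (rule continuous_on_compose2) (auto intro: linear_continuous_on bounded_linear_cvec)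
  then show "continuous_on \<Omega> third1" "continuous_on \<Omega> third2"
    unfolding third1_def third2_def by (intro continuous_intros; simp)+
qed

definition Y :: "real^2 \<Rightarrow> real^2" where "Y x = D2 x (G x)"

lemma Y_nth: "Y x $ 1 = c x * a x + d x * b x" "Y x $ 2 = d x * a x - c x * b x"
  by (simp_all add: Y_def D2_def G_def)

lemma Y_continuous: "continuous_on UNIV Y"
  unfolding Y_def D2_def G_def by (simp, intro vector2_continuous continuous_intros cont)

text \<open>Multiplying by the cut-off \<open>Z k\<close> turns the divergence theorem on \<open>\<Omega>\<close> into the vanishing of the integral
  of a derivative over the plane; the boundary term appears as the flux density \<open>q k\<close>.\<close>
lemma cutoff_divergence:
  fixes y \<psi> :: "real^2 \<Rightarrow> real" and W :: "real^2 \<Rightarrow> real^2"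
  assumes y: "continuous_on UNIV y" "\<And>x. x \<in> \<Omega> \<Longrightarrow> (y has_derivative Dy x) (at x)" "continuous_on \<Omega> (\<lambda>x. Dy x v)"
    and \<psi>: "\<And>x. (\<psi> has_derivative (\<lambda>h. W x \<bullet> h)) (at x)" "continuous_on UNIV W"
    and supp: "\<And>x. R < norm x \<Longrightarrow> \<psi> x = 0" "\<And>x. R < norm x \<Longrightarrow> W x = 0"
  shows "integrable lborel (\<lambda>x. Z (real k) x * (\<psi> x * Dy x v + (W x \<bullet> v) * y x))"
    and "(LINT x|lborel. Z (real k) x * (\<psi> x * Dy x v + (W x \<bullet> v) * y x))
      = (LINT x|lborel. q (real k) x * (u x * (G x \<bullet> v) * y x * \<psi> x))"
proof -
  let ?k = "real k"
  have \<psi>_cont: "continuous_on UNIV \<psi>"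
    using \<psi>(1) has_derivative_continuous by (blast intro: continuous_at_imp_continuous_on)
  have Z_cont: "continuous_on UNIV (Z ?k)"
    using Z_derivative has_derivative_continuous by (blast intro: continuous_at_imp_continuous_on)
  define T where "T x = Z ?k x * (\<psi> x * Dy x v + (W x \<bullet> v) * y x)" for x
  define B where "B x = q ?k x * (u x * (G x \<bullet> v) * y x * \<psi> x)" for x
  define V where "V = {x. ?k * w x < 1}"
  have V: "open V" unfolding V_def using w_continuous by (intro open_Collect_less continuous_intros) auto
  have ZV: "Z ?k x = 0" "q ?k x = 0" if "x \<in> V" for x
    using that by (simp_all add: V_def Z_def q_def zeta_values)
  have out: "x \<in> V" if "x \<notin> \<Omega>" for x using w_outside[OF that] by (simp add: V_def)
  have T_cont: "continuous_on UNIV T"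
  proof -
    have sub: "continuous_on \<Omega> h" if "continuous_on UNIV h" for h :: "real^2 \<Rightarrow> real"
      using that by (rule continuous_on_subset) simp
    have "continuous_on \<Omega> T"
      unfolding T_def by (intro continuous_intros y(3) sub[OF Z_cont] sub[OF \<psi>_cont] sub[OF y(1)] continuous_on_subset[OF \<psi>(2)]) auto
    moreover have "continuous_on V T"
      using continuous_on_cong[of V V T "\<lambda>_. 0"] ZV by (simp add: T_def)
    ultimately have "continuous_on (\<Omega> \<union> V) T" using open_Omega V by (intro continuous_on_open_Un)
    moreover have "\<Omega> \<union> V = UNIV" using out by auto
    ultimately show ?thesis by simp
  qed
  have B_cont: "continuous_on UNIV B"
    unfolding B_def by (intro continuous_intros q_continuous cont G_continuous y(1) \<psi>_cont)
  have T_int: "integrable lborel T"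
    by (rule compactly_supported_integrable[OF T_cont, of R]) (simp add: T_def supp)
  then show "integrable lborel (\<lambda>x. Z ?k x * (\<psi> x * Dy x v + (W x \<bullet> v) * y x))"
    unfolding T_def .
  have B_int: "integrable lborel B"
    by (rule compactly_supported_integrable[OF B_cont, of R]) (simp add: B_def supp)
  define h where "h x = Z ?k x * (\<psi> x * y x)" for x
  define D where "D x e = Z ?k x * (\<psi> x * Dy x e + (W x \<bullet> e) * y x) - q ?k x * (u x * (G x \<bullet> e)) * (\<psi> x * y x)" for x e
  define D' where "D' x = (if x \<in> \<Omega> then D x else (\<lambda>_. 0))" for x
  have h_der: "(h has_derivative D' x) (at x)" for x
  proof (cases "x \<in> \<Omega>")
    case True
    have "(h has_derivative (\<lambda>e. Z ?k x * (\<psi> x * Dy x e + (W x \<bullet> e) * y x)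
        + - (q ?k x * (u x * (G x \<bullet> e))) * (\<psi> x * y x))) (at x)"
      unfolding h_def by (intro has_derivative_mult Z_derivative \<psi>(1) y(2) True)
    then show ?thesis using True by (simp add: D'_def D_def[abs_def])
  next
    case False
    have "((\<lambda>_. 0) has_derivative (\<lambda>_. 0)) (at x)" by simp
    then have "(h has_derivative (\<lambda>_. 0)) (at x)"
      using V out[OF False] by (rule has_derivative_transform_within_open) (simp add: h_def ZV)
    then show ?thesis using False by (simp add: D'_def)
  qed
  have D'_eq: "D' x v = T x - B x" for x
  proof (cases "x \<in> \<Omega>")
    case False
    then show ?thesis using ZV[OF out[OF False]] by (simp add: D'_def T_def B_def)
  qed (simp add: D'_def D_def T_def B_def algebra_simps)
  have "(LINT x|lborel. D' x v) = 0"
  proof (rule integral_derivative_eq_0[OF h_der])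
    show "continuous_on UNIV (\<lambda>x. D' x v)" unfolding D'_eq by (intro continuous_intros T_cont B_cont)
    show "h x = 0" if "R < norm x" for x using supp that by (simp add: h_def)
  qed
  then have "(LINT x|lborel. T x) = (LINT x|lborel. B x)"
    unfolding D'_eq using T_int B_int by simp
  then show "(LINT x|lborel. Z ?k x * (\<psi> x * Dy x v + (W x \<bullet> v) * y x))
      = (LINT x|lborel. q ?k x * (u x * (G x \<bullet> v) * y x * \<psi> x))"
    unfolding T_def B_def .
qed

text \<open>The divergence theorem for \<open>\<psi> Y\<close> on \<open>\<Omega>\<close>. The third derivatives cancel in \<open>div Y\<close> because \<open>u\<close> is
  harmonic, and what remains is \<open>|D\<^sup>2u|\<^sup>2 = 2 (c\<^sup>2 + d\<^sup>2)\<close>.\<close>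
lemma curvature_identity:
  fixes \<psi> :: "real^2 \<Rightarrow> real" and W :: "real^2 \<Rightarrow> real^2"
  assumes \<psi>: "\<And>x. (\<psi> has_derivative (\<lambda>h. W x \<bullet> h)) (at x)" "continuous_on UNIV W"
    and supp: "\<And>x. R < norm x \<Longrightarrow> \<psi> x = 0" "\<And>x. R < norm x \<Longrightarrow> W x = 0"
  shows "length_integral (\<lambda>x. H x * \<psi> x) = (LINT x|lborel. indicator \<Omega> x * (2 * ((c x)\<^sup>2 + (d x)\<^sup>2) * \<psi> x + W x \<bullet> Y x))"
proof -
  have \<psi>_cont: "continuous_on UNIV \<psi>"
    using \<psi>(1) has_derivative_continuous by (blast intro: continuous_at_imp_continuous_on)
  define E where "E x = 2 * ((c x)\<^sup>2 + (d x)\<^sup>2) * \<psi> x + W x \<bullet> Y x" for x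
  have E_cont: "continuous_on UNIV E" unfolding E_def by (intro continuous_intros cont \<psi>_cont \<psi>(2) Y_continuous)
  have E_int: "integrable lborel E"
    by (rule compactly_supported_integrable[OF E_cont, of R]) (simp add: E_def supp)
  define e1 e2 :: "real^2" where "e1 = axis 1 1" and "e2 = axis 2 1"
  have e: "v \<bullet> e1 = v $ 1" "v \<bullet> e2 = v $ 2" "e1 $ 1 = 1" "e1 $ 2 = 0" "e2 $ 1 = 0" "e2 $ 2 = 1" for v
    by (simp_all add: e1_def e2_def inner_vec2 axis_def)
  define D1 where "D1 x h = (c x * (c x * h $ 1 + d x * h $ 2) + (third1 x * h $ 1 + third2 x * h $ 2) * a x)
      + (d x * (d x * h $ 1 - c x * h $ 2) + (third2 x * h $ 1 - third1 x * h $ 2) * b x)" for x and h :: "real^2"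
  define D3 where "D3 x h = (d x * (c x * h $ 1 + d x * h $ 2) + (third2 x * h $ 1 - third1 x * h $ 2) * a x)
      - (c x * (d x * h $ 1 - c x * h $ 2) + (third1 x * h $ 1 + third2 x * h $ 2) * b x)" for x and h :: "real^2"
  have Y1: "((\<lambda>x. Y x $ 1) has_derivative D1 x) (at x)" if "x \<in> \<Omega>" for x
    unfolding Y_nth D1_def[abs_def]
    by (intro has_derivative_add has_derivative_mult da db second_derivatives_derivative that)
  have Y2: "((\<lambda>x. Y x $ 2) has_derivative D3 x) (at x)" if "x \<in> \<Omega>" for x
    unfolding Y_nth D3_def[abs_def]
    by (intro has_derivative_diff has_derivative_mult da db second_derivatives_derivative that)
  have sub: "continuous_on \<Omega> h" if "continuous_on UNIV h" for h :: "real^2 \<Rightarrow> real"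
    using that by (rule continuous_on_subset) simp
  have cD: "continuous_on \<Omega> (\<lambda>x. D1 x v)" "continuous_on \<Omega> (\<lambda>x. D3 x v)" for v
    unfolding D1_def D3_def by (intro continuous_intros third_continuous sub[OF cont(2)] sub[OF cont(3)] sub[OF cont(4)] sub[OF cont(5)])+
  have cY: "continuous_on UNIV (\<lambda>x. Y x $ i)" for i using Y_continuous by (intro continuous_intros)
  note d1 = cutoff_divergence[OF cY Y1 cD(1)[of e1] \<psi> supp]
  note d2 = cutoff_divergence[OF cY Y2 cD(2)[of e2] \<psi> supp]
  have div: "D1 x e1 + D3 x e2 = 2 * ((c x)\<^sup>2 + (d x)\<^sup>2)" for x
    by (simp add: D1_def D3_def e power2_eq_square algebra_simps)
  have eq: "flux (\<lambda>x. H x * \<psi> x) k = (LINT x|lborel. Z (real k) x * E x)" for k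
  proof -
    have c1: "continuous_on UNIV (\<lambda>x. u x * (G x \<bullet> v) * Y x $ i * \<psi> x)" for v i
      by (intro continuous_intros cont G_continuous cY \<psi>_cont)
    have i: "integrable lborel (\<lambda>x. q (real k) x * (u x * (G x \<bullet> v) * Y x $ i * \<psi> x))" for v i
      by (rule flux_integrable[OF c1, of R]) (simp add: supp)
    have "(LINT x|lborel. Z (real k) x * E x)
       = (LINT x|lborel. Z (real k) x * (\<psi> x * D1 x e1 + (W x \<bullet> e1) * Y x $ 1) + Z (real k) x * (\<psi> x * D3 x e2 + (W x \<bullet> e2) * Y x $ 2))"
    proof (intro Bochner_Integration.integral_cong refl)
      fix x
      have "E x = (\<psi> x * D1 x e1 + (W x \<bullet> e1) * Y x $ 1) + (\<psi> x * D3 x e2 + (W x \<bullet> e2) * Y x $ 2)"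
        unfolding E_def div[symmetric] by (simp add: e inner_vec2 algebra_simps)
      then show "Z (real k) x * E x = Z (real k) x * (\<psi> x * D1 x e1 + (W x \<bullet> e1) * Y x $ 1) + Z (real k) x * (\<psi> x * D3 x e2 + (W x \<bullet> e2) * Y x $ 2)"
        by (simp only: distrib_left)
    qed
    also have "\<dots> = (LINT x|lborel. q (real k) x * (u x * (G x \<bullet> e1) * Y x $ 1 * \<psi> x))
        + (LINT x|lborel. q (real k) x * (u x * (G x \<bullet> e2) * Y x $ 2 * \<psi> x))"
      using d1(1)[of R k] d2(1)[of R k] d1(2)[of R k] d2(2)[of R k] by simp
    also have "\<dots> = (LINT x|lborel. q (real k) x * (u x * (G x \<bullet> e1) * Y x $ 1 * \<psi> x) + q (real k) x * (u x * (G x \<bullet> e2) * Y x $ 2 * \<psi> x))"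
      using i by simp
    also have "\<dots> = flux (\<lambda>x. H x * \<psi> x) k"
      unfolding flux_def
    proof (intro Bochner_Integration.integral_cong refl)
      fix x
      have "H x = u x * (G x \<bullet> e1) * Y x $ 1 + u x * (G x \<bullet> e2) * Y x $ 2"
        by (simp add: H_def Y_def[symmetric] e inner_vec2[of "Y x"] algebra_simps)
      then show "q (real k) x * (u x * (G x \<bullet> e1) * Y x $ 1 * \<psi> x) + q (real k) x * (u x * (G x \<bullet> e2) * Y x $ 2 * \<psi> x)
          = q (real k) x * (H x * \<psi> x)" by (simp add: algebra_simps)
    qed
    finally show ?thesis ..
  qed
  have "flux (\<lambda>x. H x * \<psi> x) \<longlonglongrightarrow> length_integral (\<lambda>x. H x * \<psi> x)"
    by (rule weak_limit[of _ R]) (use supp in \<open>auto intro!: continuous_intros H_continuous \<psi>_cont\<close>)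
  moreover have "flux (\<lambda>x. H x * \<psi> x) \<longlonglongrightarrow> (LINT x|lborel. indicator \<Omega> x * E x)"
    unfolding eq[abs_def]
  proof (rule integral_dominated_convergence[where w="\<lambda>x. \<bar>E x\<bar>"])
    have [measurable]: "E \<in> borel_measurable borel" by (rule borel_measurable_continuous_onI[OF E_cont])
    have [measurable]: "Z (real k) \<in> borel_measurable borel" for k
      using Z_derivative has_derivative_continuous
      by (blast intro: continuous_at_imp_continuous_on borel_measurable_continuous_onI)
    have [measurable]: "\<Omega> \<in> sets borel" using open_Omega by simp
    show "(\<lambda>x. indicator \<Omega> x * E x) \<in> borel_measurable lborel" by simp
    show "(\<lambda>x. Z (real k) x * E x) \<in> borel_measurable lborel" for k by simp
    show "integrable lborel (\<lambda>x. \<bar>E x\<bar>)" using E_int by simp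
    show "AE x in lborel. (\<lambda>k. Z (real k) x * E x) \<longlonglongrightarrow> indicator \<Omega> x * E x"
    proof (rule AE_I2)
      fix x
      show "(\<lambda>k. Z (real k) x * E x) \<longlonglongrightarrow> indicator \<Omega> x * E x"
      proof (cases "x \<in> \<Omega>")
        case True
        have "\<forall>\<^sub>F k in sequentially. \<forall>y\<in>{x}. q (real k) y = 0 \<and> Z (real k) y = 1"
          by (rule eventually_q_eq_0_on_compact) (use True in auto)
        then have "\<forall>\<^sub>F k in sequentially. Z (real k) x * E x = indicator \<Omega> x * E x"
          by eventually_elim (use True in simp)
        then show ?thesis by (rule tendsto_eventually)
      qed (simp add: Z_outside)
    qed
    show "AE x in lborel. norm (Z (real k) x * E x) \<le> \<bar>E x\<bar>" for k
      using Z_bounds by (intro AE_I2) (simp add: abs_mult mult_left_le_one_le)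
  qed
  ultimately have "length_integral (\<lambda>x. H x * \<psi> x) = (LINT x|lborel. indicator \<Omega> x * E x)" by (rule LIMSEQ_unique)
  then show ?thesis by (simp add: E_def)
qed

text \<open>Stability and \<open>curvature_identity\<close> for \<open>\<psi> = \<phi>\<^sup>2\<close>. The mixed term is absorbed using
  \<open>|Y|\<^sup>2 = (c\<^sup>2 + d\<^sup>2) |G|\<^sup>2 \<le> 16 (c\<^sup>2 + d\<^sup>2)\<close>, which costs 16 times the energy of \<open>\<phi>\<close>.\<close>
lemma hessian_energy_bound:
  assumes stab: "stable_solution u" and tr: "\<Omega> = transition_region u"
    and test: "test_function \<phi>" and \<phi>: "\<And>x. (\<phi> has_derivative (\<lambda>h. W x \<bullet> h)) (at x)" "continuous_on UNIV W"
    and supp: "\<And>x. R < norm x \<Longrightarrow> \<phi> x = 0" "\<And>x. R < norm x \<Longrightarrow> W x = 0"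
  shows "(LINT x|lborel. indicator \<Omega> x * (((c x)\<^sup>2 + (d x)\<^sup>2) * (\<phi> x)\<^sup>2)) \<le> 17 * (LINT x|lborel. (norm (W x))\<^sup>2)"
proof -
  have \<phi>_cont: "continuous_on UNIV \<phi>"
    using \<phi>(1) has_derivative_continuous by (blast intro: continuous_at_imp_continuous_on)
  have grad: "grad \<phi> x = W x" for x by (rule grad_eq[OF \<phi>(1)])
  define E where "E = (LINT x|lborel. (norm (W x))\<^sup>2)"
  have [measurable]: "\<Omega> \<in> sets borel" using open_Omega by simp
  have W2: "integrable lborel (\<lambda>x. (norm (W x))\<^sup>2)"
    by (rule compactly_supported_integrable[of _ R]) (use supp in \<open>auto intro!: continuous_intros \<phi>(2)\<close>)
  have ind: "integrable lborel (\<lambda>x. indicator \<Omega> x * h x)" if h: "integrable lborel h" for h :: "real^2 \<Rightarrow> real"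
    using integrable_mult_indicator[OF _ h, of \<Omega>] by simp
  have S: "(LINT x:frontier \<Omega>|hausdorff1. boundary_curvature \<Omega> x * (\<phi> x)\<^sup>2) \<le> (LINT x:\<Omega>|lborel. (norm (grad \<phi> x))\<^sup>2)"
    using stab test unfolding stable_solution_def Let_def tr by blast
  have "(LINT x:frontier \<Omega>|hausdorff1. boundary_curvature \<Omega> x * (\<phi> x)\<^sup>2) = length_integral (\<lambda>x. H x * (\<phi> x)\<^sup>2)"
    unfolding length_integral_def set_lebesgue_integral_def
    by (intro Bochner_Integration.integral_cong refl) (auto simp: indicator_def boundary_curvature_H)
  moreover have "(LINT x:\<Omega>|lborel. (norm (grad \<phi> x))\<^sup>2) \<le> E"
    unfolding set_lebesgue_integral_def grad E_def
    using ind[OF W2] W2 by (intro integral_mono) (auto simp: indicator_def)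
  moreover have sq: "((\<lambda>x. (\<phi> x)\<^sup>2) has_derivative (\<lambda>h. ((2 * \<phi> x) *\<^sub>R W x) \<bullet> h)) (at x)" for x
    using has_derivative_power[OF \<phi>(1)[of x], of 2] by (simp add: mult_ac)
  have "length_integral (\<lambda>x. H x * (\<phi> x)\<^sup>2)
      = (LINT x|lborel. indicator \<Omega> x * (2 * ((c x)\<^sup>2 + (d x)\<^sup>2) * (\<phi> x)\<^sup>2 + ((2 * \<phi> x) *\<^sub>R W x) \<bullet> Y x))"
    by (rule curvature_identity[OF sq, of R]) (use supp in \<open>auto intro!: continuous_intros \<phi>_cont \<phi>(2)\<close>)
  ultimately have le: "(LINT x|lborel. indicator \<Omega> x * (2 * ((c x)\<^sup>2 + (d x)\<^sup>2) * (\<phi> x)\<^sup>2 + ((2 * \<phi> x) *\<^sub>R W x) \<bullet> Y x)) \<le> E"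
    using S by linarith
  define s where "s x = (c x)\<^sup>2 + (d x)\<^sup>2" for x
  have s0: "0 \<le> s x" for x by (simp add: s_def)
  have ptw: "s x * (\<phi> x)\<^sup>2 - 16 * (norm (W x))\<^sup>2 \<le> 2 * s x * (\<phi> x)\<^sup>2 + ((2 * \<phi> x) *\<^sub>R W x) \<bullet> Y x" if x: "x \<in> \<Omega>" for x
  proof -
    have "(norm (Y x))\<^sup>2 = s x * ((a x)\<^sup>2 + (b x)\<^sup>2)"
      unfolding power2_norm_eq_inner by (simp add: inner_vec2 Y_nth s_def power2_eq_square algebra_simps)
    also have "\<dots> \<le> s x * 16" using gradient_bound[OF x] s0 by (intro mult_left_mono) auto
    finally have Y16: "(norm (Y x))\<^sup>2 \<le> 16 * s x" by simp
    \<comment> \<open>the weight 16 is the bound for \<open>|G|\<^sup>2\<close>: after division by it \<open>|Y|\<^sup>2\<close> contributes \<open>s\<close> with coefficient 1\<close>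
    have "0 \<le> (norm (\<phi> x *\<^sub>R Y x + 16 *\<^sub>R W x))\<^sup>2" by simp
    also have "\<dots> = (\<phi> x)\<^sup>2 * (norm (Y x))\<^sup>2 + 16 * (((2 * \<phi> x) *\<^sub>R W x) \<bullet> Y x) + 256 * (norm (W x))\<^sup>2"
      unfolding power2_norm_eq_inner
      by (simp add: inner_add_left inner_add_right power2_eq_square inner_commute algebra_simps)
    also have "(\<phi> x)\<^sup>2 * (norm (Y x))\<^sup>2 \<le> (\<phi> x)\<^sup>2 * (16 * s x)" using Y16 by (intro mult_left_mono) auto
    finally have "0 \<le> 16 * ((\<phi> x)\<^sup>2 * s x) + 16 * (((2 * \<phi> x) *\<^sub>R W x) \<bullet> Y x) + 256 * (norm (W x))\<^sup>2" by simp
    then have "0 \<le> s x * (\<phi> x)\<^sup>2 + ((2 * \<phi> x) *\<^sub>R W x) \<bullet> Y x + 16 * (norm (W x))\<^sup>2" by (simp add: mult.commute)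
    then show ?thesis by simp
  qed
  have s\<phi>: "integrable lborel (\<lambda>x. s x * (\<phi> x)\<^sup>2)"
    unfolding s_def by (rule compactly_supported_integrable[of _ R]) (use supp in \<open>auto intro!: continuous_intros cont \<phi>_cont\<close>)
  have full: "integrable lborel (\<lambda>x. 2 * s x * (\<phi> x)\<^sup>2 + ((2 * \<phi> x) *\<^sub>R W x) \<bullet> Y x)"
    unfolding s_def by (rule compactly_supported_integrable[of _ R])
      (use supp in \<open>auto intro!: continuous_intros cont \<phi>_cont \<phi>(2) Y_continuous\<close>)
  have "(LINT x|lborel. indicator \<Omega> x * (s x * (\<phi> x)\<^sup>2 - 16 * (norm (W x))\<^sup>2))
      \<le> (LINT x|lborel. indicator \<Omega> x * (2 * s x * (\<phi> x)\<^sup>2 + ((2 * \<phi> x) *\<^sub>R W x) \<bullet> Y x))"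
    by (intro integral_mono ind full Bochner_Integration.integrable_diff s\<phi> integrable_mult_right W2)
      (use ptw in \<open>auto simp: indicator_def\<close>)
  also have "\<dots> \<le> E" using le by (simp add: s_def)
  finally have "(LINT x|lborel. indicator \<Omega> x * (s x * (\<phi> x)\<^sup>2 - 16 * (norm (W x))\<^sup>2)) \<le> E" .
  moreover have "(\<lambda>x. indicator \<Omega> x * (s x * (\<phi> x)\<^sup>2 - 16 * (norm (W x))\<^sup>2))
      = (\<lambda>x. indicator \<Omega> x * (s x * (\<phi> x)\<^sup>2) - 16 * (indicator \<Omega> x * (norm (W x))\<^sup>2))"
    by (simp add: fun_eq_iff algebra_simps)
  moreover have "(LINT x|lborel. indicator \<Omega> x * (s x * (\<phi> x)\<^sup>2) - 16 * (indicator \<Omega> x * (norm (W x))\<^sup>2))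
      = (LINT x|lborel. indicator \<Omega> x * (s x * (\<phi> x)\<^sup>2)) - 16 * (LINT x|lborel. indicator \<Omega> x * (norm (W x))\<^sup>2)"
    using ind[OF s\<phi>] integrable_mult_right[OF ind[OF W2], of 16]
    by (subst Bochner_Integration.integral_diff) simp_all
  ultimately have "(LINT x|lborel. indicator \<Omega> x * (s x * (\<phi> x)\<^sup>2)) - 16 * (LINT x|lborel. indicator \<Omega> x * (norm (W x))\<^sup>2) \<le> E"
    by simp
  moreover have "(LINT x|lborel. indicator \<Omega> x * (norm (W x))\<^sup>2) \<le> E"
    unfolding E_def using ind[OF W2] W2 by (intro integral_mono) (auto simp: indicator_def)
  ultimately show ?thesis by (simp add: s_def E_def)
qed

text \<open>If the Hessian did not vanish at \<open>x0\<close>, its energy in a small disc would be a positive number \<open>m\<close>,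
  while the cut-offs centred at \<open>x0\<close> bound it by a multiple of \<open>1 / N\<close> for every \<open>N\<close>.\<close>
lemma hessian_zero:
  assumes stab: "stable_solution u" and tr: "\<Omega> = transition_region u" and x0: "x0 \<in> \<Omega>"
  shows "c x0 = 0 \<and> d x0 = 0"
proof (rule ccontr)
  assume "\<not> (c x0 = 0 \<and> d x0 = 0)"
  define s where "s x = (c x)\<^sup>2 + (d x)\<^sup>2" for x
  have s0: "0 \<le> s x" for x by (simp add: s_def)
  have pos: "0 < s x0" using \<open>\<not> _\<close> by (auto simp: s_def sum_power2_gt_zero_iff)
  have s_cont: "continuous_on UNIV s" unfolding s_def by (intro continuous_intros cont)
  then have "isCont s x0" by (simp add: continuous_on_eq_continuous_at)
  then obtain \<delta>1 where \<delta>1: "0 < \<delta>1" "\<And>x. dist x x0 < \<delta>1 \<Longrightarrow> dist (s x) (s x0) < s x0 / 2"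
    unfolding continuous_at_eps_delta using pos by (metis half_gt_zero)
  obtain \<delta>2 where \<delta>2: "0 < \<delta>2" "ball x0 \<delta>2 \<subseteq> \<Omega>" using open_Omega x0 open_contains_ball by metis
  define \<delta> where "\<delta> = min (min \<delta>1 \<delta>2) 1"
  have \<delta>: "0 < \<delta>" "\<delta> \<le> \<delta>1" "\<delta> \<le> \<delta>2" "\<delta> \<le> 1" using \<delta>1 \<delta>2 by (auto simp: \<delta>_def)
  define m where "m = s x0 / 2 * measure lborel (ball x0 \<delta>)"
  have mpos: "0 < m"
  proof -
    have "0 < measure lborel (ball x0 \<delta>)"
      using \<delta>(1) by (simp add: content_ball)
    then show ?thesis using pos by (simp add: m_def)
  qed
  obtain C where C: "\<And>N::nat. 0 < N \<Longrightarrow> \<exists>\<phi> w. test_function \<phi> \<and> (\<forall>x. 0 \<le> \<phi> x \<and> \<phi> x \<le> 1) \<and>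
     (\<forall>x. dist x x0 \<le> 1 \<longrightarrow> \<phi> x = 1) \<and> continuous_on UNIV w \<and>
     (\<forall>x. (\<phi> has_derivative (\<lambda>h. w x \<bullet> h)) (at x)) \<and>
     (\<exists>R. \<forall>x. R < norm x \<longrightarrow> \<phi> x = 0 \<and> w x = 0) \<and>
     integrable lborel (\<lambda>x. (norm (w x))\<^sup>2) \<and> (LINT x|lborel. (norm (w x))\<^sup>2) \<le> C / real N"
    by (rule log_cutoff[of x0]) (rule that)
  have le: "m \<le> 17 * (C / real N)" if N: "0 < N" for N :: nat
  proof -
    obtain \<phi> W R where tf: "test_function \<phi>" and \<phi>1: "\<forall>x. dist x x0 \<le> 1 \<longrightarrow> \<phi> x = 1" and Wc: "continuous_on UNIV W"
      and der: "\<forall>x. (\<phi> has_derivative (\<lambda>h. W x \<bullet> h)) (at x)" and R': "\<forall>x. R < norm x \<longrightarrow> \<phi> x = 0 \<and> W x = 0"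
      and E: "(LINT x|lborel. (norm (W x))\<^sup>2) \<le> C / real N"
      using C[OF N] by (elim exE conjE) (rule that)
    from R' have R: "\<And>x. R < norm x \<Longrightarrow> \<phi> x = 0" "\<And>x. R < norm x \<Longrightarrow> W x = 0" by simp_all
    have \<phi>_cont: "continuous_on UNIV \<phi>"
      using der has_derivative_continuous by (blast intro: continuous_at_imp_continuous_on)
    have [measurable]: "\<Omega> \<in> sets borel" using open_Omega by simp
    have "integrable lborel (\<lambda>x. s x * (\<phi> x)\<^sup>2)"
      by (rule compactly_supported_integrable[of _ R]) (use R in \<open>auto intro!: continuous_intros s_cont \<phi>_cont\<close>)
    then have i2: "integrable lborel (\<lambda>x. indicator \<Omega> x * (s x * (\<phi> x)\<^sup>2))"
      using integrable_mult_indicator[of \<Omega> lborel "\<lambda>x. s x * (\<phi> x)\<^sup>2"] by simp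
    have i1: "integrable lborel (\<lambda>x. s x0 / 2 * indicator (ball x0 \<delta>) x)"
      using \<delta>(1) by (intro integrable_mult_right integrable_real_indicator) (auto simp: emeasure_ball)
    have "m = (LINT x|lborel. s x0 / 2 * indicator (ball x0 \<delta>) x)" by (simp add: m_def)
    also have "\<dots> \<le> (LINT x|lborel. indicator \<Omega> x * (s x * (\<phi> x)\<^sup>2))"
    proof (rule integral_mono[OF i1 i2])
      fix x
      show "s x0 / 2 * indicator (ball x0 \<delta>) x \<le> indicator \<Omega> x * (s x * (\<phi> x)\<^sup>2)"
      proof (cases "x \<in> ball x0 \<delta>")
        case True
        then have dx: "dist x x0 < \<delta>" by (simp add: dist_commute)
        then have "x \<in> \<Omega>" using \<delta>2(2) \<delta>(3) by (auto simp: dist_commute)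
        moreover have "\<phi> x = 1" using \<phi>1 dx \<delta>(4) by simp
        moreover have "s x0 / 2 \<le> s x" using \<delta>1(2)[of x] dx \<delta>(2) unfolding dist_real_def by linarith
        ultimately show ?thesis using True by simp
      qed (use s0 in auto)
    qed
    also have "\<dots> \<le> 17 * (LINT x|lborel. (norm (W x))\<^sup>2)"
      unfolding s_def using der by (intro hessian_energy_bound[OF stab tr tf _ Wc R]) auto
    also have "\<dots> \<le> 17 * (C / real N)" using E by simp
    finally show ?thesis .
  qed
  obtain N :: nat where N: "17 * C / m < real N" using reals_Archimedean2 by blast
  define N' where "N' = Suc N"
  have "17 * C / m < real N'" using N by (simp add: N'_def)
  then have "17 * C < m * real N'" using mpos by (simp add: field_simps)
  moreover have "m * real N' \<le> 17 * C" using le[of N'] by (simp add: N'_def field_simps)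
  ultimately show False by simp
qed

section \<open>Components are parallel strips\<close>

lemma component_affine:
  assumes cd: "\<And>x. x \<in> \<Omega> \<Longrightarrow> c x = 0 \<and> d x = 0" and x: "x \<in> \<Omega>" and y: "y \<in> connected_component_set \<Omega> x"
  shows "G y = G x" and "u y = u x + G x \<bullet> (y - x)"
proof -
  define C where "C = connected_component_set \<Omega> x"
  have C: "open C" "connected C" "C \<subseteq> \<Omega>" "x \<in> C" "y \<in> C"
    using open_connected_component[OF open_Omega] connected_component_subset[of \<Omega> x] x y
    by (auto simp: C_def connected_connected_component)
  have Gz: "G z = G x" if z: "z \<in> C" for z
  proof -
    have "a z = a x"
      by (rule has_derivative_zero_unique_connected[OF C(1,2) _ z C(4)]) (use da cd C(3) in fastforce)
    moreover have "b z = b x"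
      by (rule has_derivative_zero_unique_connected[OF C(1,2) _ z C(4)]) (use db cd C(3) in fastforce)
    ultimately show ?thesis by (simp add: G_def)
  qed
  show "G y = G x" by (rule Gz[OF C(5)])
  have "u y - G x \<bullet> y = u x - G x \<bullet> x"
  proof (rule has_derivative_zero_unique_connected[OF C(1,2) _ C(5,4)])
    fix z assume z: "z \<in> C"
    have "((\<lambda>z. u z - G x \<bullet> z) has_derivative (\<lambda>v. G z \<bullet> v - G x \<bullet> v)) (at z)"
      using z C(3) by (intro has_derivative_diff du_G bounded_linear_imp_has_derivative bounded_linear_inner_right) auto
    then show "((\<lambda>z. u z - G x \<bullet> z) has_derivative (\<lambda>v. 0)) (at z)" using Gz[OF z] by simp
  qed
  then show "u y = u x + G x \<bullet> (y - x)" by (simp add: inner_diff_right)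
qed

text \<open>The components of an open set are open, so a boundary point of one component lies in no other.\<close>
lemma component_frontier:
  assumes x: "x \<in> \<Omega>" and y: "y \<in> frontier (connected_component_set \<Omega> x)"
  shows "y \<in> frontier \<Omega>"
proof -
  define C where "C = connected_component_set \<Omega> x"
  have C: "open C" "C \<subseteq> \<Omega>"
    using open_connected_component[OF open_Omega] connected_component_subset[of \<Omega> x] by (auto simp: C_def)
  have yC: "y \<in> closure C" "y \<notin> C" using y C(1) by (auto simp: C_def frontier_def interior_open)
  have "y \<notin> \<Omega>"
  proof
    assume "y \<in> \<Omega>"
    then have "open (connected_component_set \<Omega> y)" "y \<in> connected_component_set \<Omega> y"
      using open_connected_component[OF open_Omega] by auto
    then have "connected_component_set \<Omega> y \<inter> C \<noteq> {}"
      using yC(1) open_Int_closure_eq_empty[of "connected_component_set \<Omega> y" C] by blast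
    then have "connected_component_set \<Omega> y = C"
      unfolding C_def using connected_component_nonoverlap[of \<Omega> y x] by blast
    then show False using yC(2) \<open>y \<in> connected_component_set \<Omega> y\<close> by simp
  qed
  then show ?thesis using yC(1) closure_mono[OF C(2)] open_Omega by (auto simp: frontier_def interior_open)
qed

text \<open>A component on which \<open>u\<close> is affine, other than the whole plane, is a strip: inside the strip
  \<open>u\<close> cannot take the values 1 and -1, so the component has no boundary there.\<close>
lemma component_strip:
  assumes cd: "\<And>x. x \<in> \<Omega> \<Longrightarrow> c x = 0 \<and> d x = 0" and x: "x \<in> \<Omega>"
    and ne: "connected_component_set \<Omega> x \<noteq> UNIV"
  shows "norm (G x) = 1"
    and "\<And>y. -1 < u x + G x \<bullet> (y - x) \<Longrightarrow> u x + G x \<bullet> (y - x) < 1 \<Longrightarrow> y \<in> connected_component_set \<Omega> x"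
proof -
  define C where "C = connected_component_set \<Omega> x"
  define l where "l y = u x + G x \<bullet> (y - x)" for y
  have l_cont: "continuous_on UNIV l" unfolding l_def by (intro continuous_intros)
  have xC: "x \<in> C" using x by (simp add: C_def)
  have onC: "G y = G x" "u y = l y" if "y \<in> C" for y
    using component_affine[OF cd x] that by (auto simp: C_def l_def)
  have onF: "G y = G x \<and> u y = l y" if y: "y \<in> closure C" for y
  proof
    have "(\<lambda>y. norm (G y - G x)) y = 0"
      by (rule continuous_constant_on_closure[of C "\<lambda>y. norm (G y - G x)" 0 y])
        (use y onC in \<open>auto intro!: continuous_intros continuous_on_subset[OF G_continuous]\<close>)
    then show "G y = G x" by simp
    have "(\<lambda>y. u y - l y) y = 0"
      by (rule continuous_constant_on_closure[of C "\<lambda>y. u y - l y" 0 y])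
        (use y onC in \<open>auto intro!: continuous_intros continuous_on_subset[OF cont(1)] continuous_on_subset[OF l_cont]\<close>)
    then show "u y = l y" by simp
  qed
  have "C \<noteq> UNIV" "C \<noteq> {}" using ne xC by (unfold C_def, blast+)
  then have "frontier C \<noteq> {}" using frontier_eq_empty[of C] by blast
  then obtain z where z: "z \<in> frontier C" by blast
  then have "z \<in> frontier \<Omega>" "G z = G x"
    using component_frontier[OF x] onF[of z] by (auto simp: C_def frontier_def)
  then show "norm (G x) = 1" using norm_G_frontier[of z] by (simp add: norm_eq_1)
  fix y assume y: "-1 < u x + G x \<bullet> (y - x)" "u x + G x \<bullet> (y - x) < 1"
  define S where "S = {y. l y \<in> {-1<..<1}}"
  have "S = {y. - 1 - u x + G x \<bullet> x < G x \<bullet> y} \<inter> {y. G x \<bullet> y < 1 - u x + G x \<bullet> x}"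
    by (auto simp: S_def l_def inner_diff_right)
  then have "convex S"
    using convex_halfspace_gt[of "- 1 - u x + G x \<bullet> x" "G x"] convex_halfspace_lt[of "G x" "1 - u x + G x \<bullet> x"]
    by (simp add: convex_Int)
  then have "connected S" by (rule convex_connected)
  moreover have "x \<in> S" using x by (simp add: S_def l_def Omega)
  moreover have "S \<inter> frontier C = {}"
  proof -
    have False if w: "w \<in> S" "w \<in> frontier C" for w
    proof -
      have "u w = 1 \<or> u w = -1" using w(2) component_frontier[OF x] frontier_value by (simp add: C_def)
      moreover have "u w = l w" using onF[of w] w(2) by (simp add: frontier_def)
      ultimately show False using w(1) by (auto simp: S_def)
    qed
    then show ?thesis by blast
  qed
  ultimately have "S \<subseteq> C" using connected_Int_frontier[of S C] xC by blast
  moreover have "y \<in> S" using y by (simp add: S_def l_def)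
  ultimately show "y \<in> connected_component_set \<Omega> x" by (auto simp: C_def)
qed

text \<open>If a component is the whole plane, \<open>u\<close> is bounded and affine, hence constant. Otherwise all components
  are parallel strips. A line in their direction lies in one strip, where \<open>u\<close> is constant on it, or in
  the complement of \<open>\<Omega>\<close>, where \<open>u\<close> is continuous with values 1 and -1.\<close>
lemma one_dimensional:
  assumes cd: "\<And>x. x \<in> \<Omega> \<Longrightarrow> c x = 0 \<and> d x = 0"
  shows "\<exists>e. norm e = 1 \<and> (\<exists>g. \<forall>x. u x = g (x \<bullet> e))"
proof -
  have const_case: ?thesis if k: "\<And>x. u x = k" for k
    by (rule exI[of _ "axis 1 1"]) (use k in \<open>auto intro!: exI[of _ "\<lambda>_. k"]\<close>)
  have two_valued: "u (x + t *\<^sub>R v) = u x" if out: "\<And>s. x + s *\<^sub>R v \<notin> \<Omega>" for x v t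
  proof -
    have "connected ((\<lambda>s. u (x + s *\<^sub>R v)) ` UNIV)"
      by (intro connected_continuous_image continuous_on_compose2[OF cont(1)] continuous_intros) auto
    moreover have "(\<lambda>s. u (x + s *\<^sub>R v)) ` UNIV \<subseteq> {1, -1}" using outside[OF out] by auto
    then have "finite ((\<lambda>s. u (x + s *\<^sub>R v)) ` UNIV)" by (rule finite_subset) simp
    ultimately have "(\<lambda>s. u (x + s *\<^sub>R v)) ` UNIV = {} \<or> (\<exists>k. (\<lambda>s. u (x + s *\<^sub>R v)) ` UNIV = {k})"
      by (simp add: connected_finite_iff_sing)
    then obtain k where k: "(\<lambda>s. u (x + s *\<^sub>R v)) ` UNIV = {k}" by blast
    have "u (x + s *\<^sub>R v) = k" for s using k by blast
    from this[of t] this[of 0] show ?thesis by simp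
  qed
  show ?thesis
  proof (cases "\<Omega> = {}")
    case True
    have "u x = u 0" for x using two_valued[of 0 x 1] True by simp
    then show ?thesis by (rule const_case)
  next
    case False
    then obtain x0 where x0: "x0 \<in> \<Omega>" by blast
    show ?thesis
    proof (cases "\<exists>x\<in>\<Omega>. connected_component_set \<Omega> x = UNIV")
      case True
      then obtain x where x: "x \<in> \<Omega>" "connected_component_set \<Omega> x = UNIV" by blast
      have aff: "u y = u x + G x \<bullet> (y - x)" for y
        using component_affine(2)[OF cd x(1), of y] x(2) by simp
      have all: "y \<in> \<Omega>" for y using x(2) connected_component_subset[of \<Omega> x] by blast
      have "G x = 0"
      proof (rule ccontr)
        assume ne: "G x \<noteq> 0"
        define t where "t = 2 / (G x \<bullet> G x)"
        have "u (x + t *\<^sub>R G x) = u x + 2" using aff[of "x + t *\<^sub>R G x"] ne by (simp add: t_def)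
        moreover have "u (x + t *\<^sub>R G x) < 1" "-1 < u x" using all by (auto simp: Omega)
        ultimately show False by simp
      qed
      then have "u y = u x" for y using aff[of y] by simp
      then show ?thesis by (rule const_case)
    next
      case False
      then have ne: "\<And>x. x \<in> \<Omega> \<Longrightarrow> connected_component_set \<Omega> x \<noteq> UNIV" by blast
      have strip1: "norm (G x) = 1" if "x \<in> \<Omega>" for x
        by (rule component_strip(1)) (use cd ne that in auto)
      have strip2: "y \<in> connected_component_set \<Omega> x"
        if "x \<in> \<Omega>" "-1 < u x + G x \<bullet> (y - x)" "u x + G x \<bullet> (y - x) < 1" for x y
        by (rule component_strip(2)) (use cd ne that in auto)
      define e where "e = G x0"
      have e: "norm e = 1" unfolding e_def by (rule strip1[OF x0])
      \<comment> \<open>two strips that are not parallel would intersect\<close>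
      have par: "G x \<bullet> perp e = 0" if x: "x \<in> \<Omega>" for x
      proof (rule ccontr)
        assume np: "G x \<bullet> perp e \<noteq> 0"
        define s where "s = (G x \<bullet> (x - x0)) / (G x \<bullet> perp e)"
        define y where "y = x0 + s *\<^sub>R perp e"
        have "G x \<bullet> (y - x) = 0" using np by (simp add: y_def s_def inner_diff_right inner_add_right)
        then have y1: "y \<in> connected_component_set \<Omega> x"
          using strip2[OF x, of y] x by (simp add: Omega)
        have "e \<bullet> (y - x0) = 0" by (simp add: y_def perp)
        then have y2: "y \<in> connected_component_set \<Omega> x0"
          using strip2[OF x0, of y] x0 by (simp add: Omega e_def)
        have "G x = e"
          using component_affine(1)[OF cd x y1] component_affine(1)[OF cd x0 y2] by (simp add: e_def)
        then show False using np by (simp add: perp)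
      qed
      have inside: "x + t *\<^sub>R perp e \<in> \<Omega> \<and> u (x + t *\<^sub>R perp e) = u x" if x: "x \<in> \<Omega>" for x t
      proof -
        let ?y = "x + t *\<^sub>R perp e"
        have 0: "G x \<bullet> (?y - x) = 0" using par[OF x] by simp
        have y: "?y \<in> connected_component_set \<Omega> x"
        proof (rule strip2[OF x])
          show "-1 < u x + G x \<bullet> (?y - x)" "u x + G x \<bullet> (?y - x) < 1"
            unfolding 0 using x by (simp_all add: Omega)
        qed
        have "?y \<in> \<Omega>" using y connected_component_subset[of \<Omega> x] by blast
        moreover have "u ?y = u x" using component_affine(2)[OF cd x y] 0 by simp
        ultimately show ?thesis by simp
      qed
      have inv: "u (x + t *\<^sub>R perp e) = u x" for x t
      proof (cases "x \<in> \<Omega>")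
        case False
        have "x + s *\<^sub>R perp e \<notin> \<Omega>" for s
        proof
          assume "x + s *\<^sub>R perp e \<in> \<Omega>"
          then have "x + s *\<^sub>R perp e + (- s) *\<^sub>R perp e \<in> \<Omega>" using inside by blast
          then show False using False by simp
        qed
        then show ?thesis by (rule two_valued)
      qed (use inside in blast)
      have "u x = u ((x \<bullet> e) *\<^sub>R e)" for x
      proof -
        have "0 + (x \<bullet> perp e) *\<^sub>R perp e + (x \<bullet> e) *\<^sub>R e = x"
          using pt_coordinates[OF e, of 0 x] unfolding pt_def diff_zero .
        then have "(x \<bullet> e) *\<^sub>R e + (x \<bullet> perp e) *\<^sub>R perp e = x" by (metis add.commute add_0)
        then show ?thesis using inv[of "(x \<bullet> e) *\<^sub>R e" "x \<bullet> perp e"] by metis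
      qed
      then show ?thesis using e by (intro exI[of _ e] conjI exI[of _ "\<lambda>s. u (s *\<^sub>R e)"]) auto
    qed
  qed
qed

end

theorem theorem1p2:
  fixes u :: "real^2 \<Rightarrow> real"
  assumes "classical_solution u" and "stable_solution u"
  shows "\<exists>e. norm e = 1 \<and> (\<exists>g :: real \<Rightarrow> real. \<forall>x. u x = g (x \<bullet> e))"
proof -
  obtain a b c d where "free_boundary u a b c d (transition_region u)"
    by (rule classical_solution_free_boundary[OF assms(1)])
  then interpret free_boundary u a b c d "transition_region u" .
  show ?thesis
    by (rule one_dimensional) (rule hessian_zero[OF assms(2) refl])
qed

end
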